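(* Let $\Sigma\subset\mathbb{H}$ be a real-analytic embedded surface in the Heisenberg group $\mathbb{H}$. Assume that all characteristic points of $\Sigma$ are isolated. Then the horizontal mean curvature $\mathcal{H}$ of $\Sigma$ satisfies $$\mathcal{H}\in L^1_{\mathrm{loc}}(\Sigma,\sigma_{\mathrm{R}}),$$ where $\sigma_{\mathrm{R}}$ denotes the Riemannian induced measure on $\Sigma$.
   Context: The Heisenberg group $\mathbb{H}$ is $\mathbb{R}^3$ with the distribution $\mathcal{D}=\ker\left(dz-\frac12(x\,dy-y\,dx)\right)$ and the metric $g$ on $\mathcal{D}$ for which $X=\partial_x-\frac y2\partial_z$, $Y=\partial_y+\frac x2\partial_z$ is an orthonormal frame. It is equipped with the Lebesgue measure $\mu$. Horizontal gradient: $\nabla f=(Xf)X+(Yf)Y$, with norm $\|\nabla f\|=\left((Xf)^2+(Yf)^2\right)^{1/2}$. The divergence $\mathrm{div}_\mu$ is with respect to Lebesgue measure. A local defining function for $\Sigma$ near $p\in\Sigma$ is a function $u$ of class at least $C^2$ on a neighborhood $U$ of $p$ with $\Sigma\cap U=\{u=0\}$ and $du\neq0$ on $\Sigma\cap U$. Characteristic points: $p\in\Sigma$ is characteristic if $\mathcal{D}_p\subseteq T_p\Sigma$, equivalently $Xu(p)=Yu(p)=0$. The set of characteristic points is $C(\Sigma)$ (closed, zero measure in $\Sigma$); $p$ is isolated if it is an isolated point of $C(\Sigma)$. Horizontal mean curvature: for $p\in\Sigma\setminus C(\Sigma)$, $\mathcal{H}(p)=-\mathrm{div}_\mu\left(\frac{\nabla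 u}{\|\nabla u\|}\right)\big|_p$ with $u$ a local defining function for $\Sigma$ near $p$; up to sign it does not depend on $u$. Riemannian induced measure: choose any Riemannian metric on $\mathbb{R}^3$ extending $g$, and let $n$ be the corresponding unit normal to $\Sigma$; $\sigma_{\mathrm{R}}$ is the measure on $\Sigma$ with density $|i_n\mu|$. The choice of extension plays no role in the integrability statement. $f\in L^1_{\mathrm{loc}}(\Sigma,\sigma_{\mathrm{R}})$ means that every point of $\Sigma$ has a neighborhood in $\Sigma$ on which $|f|$ is $\sigma_{\mathrm{R}}$-integrable. *)

theory Defs
  imports "HOL-Analysis.Analysis"
begin

section \<open>Regularity of functions of several variables\<close>

text \<open>Only meant for open \<open>U\<close>: \<open>f\<close> is \<open>k\<close> times continuously differentiable on \<open>U\<close>.\<close>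

fun C_on :: "nat \<Rightarrow> ('a::euclidean_space \<Rightarrow> 'b::real_normed_vector) \<Rightarrow> 'a set \<Rightarrow> bool" where
  "C_on 0 f U \<longleftrightarrow> continuous_on U f"
| "C_on (Suc k) f U \<longleftrightarrow> (\<forall>p\<in>U. f differentiable (at p)) \<and>
     (\<forall>v. C_on k (\<lambda>p. frechet_derivative f (at p) v) U)"

definition smooth_on :: "('a::euclidean_space \<Rightarrow> 'b::real_normed_vector) \<Rightarrow> 'a set \<Rightarrow> bool" where
  "smooth_on f U \<longleftrightarrow> (\<forall>k. C_on k f U)"

text \<open>Here \<open>\<alpha>\<close> ranges over all multi-indices.\<close>

definition real_analytic_on :: "(real ^ 'n \<Rightarrow> real) \<Rightarrow> (real ^ 'n) set \<Rightarrow> bool" where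
  "real_analytic_on f U \<longleftrightarrow>
     (\<forall>p\<in>U. \<exists>(a :: ('n \<Rightarrow> nat) \<Rightarrow> real) r. r > 0 \<and>
        (\<forall>q\<in>ball p r. ((\<lambda>\<alpha>. a \<alpha> * (\<Prod>i\<in>UNIV. (q $ i - p $ i) ^ \<alpha> i)) has_sum f q) UNIV))"

section \<open>The Heisenberg group\<close>

definition X_field :: "real ^ 3 \<Rightarrow> real ^ 3" where
  "X_field p = vector [1, 0, - (p $ 2) / 2]"

definition Y_field :: "real ^ 3 \<Rightarrow> real ^ 3" where
  "Y_field p = vector [0, 1, p $ 1 / 2]"

definition horizontal_space :: "real ^ 3 \<Rightarrow> (real ^ 3) set" where
  "horizontal_space p = {v. v $ 3 - (p $ 1 * v $ 2 - p $ 2 * v $ 1) / 2 = 0}"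

definition dir_deriv :: "(real ^ 3 \<Rightarrow> real ^ 3) \<Rightarrow> (real ^ 3 \<Rightarrow> real) \<Rightarrow> real ^ 3 \<Rightarrow> real" where
  "dir_deriv V f p = frechet_derivative f (at p) (V p)"

definition horizontal_gradient :: "(real ^ 3 \<Rightarrow> real) \<Rightarrow> real ^ 3 \<Rightarrow> real ^ 3" where
  "horizontal_gradient f p =
     dir_deriv X_field f p *\<^sub>R X_field p + dir_deriv Y_field f p *\<^sub>R Y_field p"

text \<open>
  The norm of the horizontal gradient with respect to the sub-Riemannian metric; it differs from
  the Euclidean norm of the vector.
\<close>

definition horizontal_gradient_norm :: "(real ^ 3 \<Rightarrow> real) \<Rightarrow> real ^ 3 \<Rightarrow> real" where
  "horizontal_gradient_norm f p =
     sqrt ((dir_deriv X_field f p)\<^sup>2 + (dir_deriv Y_field f p)\<^sup>2)"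

definition divergence :: "(real ^ 3 \<Rightarrow> real ^ 3) \<Rightarrow> real ^ 3 \<Rightarrow> real" where
  "divergence V p = (\<Sum>i\<in>UNIV. frechet_derivative V (at p) (axis i 1) $ i)"

section \<open>Surfaces\<close>

definition local_defining_function ::
  "(real ^ 3) set \<Rightarrow> real ^ 3 \<Rightarrow> (real ^ 3) set \<Rightarrow> (real ^ 3 \<Rightarrow> real) \<Rightarrow> bool" where
  "local_defining_function S p U u \<longleftrightarrow>
     open U \<and> p \<in> U \<and> C_on 2 u U \<and> S \<inter> U = {q \<in> U. u q = 0} \<and>
     (\<forall>q \<in> S \<inter> U. frechet_derivative u (at q) \<noteq> (\<lambda>v. 0))"

definition analytic_surface :: "(real ^ 3) set \<Rightarrow> bool" where
  "analytic_surface S \<longleftrightarrow>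
     (\<forall>p\<in>S. \<exists>U u. local_defining_function S p U u \<and> real_analytic_on u U)"

text \<open>
  Velocities of curves in \<open>S\<close> through \<open>p\<close>. For an embedded surface it does not matter that the
  curves are only required to be differentiable at the base point.
\<close>

definition tangent_space :: "(real ^ 3) set \<Rightarrow> real ^ 3 \<Rightarrow> (real ^ 3) set" where
  "tangent_space S p = {v. \<exists>(\<gamma> :: real \<Rightarrow> real ^ 3) e. e > 0 \<and> (\<forall>t. \<bar>t\<bar> < e \<longrightarrow> \<gamma> t \<in> S) \<and>
     \<gamma> 0 = p \<and> (\<gamma> has_vector_derivative v) (at 0)}"

definition characteristic_set :: "(real ^ 3) set \<Rightarrow> (real ^ 3) set" where
  "characteristic_set S = {p \<in> S. horizontal_space p \<subseteq> tangent_space S p}"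

text \<open>
  The horizontal mean curvature is determined only up to sign and only off the characteristic set,
  so it is a predicate on functions \<open>H\<close>: the sign may be chosen separately at each point, and the
  values of \<open>H\<close> at characteristic points are unconstrained.
\<close>

definition is_horizontal_mean_curvature :: "(real ^ 3) set \<Rightarrow> (real ^ 3 \<Rightarrow> real) \<Rightarrow> bool" where
  "is_horizontal_mean_curvature S H \<longleftrightarrow>
     (\<forall>p \<in> S - characteristic_set S. \<exists>U u. local_defining_function S p U u \<and>
        H p = - divergence (\<lambda>q. horizontal_gradient u q /\<^sub>R horizontal_gradient_norm u q) p)"

section \<open>The Riemannian induced measure\<close>

definition riemannian_metric :: "(real ^ 3 \<Rightarrow> real ^ 3 \<Rightarrow> real ^ 3 \<Rightarrow> real) \<Rightarrow> bool" where
  "riemannian_metric G \<longleftrightarrow>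
     (\<forall>p. bilinear (G p) \<and> (\<forall>v w. G p v w = G p w v) \<and> (\<forall>v. v \<noteq> 0 \<longrightarrow> G p v v > 0)) \<and>
     (\<forall>v w. smooth_on (\<lambda>p. G p v w) UNIV)"

text \<open>\<open>X_field p\<close>, \<open>Y_field p\<close> is a basis of the distribution at \<open>p\<close>, and the sub-Riemannian metric
  is the one for which it is orthonormal.\<close>

definition extends_heisenberg_metric :: "(real ^ 3 \<Rightarrow> real ^ 3 \<Rightarrow> real ^ 3 \<Rightarrow> real) \<Rightarrow> bool" where
  "extends_heisenberg_metric G \<longleftrightarrow>
     (\<forall>p. G p (X_field p) (X_field p) = 1 \<and> G p (Y_field p) (Y_field p) = 1 \<and>
          G p (X_field p) (Y_field p) = 0)"

text \<open>No continuity of the sign is required, so such a field exists also if \<open>S\<close> is not orientable.\<close>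

definition unit_normal_field ::
  "(real ^ 3 \<Rightarrow> real ^ 3 \<Rightarrow> real ^ 3 \<Rightarrow> real) \<Rightarrow> (real ^ 3) set \<Rightarrow> (real ^ 3 \<Rightarrow> real ^ 3) \<Rightarrow> bool" where
  "unit_normal_field G S n \<longleftrightarrow>
     (\<forall>p\<in>S. G p (n p) (n p) = 1 \<and> (\<forall>v \<in> tangent_space S p. G p (n p) v = 0))"

definition surface_chart :: "(real ^ 3) set \<Rightarrow> (real ^ 2) set \<Rightarrow> (real ^ 2 \<Rightarrow> real ^ 3) \<Rightarrow> bool" where
  "surface_chart S V \<phi> \<longleftrightarrow>
     open V \<and> C_on 1 \<phi> V \<and> (\<forall>x\<in>V. inj (frechet_derivative \<phi> (at x))) \<and>
     openin (top_of_set S) (\<phi> ` V) \<and> (\<exists>\<psi>. homeomorphism V (\<phi> ` V) \<phi> \<psi>)"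

text \<open>
  The Borel measure on \<open>S\<close> with density \<open>|i_n \<mu>|\<close>. Since \<open>\<mu>\<close> is Lebesgue measure,
  \<open>|i_n \<mu>|(v, w) = |det (n, v, w)|\<close>; the density does not depend on the sign of \<open>n\<close>. Countably many
  charts cover \<open>S\<close>, so the values on subsets of chart domains determine the measure.
\<close>

definition is_riemannian_induced_measure ::
  "(real ^ 3 \<Rightarrow> real ^ 3 \<Rightarrow> real ^ 3 \<Rightarrow> real) \<Rightarrow> (real ^ 3) set \<Rightarrow> (real ^ 3) measure \<Rightarrow> bool" where
  "is_riemannian_induced_measure G S \<sigma> \<longleftrightarrow>
     space \<sigma> = S \<and> sets \<sigma> = sets (restrict_space borel S) \<and>
     (\<exists>n. unit_normal_field G S n \<and>
        (\<forall>V \<phi>. surface_chart S V \<phi> \<longrightarrow>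
          (\<forall>A \<in> sets \<sigma>. A \<subseteq> \<phi> ` V \<longrightarrow>
             emeasure \<sigma> A =
               (\<integral>\<^sup>+x. ennreal \<bar>det (vector [n (\<phi> x),
                                  frechet_derivative \<phi> (at x) (axis 1 1),
                                  frechet_derivative \<phi> (at x) (axis 2 1)] :: real ^ 3 ^ 3)\<bar>
                      * indicator (V \<inter> \<phi> -` A) x \<partial>lborel))))"

definition locally_integrable_on ::
  "(real ^ 3) set \<Rightarrow> (real ^ 3) measure \<Rightarrow> (real ^ 3 \<Rightarrow> real) \<Rightarrow> bool" where
  "locally_integrable_on S \<sigma> f \<longleftrightarrow>
     (\<forall>p\<in>S. \<exists>N. openin (top_of_set S) N \<and> p \<in> N \<and> set_integrable \<sigma> N (\<lambda>q. \<bar>f q\<bar>))"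

end

(*
  Near a point the surface is a graph of a real analytic function g over two of the coordinate
  directions j, k. If L is the differential of q_i - p_i - g, every defining function u satisfies
  (Xu, Yu) = u_i (L X, L Y) on the surface, and (G1, G2) := (L X, L Y) vanishes exactly at the
  characteristic points. As the unit vector nu = grad u / |grad u| has div nu = <D_T nu, T> with T
  the horizontal tangent direction, |H| is bounded by a constant times the sum of the
  absolute partial derivatives of the angle of (G1, G2) in the parameter plane.
  The integral of the absolute derivative of an angle over a line is at most pi times the number of
  monotonicity intervals, and hence is controlled by the number of zeros of analytic functions on
  that line. By Jensen's inequality the line at height y contains only O(log(1/|y|)) zeros, which is
  integrable in y. To count zeros, the power series are extended to complex arguments.
*)
theory Submission
  imports Defs "HOL-Complex_Analysis.Conformal_Mappings"
begin

section \<open>Bounded separately holomorphic functions on a bidisc\<close>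

text \<open>Near a characteristic point \<open>(G1, G2)\<close> can vanish to any finite order along
  curves, so an estimate by powers of the distance would have to control that order. The angle
  avoids this. In the curvature formula a numerator linear in the tangent direction stands over the
  cube of |(G1, G2)|; the tangent direction is itself of size |(G1, G2)|, which leaves exactly the
  square that belongs to the derivative of an angle. Its variation along a line is insensitive to
  the order of vanishing, which only reappears in the number of zeros. Each partial derivative is
  integrated along its own coordinate, so lines are treated for the first variable and the other one
  follows by a swap. Counting zeros on whole segments requires extensions to discs of a fixed size;
  this is why analyticity is encoded by bounded functions on a bidisc and not by series at each
  point. \<open>H\<close> has arbitrary signs, and arbitrary values at characteristic points.
  Isolation makes its absolute value an explicit Borel function on a small chart with one point
  removed, and that point is negligible.\<close>

lemma holomorphic_on_ball_uniform_limit: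
  fixes f :: "'a \<Rightarrow> complex \<Rightarrow> complex"
  assumes hol: "eventually (\<lambda>n. f n holomorphic_on ball z r) F"
    and lim: "uniform_limit (ball z r) f g F" and F: "F \<noteq> bot"
  shows "g holomorphic_on ball z r"
proof -
  have "\<exists>d>0. g holomorphic_on ball w d" if "w \<in> ball z r" for w
  proof -
    \<comment> \<open>\<open>holomorphic_uniform_limit\<close> asks for continuity on a closed disc,
      which is only known strictly inside the ball. Holomorphy is local, so small discs
      suffice.\<close>
    obtain d where d: "d > 0" "cball w d \<subseteq> ball z r"
      using \<open>w \<in> ball z r\<close> open_ball[of z r] by (meson open_contains_cball)
    have "eventually (\<lambda>n. continuous_on (cball w d) (f n) \<and> f n holomorphic_on ball w d) F"
      using hol
    proof eventually_elim
      case (elim n)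
      have "f n holomorphic_on cball w d" using elim d(2) holomorphic_on_subset by blast
      then show ?case
        using holomorphic_on_imp_continuous_on holomorphic_on_subset ball_subset_cball by blast
    qed
    moreover have "uniform_limit (cball w d) f g F"
      using lim d(2) uniform_limit_on_subset by blast
    ultimately show ?thesis using holomorphic_uniform_limit[OF _ _ F] d(1) by blast
  qed
  then have "\<exists>g'. (g has_field_derivative g') (at w)" if "w \<in> ball z r" for w
    using that by (meson centre_in_ball holomorphic_on_imp_differentiable_at open_ball
        field_differentiable_def)
  then show ?thesis by (simp add: holomorphic_on_open)
qed

text \<open>By Cauchy's estimates, boundedness makes these functions continuous on smaller bidiscs, and it is
  inherited by the partial derivatives there; so continuity is not required.\<close>

definition bihol :: "real \<Rightarrow> (complex \<Rightarrow> complex \<Rightarrow> complex) \<Rightarrow> bool" where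
  "bihol r F \<longleftrightarrow> (\<forall>y\<in>ball 0 r. (\<lambda>x. F x y) holomorphic_on ball 0 r) \<and>
     (\<forall>x\<in>ball 0 r. F x holomorphic_on ball 0 r) \<and>
     (\<exists>M. \<forall>x\<in>ball 0 r. \<forall>y\<in>ball 0 r. norm (F x y) \<le> M)"

lemma biholI:
  assumes "\<And>y. norm y < r \<Longrightarrow> (\<lambda>x. F x y) holomorphic_on ball 0 r"
    "\<And>x. norm x < r \<Longrightarrow> F x holomorphic_on ball 0 r"
    "\<And>x y. norm x < r \<Longrightarrow> norm y < r \<Longrightarrow> norm (F x y) \<le> M"
  shows "bihol r F"
  unfolding bihol_def using assms by (metis mem_ball_0)

lemma biholE:
  assumes "bihol r F"
  obtains M where "M > 0" "\<And>y. norm y < r \<Longrightarrow> (\<lambda>x. F x y) holomorphic_on ball 0 r"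
    "\<And>x. norm x < r \<Longrightarrow> F x holomorphic_on ball 0 r"
    "\<And>x y. norm x < r \<Longrightarrow> norm y < r \<Longrightarrow> norm (F x y) \<le> M"
proof -
  obtain M where M: "\<forall>x\<in>ball 0 r. \<forall>y\<in>ball 0 r. norm (F x y) \<le> M"
    using assms unfolding bihol_def by blast
  have "\<forall>x\<in>ball 0 r. \<forall>y\<in>ball 0 r. norm (F x y) \<le> max M 1"
    using M by (meson le_max_iff_disj)
  then show ?thesis
    using that[of "max M 1"] assms unfolding bihol_def by (simp add: dist_norm)
qed

lemma bihol_mono: "bihol r F \<Longrightarrow> r' \<le> r \<Longrightarrow> bihol r' F"
  unfolding bihol_def
  by (meson subset_ball subsetD holomorphic_on_subset)

lemma bihol_swap: "bihol r F \<Longrightarrow> bihol r (\<lambda>x y. F y x)"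
  unfolding bihol_def by blast

lemma bihol_const [simp]: "bihol r (\<lambda>x y. c)"
  by (rule biholI[where M="norm c"]) auto

lemma bihol_fst [simp]: "bihol r (\<lambda>x y. x)"
  by (rule biholI[where M=r]) (auto intro: holomorphic_intros)

lemma bihol_snd [simp]: "bihol r (\<lambda>x y. y)"
  by (rule biholI[where M=r]) (auto intro: holomorphic_intros)

lemma bihol_add:
  assumes "bihol r F" "bihol r G" shows "bihol r (\<lambda>x y. F x y + G x y)"
proof -
  obtain M where M: "M > 0" "\<And>y. norm y < r \<Longrightarrow> (\<lambda>x. F x y) holomorphic_on ball 0 r"
    "\<And>x. norm x < r \<Longrightarrow> F x holomorphic_on ball 0 r"
    "\<And>x y. norm x < r \<Longrightarrow> norm y < r \<Longrightarrow> norm (F x y) \<le> M"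
    using biholE[OF assms(1)] by blast
  obtain N where N: "N > 0" "\<And>y. norm y < r \<Longrightarrow> (\<lambda>x. G x y) holomorphic_on ball 0 r"
    "\<And>x. norm x < r \<Longrightarrow> G x holomorphic_on ball 0 r"
    "\<And>x y. norm x < r \<Longrightarrow> norm y < r \<Longrightarrow> norm (G x y) \<le> N"
    using biholE[OF assms(2)] by blast
  show ?thesis
    by (rule biholI[where M="M+N"]) (use M N in \<open>auto intro!: holomorphic_intros norm_triangle_mono\<close>)
qed

lemma bihol_mult:
  assumes "bihol r F" "bihol r G" shows "bihol r (\<lambda>x y. F x y * G x y)"
proof -
  obtain M where M: "M > 0" "\<And>y. norm y < r \<Longrightarrow> (\<lambda>x. F x y) holomorphic_on ball 0 r"
    "\<And>x. norm x < r \<Longrightarrow> F x holomorphic_on ball 0 r"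
    "\<And>x y. norm x < r \<Longrightarrow> norm y < r \<Longrightarrow> norm (F x y) \<le> M"
    using biholE[OF assms(1)] by blast
  obtain N where N: "N > 0" "\<And>y. norm y < r \<Longrightarrow> (\<lambda>x. G x y) holomorphic_on ball 0 r"
    "\<And>x. norm x < r \<Longrightarrow> G x holomorphic_on ball 0 r"
    "\<And>x y. norm x < r \<Longrightarrow> norm y < r \<Longrightarrow> norm (G x y) \<le> N"
    using biholE[OF assms(2)] by blast
  show ?thesis
    by (rule biholI[where M="M*N"])
       (use M N in \<open>auto intro!: holomorphic_intros mult_mono simp: norm_mult less_imp_le\<close>)
qed

lemma bihol_power: "bihol r F \<Longrightarrow> bihol r (\<lambda>x y. F x y ^ n)"
  by (induction n) (auto intro: bihol_mult)

lemma bihol_sum: "(\<And>i. i \<in> I \<Longrightarrow> bihol r (F i)) \<Longrightarrow> bihol r (\<lambda>x y. \<Sum>i\<in>I. F i x y)"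
  by (induction I rule: infinite_finite_induct) (auto intro: bihol_add)

lemma bihol_uniform_limit:
  assumes hol: "eventually (\<lambda>n. bihol r (f n)) F"
    and lim: "uniform_limit (ball 0 r \<times> ball 0 r) (\<lambda>n (x,y). f n x y) (\<lambda>(x,y). g x y) F"
    and F: "F \<noteq> bot"
  shows "bihol r g"
proof -
  have "eventually (\<lambda>n. \<forall>p\<in>ball 0 r \<times> ball 0 r. dist ((\<lambda>(x,y). f n x y) p) ((\<lambda>(x,y). g x y) p) < 1) F"
    using lim unfolding uniform_limit_iff using zero_less_one by blast
  then have "eventually (\<lambda>n. bihol r (f n) \<and>
      (\<forall>p\<in>ball 0 r \<times> ball 0 r. dist ((\<lambda>(x,y). f n x y) p) ((\<lambda>(x,y). g x y) p) < 1)) F"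
    using hol by eventually_elim auto
  then obtain n where n: "bihol r (f n)"
    "\<And>x y. norm x < r \<Longrightarrow> norm y < r \<Longrightarrow> dist (f n x y) (g x y) < 1"
    using eventually_happens'[OF F] by fastforce
  obtain M where "\<forall>x\<in>ball 0 r. \<forall>y\<in>ball 0 r. norm (f n x y) \<le> M"
    using n(1) unfolding bihol_def by blast
  then have M: "norm (f n x y) \<le> M" if "norm x < r" "norm y < r" for x y
    using that by simp
  show ?thesis
  proof (rule biholI)
    fix y :: complex assume y: "norm y < r"
    show "(\<lambda>x. g x y) holomorphic_on ball 0 r"
    proof (rule holomorphic_on_ball_uniform_limit[OF _ _ F])
      show "eventually (\<lambda>n. (\<lambda>x. f n x y) holomorphic_on ball 0 r) F"
        using hol by eventually_elim (use y in \<open>auto simp: bihol_def\<close>)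
      show "uniform_limit (ball 0 r) (\<lambda>n x. f n x y) (\<lambda>x. g x y) F"
        unfolding uniform_limit_iff
      proof (intro allI impI)
        fix e :: real assume "e > 0"
        then have "eventually (\<lambda>n. \<forall>p\<in>ball 0 r \<times> ball 0 r. dist ((\<lambda>(x,y). f n x y) p) ((\<lambda>(x,y). g x y) p) < e) F"
          using lim unfolding uniform_limit_iff by blast
        then show "\<forall>\<^sub>F n in F. \<forall>x\<in>ball 0 r. dist (f n x y) (g x y) < e"
          by eventually_elim (use y in auto)
      qed
    qed
  next
    fix x :: complex assume x: "norm x < r"
    show "g x holomorphic_on ball 0 r"
    proof (rule holomorphic_on_ball_uniform_limit[OF _ _ F])
      show "eventually (\<lambda>n. f n x holomorphic_on ball 0 r) F"
        using hol by eventually_elim (use x in \<open>auto simp: bihol_def\<close>)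
      show "uniform_limit (ball 0 r) (\<lambda>n. f n x) (g x) F"
        unfolding uniform_limit_iff
      proof (intro allI impI)
        fix e :: real assume "e > 0"
        then have "eventually (\<lambda>n. \<forall>p\<in>ball 0 r \<times> ball 0 r. dist ((\<lambda>(x,y). f n x y) p) ((\<lambda>(x,y). g x y) p) < e) F"
          using lim unfolding uniform_limit_iff by blast
        then show "\<forall>\<^sub>F n in F. \<forall>y\<in>ball 0 r. dist (f n x y) (g x y) < e"
          by eventually_elim (use x in auto)
      qed
    qed
  next
    fix x y :: complex assume "norm x < r" "norm y < r"
    then show "norm (g x y) \<le> M + 1"
      using M[of x y] n(2)[of x y] norm_triangle_ineq4[of "f n x y" "f n x y - g x y"]
      by (simp add: dist_norm)
  qed
qed

text \<open>The bound sees \<open>g\<close> only through \<open>M\<close> and \<open>d\<close>, so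
  the difference quotients of a family with a common bound converge uniformly. It is Taylor's
  formula to first order, with the second derivative bounded by Cauchy's estimate on discs of radius
  \<open>d\<close> about points of \<open>ball z d\<close>; these stay inside
  \<open>ball z (2 * d)\<close>.\<close>

lemma holomorphic_difference_quotient_bound:
  assumes hol: "g holomorphic_on ball z (2 * d)" and bd: "\<And>w. w \<in> ball z (2 * d) \<Longrightarrow> norm (g w) \<le> M"
    and d: "d > 0" and h: "norm h < d" "h \<noteq> 0"
  shows "norm ((g (z + h) - g z) / h - deriv g z) \<le> 2 * M / d\<^sup>2 * norm h"
proof -
  have d2: "norm ((deriv ^^ 2) g w) \<le> fact 2 * M / d ^ 2" if "w \<in> ball z d" for w
  proof (rule Cauchy_inequality)
    have *: "cball w d \<subseteq> ball z (2*d)"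
      using that by (auto simp: subset_iff) (smt (verit) dist_commute dist_triangle)
    show "g holomorphic_on ball w d" "continuous_on (cball w d) g"
      using * ball_subset_cball hol holomorphic_on_subset holomorphic_on_imp_continuous_on
      by (meson subset_trans)+
    show "norm (g x) \<le> M" if "norm (w - x) = d" for x
      using * that by (intro bd) (auto simp: dist_norm)
  qed (use d in auto)
  have "norm ((deriv ^^ 0) g (z + h) - (\<Sum>i\<le>1. (deriv ^^ i) g z * (z + h - z) ^ i / fact i))
        \<le> (2 * M / d\<^sup>2) * norm (z + h - z) ^ Suc 1 / fact 1"
  proof (rule complex_Taylor[where S="ball z d" and f="\<lambda>i. (deriv ^^ i) g"])
    show "((deriv ^^ i) g has_field_derivative (deriv ^^ Suc i) g x) (at x within ball z d)"
      if "x \<in> ball z d" "i \<le> 1" for x i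
    proof -
      have "(deriv ^^ i) g holomorphic_on ball z (2*d)"
        using hol holomorphic_higher_deriv open_ball by blast
      then have "((deriv ^^ i) g has_field_derivative deriv ((deriv ^^ i) g) x) (at x)"
        by (rule holomorphic_derivI) (use that d in auto)
      then show ?thesis by (simp add: has_field_derivative_at_within)
    qed
    show "norm ((deriv ^^ Suc 1) g x) \<le> 2 * M / d\<^sup>2" if "x \<in> ball z d" for x
      using d2[OF that] by (simp add: numeral_2_eq_2)
  qed (use h d in \<open>auto simp: dist_norm\<close>)
  then have "norm (g (z + h) - g z - deriv g z * h) \<le> 2 * M / d\<^sup>2 * norm h ^ 2"
    by (simp add: algebra_simps power2_eq_square)
  moreover have "(g (z + h) - g z) / h - deriv g z = (g (z + h) - g z - deriv g z * h) / h"
    using h by (simp add: field_simps)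
  ultimately show ?thesis
    using h by (simp add: norm_divide divide_le_eq power2_eq_square mult_ac)
qed

text \<open>The point is holomorphy in \<open>y\<close> of a derivative taken in \<open>x\<close>.
  It is inherited from the difference quotients in \<open>x\<close>, which converge uniformly and
  are holomorphic in \<open>y\<close> because a shift of \<open>x\<close> leaves \<open>y\<close>
  alone.\<close>

lemma bihol_deriv_fst:
  assumes F: "bihol r F" and r': "r' < r"
  shows "bihol r' (\<lambda>x y. deriv (\<lambda>z. F z y) x)"
proof -
  obtain M where M: "M > 0" "\<And>y. norm y < r \<Longrightarrow> (\<lambda>x. F x y) holomorphic_on ball 0 r"
    "\<And>x. norm x < r \<Longrightarrow> F x holomorphic_on ball 0 r"
    "\<And>x y. norm x < r \<Longrightarrow> norm y < r \<Longrightarrow> norm (F x y) \<le> M"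
    using biholE[OF F] by blast
  \<comment> \<open>Half of the margin, so that discs of radius \<open>2 * d\<close> about points of
    \<open>ball 0 r'\<close> lie in \<open>ball 0 r\<close>.\<close>
  define d where "d = (r - r') / 2"
  have d: "d > 0" "r' + 2 * d = r" using r' by (auto simp: d_def field_simps)
  have sub: "ball x (2 * d) \<subseteq> ball 0 r" if "norm x < r'" for x :: complex
    using that d by (auto simp: subset_iff dist_norm) (smt (verit) norm_triangle_sub norm_minus_commute)
  \<comment> \<open>The shift \<open>+ 2\<close> keeps \<open>norm (h n) < d\<close> strict, also at
    \<open>n = 0\<close>.\<close>
  define h where "h n = complex_of_real (d / (real n + 2))" for n
  have h: "norm (h n) < d" "h n \<noteq> 0" for n
    using d by (auto simp: h_def norm_divide divide_simps simp flip: of_real_add)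
  have "(\<lambda>n. complex_of_real (d / real (n + 2))) \<longlonglongrightarrow> of_real 0"
    by (intro tendsto_of_real LIMSEQ_ignore_initial_segment lim_const_over_n)
  then have h0: "h \<longlonglongrightarrow> 0" by (simp add: h_def[abs_def] add.commute)
  have "uniform_limit (ball 0 r' \<times> ball 0 r') (\<lambda>n (x,y). (F (x + h n) y - F x y) / h n)
          (\<lambda>(x,y). deriv (\<lambda>z. F z y) x) sequentially"
  proof (rule uniform_limitI)
    fix e :: real assume e: "e > 0"
    have "(\<lambda>n. 2 * M / d\<^sup>2 * norm (h n)) \<longlonglongrightarrow> 2 * M / d\<^sup>2 * norm (0::complex)"
      by (intro tendsto_intros h0)
    then have "eventually (\<lambda>n. 2 * M / d\<^sup>2 * norm (h n) < e) sequentially"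
      using e order_tendstoD(2) by fastforce
    then show "\<forall>\<^sub>F n in sequentially. \<forall>p\<in>ball 0 r' \<times> ball 0 r'.
        dist (case p of (x, y) \<Rightarrow> (F (x + h n) y - F x y) / h n) (case p of (x, y) \<Rightarrow> deriv (\<lambda>z. F z y) x) < e"
    proof eventually_elim
      case (elim n)
      show ?case
      proof clarsimp
        fix x y :: complex assume xy: "norm x < r'" "norm y < r'"
        have "norm ((F (x + h n) y - F x y) / h n - deriv (\<lambda>z. F z y) x) \<le> 2 * M / d\<^sup>2 * norm (h n)"
          by (rule holomorphic_difference_quotient_bound[where g="\<lambda>z. F z y"])
             (use holomorphic_on_subset[OF M(2)[of y] sub[OF xy(1)]] M(4)[of _ y] sub[OF xy(1)] xy r' d(1) h
               in \<open>auto simp: subset_iff\<close>)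
        then show "dist ((F (x + h n) y - F x y) / h n) (deriv (\<lambda>z. F z y) x) < e"
          using elim by (simp add: dist_norm)
      qed
    qed
  qed
  then show ?thesis
  proof (rule bihol_uniform_limit[rotated])
    show "\<forall>\<^sub>F n in sequentially. bihol r' (\<lambda>x y. (F (x + h n) y - F x y) / h n)"
    proof (intro always_eventually allI)
      fix n
      have inb: "norm (x + h n) < r" if "norm x < r'" for x
        using norm_triangle_ineq[of x "h n"] that h(1)[of n] d by linarith
      have "bihol r' (\<lambda>x y. F (x + h n) y)"
      proof (rule biholI)
        show "(\<lambda>x. F (x + h n) y) holomorphic_on ball 0 r'" if "norm y < r'" for y
          by (rule holomorphic_on_compose_gen[of "\<lambda>x. x + h n" _ "\<lambda>x. F x y" "ball 0 r", unfolded o_def])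
             (use that r' M inb in \<open>auto intro!: holomorphic_intros\<close>)
        show "F (x + h n) holomorphic_on ball 0 r'" if "norm x < r'" for x
          by (rule holomorphic_on_subset[OF M(3)[OF inb[OF that]]]) (use r' in auto)
        show "norm (F (x + h n) y) \<le> M" if "norm x < r'" "norm y < r'" for x y
          using that r' by (intro M(4) inb) auto
      qed
      moreover have "bihol r' F" using F r' bihol_mono by auto
      ultimately have "bihol r' (\<lambda>x y. (F (x + h n) y + (-1) * F x y) * inverse (h n))"
        by (intro bihol_mult bihol_add bihol_const)
      then show "bihol r' (\<lambda>x y. (F (x + h n) y - F x y) / h n)"
        by (simp add: field_simps)
    qed
  qed auto
qed

lemma bihol_lipschitz_fst:
  assumes F: "bihol r F" and r': "r' < r"
  shows "\<exists>L\<ge>0. \<forall>x x' y. norm x < r' \<longrightarrow> norm x' < r' \<longrightarrow> norm y < r' \<longrightarrow>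
           norm (F x y - F x' y) \<le> L * norm (x - x')"
proof -
  obtain L0 where L0: "\<forall>x\<in>ball 0 r'. \<forall>y\<in>ball 0 r'. norm (deriv (\<lambda>z. F z y) x) \<le> L0"
    using bihol_deriv_fst[OF F r'] unfolding bihol_def by blast
  define L where "L = max L0 0"
  have L: "L \<ge> 0"
    "\<And>x y. norm x < r' \<Longrightarrow> norm y < r' \<Longrightarrow> norm (deriv (\<lambda>z. F z y) x) \<le> L"
    using L0 by (auto simp: L_def le_max_iff_disj)
  show ?thesis
  proof (intro exI[of _ L] conjI allI impI)
    fix x x' y :: complex assume xy: "norm x < r'" "norm x' < r'" "norm y < r'"
    have hol: "(\<lambda>z. F z y) holomorphic_on ball 0 r"
      using F xy r' unfolding bihol_def by simp
    show "norm (F x y - F x' y) \<le> L * norm (x - x')"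
    proof (rule field_differentiable_bound[where S="ball 0 r'" and f="\<lambda>z. F z y" and f'="deriv (\<lambda>z. F z y)"])
      show "((\<lambda>z. F z y) has_field_derivative deriv (\<lambda>z. F z y) z) (at z within ball 0 r')"
        if "z \<in> ball 0 r'" for z
        using holomorphic_derivI[OF hol open_ball] that r' by (simp add: has_field_derivative_at_within)
    qed (use xy L in auto)
  qed (use L in simp)
qed

text \<open>Bounded partial derivatives make \<open>F\<close> Lipschitz in each variable uniformly
  in the other, hence jointly Lipschitz: a form of Osgood's lemma for bounded functions.\<close>

lemma bihol_continuous_on:
  assumes F: "bihol r F" and r': "r' < r"
  shows "continuous_on (ball 0 r' \<times> ball 0 r') (\<lambda>(x,y). F x y)"
proof -
  obtain L where L: "L \<ge> 0" "\<And>x x' y. norm x < r' \<Longrightarrow> norm x' < r' \<Longrightarrow> norm y < r' \<Longrightarrow>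
      norm (F x y - F x' y) \<le> L * norm (x - x')"
    using bihol_lipschitz_fst[OF F r'] by blast
  obtain K where K: "K \<ge> 0" "\<And>x x' y. norm x < r' \<Longrightarrow> norm x' < r' \<Longrightarrow> norm y < r' \<Longrightarrow>
      norm (F y x - F y x') \<le> K * norm (x - x')"
    using bihol_lipschitz_fst[OF bihol_swap[OF F] r'] by blast
  have "(L + K)-lipschitz_on (ball 0 r' \<times> ball 0 r') (\<lambda>(x,y). F x y)"
  proof (rule lipschitz_onI)
    fix p q :: "complex \<times> complex" assume pq: "p \<in> ball 0 r' \<times> ball 0 r'" "q \<in> ball 0 r' \<times> ball 0 r'"
    obtain x y x' y' where [simp]: "p = (x, y)" "q = (x', y')" by (cases p, cases q) auto
    have "norm (F x y - F x' y') \<le> norm (F x y - F x' y) + norm (F x' y - F x' y')"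
      using norm_triangle_ineq[of "F x y - F x' y" "F x' y - F x' y'"] by simp
    also have "\<dots> \<le> L * norm (x - x') + K * norm (y - y')"
      using L(2)[of x x' y] K(2)[of y y' x'] pq by auto
    also have "\<dots> \<le> L * dist p q + K * dist p q"
      using dist_fst_le[of p q] dist_snd_le[of p q] L(1) K(1)
      by (intro add_mono mult_left_mono) (auto simp: dist_norm)
    finally show "dist (case p of (x, y) \<Rightarrow> F x y) (case q of (x, y) \<Rightarrow> F x y) \<le> (L + K) * dist p q"
      by (simp add: dist_norm algebra_simps)
  qed (use L K in simp)
  then show ?thesis by (rule lipschitz_on_continuous_on)
qed

section \<open>Real analytic functions of two variables\<close>

text \<open>Real analyticity as one bounded holomorphic extension to the full bidisc of the same
  radius. This provides the complex discs on which the zeros along a whole segment are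
  counted.\<close>

definition biana :: "real \<Rightarrow> (real \<Rightarrow> real \<Rightarrow> real) \<Rightarrow> bool" where
  "biana r g \<longleftrightarrow> (\<exists>F. bihol r F \<and>
     (\<forall>x y. \<bar>x\<bar> < r \<longrightarrow> \<bar>y\<bar> < r \<longrightarrow> F (of_real x) (of_real y) = of_real (g x y)))"

lemma biana_mono: assumes "biana r g" "r' \<le> r" shows "biana r' g"
proof -
  obtain F where F: "bihol r F"
    "\<forall>x y. \<bar>x\<bar> < r \<longrightarrow> \<bar>y\<bar> < r \<longrightarrow> F (of_real x) (of_real y) = of_real (g x y)"
    using assms(1) unfolding biana_def by blast
  then show ?thesis
    unfolding biana_def using bihol_mono[OF F(1) assms(2)] assms(2) by (intro exI[of _ F]) auto
qed

lemma biana_swap: "biana r g \<Longrightarrow> biana r (\<lambda>x y. g y x)"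
proof -
  assume "biana r g"
  then obtain F where "bihol r F"
    "\<forall>x y. \<bar>x\<bar> < r \<longrightarrow> \<bar>y\<bar> < r \<longrightarrow> F (of_real x) (of_real y) = of_real (g x y)"
    unfolding biana_def by blast
  then show ?thesis unfolding biana_def by (intro exI[of _ "\<lambda>x y. F y x"]) (auto intro: bihol_swap)
qed

lemma biana_const: "biana r (\<lambda>x y. c)"
  unfolding biana_def by (rule exI[of _ "\<lambda>x y. of_real c"]) simp

lemma biana_fst: "biana r (\<lambda>x y. x)"
  unfolding biana_def by (rule exI[of _ "\<lambda>x y. x"]) simp

lemma biana_snd: "biana r (\<lambda>x y. y)"
  unfolding biana_def by (rule exI[of _ "\<lambda>x y. y"]) simp

lemma biana_add: assumes "biana r g" "biana r h" shows "biana r (\<lambda>x y. g x y + h x y)"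
proof -
  obtain F H where "bihol r F" "bihol r H"
    "\<forall>x y. \<bar>x\<bar> < r \<longrightarrow> \<bar>y\<bar> < r \<longrightarrow> F (of_real x) (of_real y) = of_real (g x y)"
    "\<forall>x y. \<bar>x\<bar> < r \<longrightarrow> \<bar>y\<bar> < r \<longrightarrow> H (of_real x) (of_real y) = of_real (h x y)"
    using assms unfolding biana_def by blast
  then show ?thesis unfolding biana_def
    by (intro exI[of _ "\<lambda>x y. F x y + H x y"]) (auto intro: bihol_add)
qed

lemma biana_mult: assumes "biana r g" "biana r h" shows "biana r (\<lambda>x y. g x y * h x y)"
proof -
  obtain F H where "bihol r F" "bihol r H"
    "\<forall>x y. \<bar>x\<bar> < r \<longrightarrow> \<bar>y\<bar> < r \<longrightarrow> F (of_real x) (of_real y) = of_real (g x y)"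
    "\<forall>x y. \<bar>x\<bar> < r \<longrightarrow> \<bar>y\<bar> < r \<longrightarrow> H (of_real x) (of_real y) = of_real (h x y)"
    using assms unfolding biana_def by blast
  then show ?thesis unfolding biana_def
    by (intro exI[of _ "\<lambda>x y. F x y * H x y"]) (auto intro: bihol_mult)
qed

lemma biana_diff: assumes "biana r g" "biana r h" shows "biana r (\<lambda>x y. g x y - h x y)"
  using biana_add[OF assms(1) biana_mult[OF biana_const[of r "-1"] assms(2)]] by simp

lemma biana_continuous_on:
  assumes "biana r g" "r' < r"
  shows "continuous_on ({-r'<..<r'} \<times> {-r'<..<r'}) (\<lambda>(x,y). g x y)"
proof -
  obtain F where F: "bihol r F"
    "\<And>x y. \<bar>x\<bar> < r \<Longrightarrow> \<bar>y\<bar> < r \<Longrightarrow> F (of_real x) (of_real y) = of_real (g x y)"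
    using assms(1) unfolding biana_def by blast
  let ?I = "{-r'<..<r'} \<times> {-r'<..<r'}"
  have "continuous_on ?I (\<lambda>p. Re ((\<lambda>(x,y). F x y) ((\<lambda>p. (of_real (fst p), of_real (snd p))) p)))"
    by (rule continuous_on_Re, rule continuous_on_compose2[OF bihol_continuous_on[OF F(1) assms(2)]])
       (auto intro!: continuous_intros)
  then show ?thesis
    by (rule continuous_on_eq) (use F(2) assms(2) in auto)
qed

lemma holomorphic_real_deriv:
  assumes h: "h holomorphic_on ball 0 r" and k: "\<And>t. \<bar>t\<bar> < r \<Longrightarrow> h (of_real t) = of_real (k t)"
    and x: "\<bar>x\<bar> < r"
  shows "(k has_field_derivative Re (deriv h (of_real x))) (at x)"
    and "deriv h (of_real x) = of_real (Re (deriv h (of_real x)))"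
proof -
  have "(h has_field_derivative deriv h (of_real x)) (at (of_real x))"
    using x by (intro holomorphic_derivI[OF h]) auto
  then have D: "((\<lambda>t. h (of_real t)) has_vector_derivative deriv h (of_real x)) (at x)"
    by (rule has_vector_derivative_real_field)
  have "((\<lambda>t. Re (h (of_real t))) has_field_derivative Re (deriv h (of_real x))) (at x)"
    using bounded_linear.has_vector_derivative[OF bounded_linear_Re D]
    by (simp add: has_real_derivative_iff_has_vector_derivative)
  then show "(k has_field_derivative Re (deriv h (of_real x))) (at x)"
    by (rule has_field_derivative_transform_within_open[where S="{-r<..<r}"]) (use x k in auto)
  \<comment> \<open>\<open>h\<close> is real on the real segment, so its imaginary part has
    derivative zero along it; the complex derivative therefore extends the real one.\<close>
  have "((\<lambda>t. Im (h (of_real t))) has_field_derivative Im (deriv h (of_real x))) (at x)"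
    using bounded_linear.has_vector_derivative[OF bounded_linear_Im D]
    by (simp add: has_real_derivative_iff_has_vector_derivative)
  then have "((\<lambda>t. 0) has_field_derivative Im (deriv h (of_real x))) (at x)"
    by (rule has_field_derivative_transform_within_open[where S="{-r<..<r}"]) (use x k in auto)
  then have "Im (deriv h (of_real x)) = 0"
    using DERIV_unique DERIV_const by blast
  then show "deriv h (of_real x) = of_real (Re (deriv h (of_real x)))"
    by (simp add: complex_eq_iff)
qed

lemma biana_deriv_fst:
  assumes g: "biana r g" and r': "r' < r"
  obtains g' where "biana r' g'"
    "\<And>x y. \<bar>x\<bar> < r' \<Longrightarrow> \<bar>y\<bar> < r' \<Longrightarrow> ((\<lambda>t. g t y) has_field_derivative g' x y) (at x)"
proof -
  obtain F where F: "bihol r F"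
    "\<And>x y. \<bar>x\<bar> < r \<Longrightarrow> \<bar>y\<bar> < r \<Longrightarrow> F (of_real x) (of_real y) = of_real (g x y)"
    using g unfolding biana_def by blast
  define g' where "g' x y = Re (deriv (\<lambda>z. F z (of_real y)) (of_real x))" for x y
  have hol: "(\<lambda>z. F z (of_real y)) holomorphic_on ball 0 r" if "\<bar>y\<bar> < r" for y
    using F(1) that unfolding bihol_def by simp
  show ?thesis
  proof (rule that[of g'])
    show "biana r' g'" unfolding biana_def g'_def
      using bihol_deriv_fst[OF F(1) r'] r'
      by (intro exI[of _ "\<lambda>x y. deriv (\<lambda>z. F z y) x"] conjI allI impI
           holomorphic_real_deriv(2)[OF hol, where k="\<lambda>t. g t _"]) (auto intro!: F(2))
    show "((\<lambda>t. g t y) has_field_derivative g' x y) (at x)" if "\<bar>x\<bar> < r'" "\<bar>y\<bar> < r'" for x y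
      unfolding g'_def using that r'
      by (intro holomorphic_real_deriv(1)[OF hol]) (auto intro!: F(2))
  qed
qed

lemma biana_has_derivative:
  assumes g: "biana r g" and r': "r' < r"
  obtains gx gy where "biana r' gx" "biana r' gy"
    "\<And>x y. \<bar>x\<bar> < r' \<Longrightarrow> \<bar>y\<bar> < r' \<Longrightarrow>
      ((\<lambda>(x,y). g x y) has_derivative (\<lambda>(s,t). gx x y * s + gy x y * t)) (at (x, y))"
proof -
  \<comment> \<open>An intermediate radius: \<open>biana_continuous_on\<close> gives continuity only
    on strictly smaller squares, and continuity of one partial derivative is what turns partial into
    total differentiability.\<close>
  obtain q where q: "r' < q" "q < r" using r' dense by blast
  obtain gx where gx: "biana q gx"
    "\<And>x y. \<bar>x\<bar> < q \<Longrightarrow> \<bar>y\<bar> < q \<Longrightarrow> ((\<lambda>t. g t y) has_field_derivative gx x y) (at x)"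
    using biana_deriv_fst[OF g q(2)] by blast
  obtain gy where gy: "biana q gy"
    "\<And>x y. \<bar>x\<bar> < q \<Longrightarrow> \<bar>y\<bar> < q \<Longrightarrow> ((\<lambda>t. g y t) has_field_derivative gy x y) (at x)"
    using biana_deriv_fst[OF biana_swap[OF g] q(2)] by blast
  define gy' where "gy' = (\<lambda>x y. gy y x)"
  have gy': "biana q gy'"
    "\<And>x y. \<bar>x\<bar> < q \<Longrightarrow> \<bar>y\<bar> < q \<Longrightarrow> ((\<lambda>t. g x t) has_field_derivative gy' x y) (at y)"
    using biana_swap[OF gy(1)] gy(2) by (auto simp: gy'_def)
  show ?thesis
  proof (rule that[of gx gy'])
    fix x y :: real assume xy: "\<bar>x\<bar> < r'" "\<bar>y\<bar> < r'"
    let ?I = "{-r'<..<r'}"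
    have "((\<lambda>(x, y). g x y) has_derivative (\<lambda>(s, t). gx x y * s + blinfun_mult_right (gy' x y) t))
            (at (x, y) within ?I \<times> ?I)"
    proof (rule has_derivative_partialsI[where fy="\<lambda>x y. blinfun_mult_right (gy' x y)"])
      show "((\<lambda>x. g x y) has_derivative (*) (gx x y)) (at x within ?I)"
        using gx(2)[of x y] xy q unfolding has_field_derivative_def by (auto intro: has_derivative_at_withinI)
      show "(g u has_derivative blinfun_apply (blinfun_mult_right (gy' u v))) (at v within ?I)"
        if "u \<in> ?I" "v \<in> ?I" for u v
        using gy'(2)[of u v] that q unfolding has_field_derivative_def by (auto intro: has_derivative_at_withinI)
      have "continuous (at (x, y) within ?I \<times> ?I) (\<lambda>(x, y). gy' x y)"
        using biana_continuous_on[OF gy'(1) q(1)] xy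
        unfolding continuous_on_eq_continuous_within by force
      then have "continuous (at (x, y) within ?I \<times> ?I) (\<lambda>p. blinfun_mult_right ((\<lambda>(x, y). gy' x y) p))"
        by (rule bounded_linear.continuous[OF bounded_linear_blinfun_mult_right])
      then show "continuous (at (x, y) within ?I \<times> ?I) (\<lambda>(x, y). blinfun_mult_right (gy' x y))"
        by (simp add: split_def)
    qed (use xy in auto)
    then show "((\<lambda>(x,y). g x y) has_derivative (\<lambda>(s,t). gx x y * s + gy' x y * t)) (at (x, y))"
      using xy at_within_open[of "(x,y)" "?I \<times> ?I"] by (simp add: open_Times abs_less_iff)
  qed (use biana_mono[OF gx(1)] biana_mono[OF gy'(1)] q in auto)
qed

section \<open>Counting zeros on a line\<close>

lemma holomorphic_divide_zero:
  fixes g :: "complex \<Rightarrow> complex"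
  assumes "open S" "g holomorphic_on S" "a \<in> S" "g a = 0"
  obtains q where "q holomorphic_on S" "\<And>x. g x = (x - a) * q x"
proof -
  \<comment> \<open>Away from \<open>a\<close> this is the literal quotient, so the factorization
    holds at every \<open>x\<close>, even outside \<open>S\<close>.\<close>
  let ?q = "\<lambda>z. if z = a then deriv g a else (g z - g a) / (z - a)"
  have "?q holomorphic_on S"
    by (rule pole_lemma) (use assms in \<open>auto simp: interior_open\<close>)
  then show ?thesis
    by (rule that[of ?q]) (use assms in auto)
qed

text \<open>The elementary half of Jensen's inequality: divide out the zeros one at a time and apply the
  maximum principle to the quotient.\<close>

lemma holomorphic_zeros_bound:
  fixes g :: "complex \<Rightarrow> complex"
  assumes S: "open S" "cball 0 R \<subseteq> S" and s: "s < R" and Z: "finite Z" "Z \<subseteq> cball 0 s"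
    and g: "g holomorphic_on S" "\<And>a. a \<in> Z \<Longrightarrow> g a = 0" "\<And>x. norm x = R \<Longrightarrow> norm (g x) \<le> M"
    and x: "norm x \<le> R"
  shows "norm (g x) \<le> M * (\<Prod>a\<in>Z. norm (x - a) / (R - s))"
  using Z g
proof (induction Z arbitrary: g M rule: finite_induct)
  case empty
  have "norm (g x) \<le> M"
  proof (rule maximum_modulus_frontier[of g "cball 0 R"])
    show "g holomorphic_on interior (cball 0 R)"
      using empty(2) S(2) holomorphic_on_subset interior_subset by (metis subset_trans)
    show "continuous_on (closure (cball 0 R)) g"
      using empty(2) S(2) holomorphic_on_imp_continuous_on holomorphic_on_subset by auto
  qed (use empty x in auto)
  then show ?case by simp
next
  case (insert a Z)
  have "a \<in> S" using insert.prems(1) S(2) s by auto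
  then obtain q where q: "q holomorphic_on S" "\<And>x. g x = (x - a) * q x"
    using holomorphic_divide_zero[OF S(1) insert.prems(2)] insert.prems(3) by blast
  have "norm (q x) \<le> M / (R - s) * (\<Prod>a\<in>Z. norm (x - a) / (R - s))"
  proof (rule insert.IH)
    show "q b = 0" if "b \<in> Z" for b
      using insert.prems(3)[of b] q(2)[of b] that insert.hyps(2) by auto
    show "norm (q z) \<le> M / (R - s)" if "norm z = R" for z
    proof -
      \<comment> \<open>On the circle of radius \<open>R\<close> the divided factor has modulus at
        least \<open>R - s\<close>, so each division multiplies the boundary bound by at most
        \<open>1 / (R - s)\<close>.\<close>
      have "R - s \<le> norm (z - a)"
        using norm_triangle_ineq2[of z a] that insert.prems(1) by simp
      then have "(R - s) * norm (q z) \<le> norm (z - a) * norm (q z)"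
        by (rule mult_right_mono) simp
      also have "\<dots> \<le> M" using insert.prems(4)[OF that] q(2)[of z] by (simp add: norm_mult)
      finally show ?thesis using s by (simp add: le_divide_eq mult.commute)
    qed
  qed (use insert.prems q in auto)
  then have "norm (x - a) * norm (q x) \<le> norm (x - a) * (M / (R - s) * (\<Prod>a\<in>Z. norm (x - a) / (R - s)))"
    by (rule mult_left_mono) simp
  then show ?case
    using insert.hyps q(2)[of x] by (simp add: norm_mult mult_ac)
qed

text \<open>The radius \<open>5 * s\<close> is chosen so that each zero contributes a factor of at
  most \<open>2 * s / (5 * s - s) = 1 / 2\<close> at \<open>x\<close>. So \<open>n\<close> zeros
  force \<open>norm (g x) \<le> M / 2 ^ n\<close>; applied to arbitrary finite sets of zeros this
  also gives finiteness.\<close>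

lemma card_zeros_bound:
  fixes g :: "complex \<Rightarrow> complex"
  assumes S: "open S" "cball 0 (5 * s) \<subseteq> S" and s: "s > 0" and g: "g holomorphic_on S"
    and M: "\<And>x. norm x = 5 * s \<Longrightarrow> norm (g x) \<le> M"
    and x: "norm x \<le> s" "g x \<noteq> 0"
  shows "finite {a. norm a \<le> s \<and> g a = 0}" "2 ^ card {a. norm a \<le> s \<and> g a = 0} \<le> M / norm (g x)"
proof -
  let ?Z = "{a. norm a \<le> s \<and> g a = 0}"
  have M0: "M \<ge> 0"
    using order_trans[OF norm_ge_zero M[of "of_real (5 * s)"]] s by (simp add: norm_mult)
  have *: "2 ^ card Y \<le> M / norm (g x)" if Y: "Y \<subseteq> ?Z" "finite Y" for Y
  proof -
    have "norm (g x) \<le> M * (\<Prod>a\<in>Y. norm (x - a) / (5 * s - s))"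
      by (rule holomorphic_zeros_bound[OF S _ Y(2) _ g _ M]) (use Y x s in auto)
    also have "\<dots> \<le> M * (\<Prod>a\<in>Y. 1 / 2)"
    proof (intro mult_left_mono prod_mono conjI M0)
      fix a assume "a \<in> Y"
      then have "norm (x - a) \<le> 2 * s"
        using norm_triangle_ineq4[of x a] x Y(1) by auto
      then show "norm (x - a) / (5 * s - s) \<le> 1 / 2" using s by (simp add: field_simps)
    qed (use s in auto)
    finally show ?thesis using x(2) by (simp add: field_simps)
  qed
  show fin: "finite ?Z"
  proof (rule ccontr)
    assume "infinite ?Z"
    obtain n :: nat where "M / norm (g x) < 2 ^ n" using real_arch_pow[of 2] by auto
    moreover obtain Y where "finite Y" "card Y = n" "Y \<subseteq> ?Z"
      using infinite_arbitrarily_large[OF \<open>infinite ?Z\<close>] by blast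
    ultimately show False using *[of Y] by simp
  qed
  show "2 ^ card ?Z \<le> M / norm (g x)" using *[OF _ fin] by simp
qed

text \<open>\<open>k\<close> is the order of vanishing at \<open>0\<close>: once
  \<open>w ^ k\<close> is split off, the remaining factor is bounded away from zero near
  \<open>0\<close>. With \<open>w\<close> as the height of a line, this controls a reference value
  on that line from below.\<close>

lemma holomorphic_lower_bound:
  fixes g :: "complex \<Rightarrow> complex"
  assumes r: "r > 0" and g: "g holomorphic_on ball 0 r" and z: "z \<in> ball 0 r" "g z \<noteq> 0"
  obtains c d k where "c > 0" "d > 0" "d < r" "\<And>w. norm w < d \<Longrightarrow> c * norm w ^ k \<le> norm (g w)"
proof -
  note result = that
  have pos: thesis if h: "h holomorphic_on ball 0 t" "t > 0" "t \<le> r"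
    "\<And>w. w \<in> ball 0 t \<Longrightarrow> g w = w ^ k * h w" "h 0 \<noteq> 0" for h t k
  proof -
    have "isCont h 0"
      using continuous_on_interior[OF holomorphic_on_imp_continuous_on[OF h(1)]] h(2) by simp
    then obtain d where d: "d > 0" "\<And>w. dist w 0 < d \<Longrightarrow> dist (h w) (h 0) < norm (h 0) / 2"
      using h(5) unfolding continuous_at_eps_delta by (metis half_gt_zero zero_less_norm_iff)
    show thesis
    proof (rule result[of "norm (h 0) / 2" "min d (t / 2)" k])
      fix w :: complex assume w: "norm w < min d (t / 2)"
      have "norm (h 0) - norm (h w) \<le> norm (h w - h 0)"
        by (metis norm_minus_commute norm_triangle_ineq2)
      then have "norm (h 0) / 2 \<le> norm (h w)"
        using d(2)[of w] w by (simp add: dist_norm)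
      then have "norm (h 0) / 2 * norm w ^ k \<le> norm (h w) * norm w ^ k"
        by (rule mult_right_mono) simp
      then show "norm (h 0) / 2 * norm w ^ k \<le> norm (g w)"
        using h(4)[of w] w h(2) by (simp add: norm_mult norm_power mult.commute)
    qed (use h d in auto)
  qed
  show thesis
  proof (cases "g 0 = 0")
    case False
    then show ?thesis by (intro pos[of g r 0]) (use g r in auto)
  next
    case True
    have "\<not> g constant_on ball 0 r"
    proof
      assume "g constant_on ball 0 r"
      then have "g z = g 0" using z(1) r unfolding constant_on_def by (metis centre_in_ball)
      then show False using z True by simp
    qed
    then obtain h t n where "0 < t" "ball 0 t \<subseteq> ball (0::complex) r" "h holomorphic_on ball 0 t"
      "\<And>w. w \<in> ball 0 t \<Longrightarrow> g w = (w - 0) ^ n * h w" "\<And>w. w \<in> ball 0 t \<Longrightarrow> h w \<noteq> 0"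
      using holomorphic_factor_zero_nonconstant[OF g _ _ _ True] r
      by (metis centre_in_ball connected_ball open_ball)
    then show ?thesis by (intro pos[of h t n]) (auto simp: ball_subset_ball_iff)
  qed
qed

text \<open>The bound \<open>O(ln (1 / \<bar>y\<bar>))\<close> is weakened to \<open>O(1 / sqrt \<bar>y\<bar>)\<close>, which has an explicit
  antiderivative.\<close>

lemma biana_card_zeros:
  assumes g: "biana r g" and r: "r > 0"
  obtains \<rho> where "\<rho> > 0" "\<And>x y. \<bar>x\<bar> < \<rho> \<Longrightarrow> \<bar>y\<bar> < \<rho> \<Longrightarrow> g x y = 0"
  | \<rho> C where "\<rho> > 0" "C \<ge> 0"
    "\<And>y. 0 < \<bar>y\<bar> \<Longrightarrow> \<bar>y\<bar> < \<rho> \<Longrightarrow> finite {x. \<bar>x\<bar> < \<rho> \<and> g x y = 0}"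
    "\<And>y. 0 < \<bar>y\<bar> \<Longrightarrow> \<bar>y\<bar> < \<rho> \<Longrightarrow> real (card {x. \<bar>x\<bar> < \<rho> \<and> g x y = 0}) \<le> C / sqrt \<bar>y\<bar>"
proof -
  obtain F where F: "bihol r F"
    "\<And>x y. \<bar>x\<bar> < r \<Longrightarrow> \<bar>y\<bar> < r \<Longrightarrow> F (of_real x) (of_real y) = of_real (g x y)"
    using g unfolding biana_def by blast
  obtain M where M: "M > 0" "\<And>y. norm y < r \<Longrightarrow> (\<lambda>x. F x y) holomorphic_on ball 0 r"
    "\<And>x. norm x < r \<Longrightarrow> F x holomorphic_on ball 0 r"
    "\<And>x y. norm x < r \<Longrightarrow> norm y < r \<Longrightarrow> norm (F x y) \<le> M"
    using biholE[OF F(1)] by blast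
  \<comment> \<open>Makes \<open>5 * s = r / 2\<close>, within the reach of the extension.\<close>
  define s where "s = r / 10"
  have s: "s > 0" "5 * s < r" using r by (auto simp: s_def)
  show thesis
  proof (cases "\<forall>x y. \<bar>x\<bar> < s \<longrightarrow> \<bar>y\<bar> < s \<longrightarrow> g x y = 0")
    case True
    then show ?thesis using that(1)[of s] s by blast
  next
    case False
    \<comment> \<open>The column \<open>x0\<close> supplies the reference value for the zero count
      on every nearby line: \<open>F x0\<close> is not identically zero, so near height zero it
      decays at most like a power of the height.\<close>
    then obtain x0 y0 where x0: "\<bar>x0\<bar> < s" "\<bar>y0\<bar> < s" "g x0 y0 \<noteq> 0" by blast
    obtain c d k where c: "c > 0" "d > 0" "d < r"
      "\<And>w. norm w < d \<Longrightarrow> c * norm w ^ k \<le> norm (F (of_real x0) w)"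
    proof (rule holomorphic_lower_bound[OF r M(3)[of "of_real x0"], of "of_real y0"])
      show "F (of_real x0) (of_real y0) \<noteq> 0" using F(2)[of x0 y0] x0 s by simp
    qed (use x0 s in auto)
    \<comment> \<open>\<open>\<rho> \<le> 1\<close> gives
      \<open>1 \<le> 1 / sqrt \<bar>y\<bar>\<close>, which absorbs the constant term of the
      logarithmic bound.\<close>
    define \<rho> where "\<rho> = Min {s, d, 1}"
    have \<rho>: "\<rho> > 0" "\<rho> \<le> s" "\<rho> \<le> d" "\<rho> \<le> 1" using s c by (auto simp: \<rho>_def)
    \<comment> \<open>\<open>ln 2\<close> comes from \<open>2 ^ card\<close>, and
      \<open>2 * real k\<close> from
      \<open>ln \<bar>y\<bar> = - 2 * ln (1 / sqrt \<bar>y\<bar>)\<close> together with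
      \<open>ln t \<le> t\<close>.\<close>
    define C where "C = (\<bar>ln (M / c)\<bar> + 2 * real k) / ln 2"
    have main: "finite {x. \<bar>x\<bar> < \<rho> \<and> g x y = 0} \<and> real (card {x. \<bar>x\<bar> < \<rho> \<and> g x y = 0}) \<le> C / sqrt \<bar>y\<bar>"
      if y: "0 < \<bar>y\<bar>" "\<bar>y\<bar> < \<rho>" for y
    proof -
      let ?Z = "{a. norm a \<le> s \<and> F a (of_real y) = 0}"
      have lb: "c * \<bar>y\<bar> ^ k \<le> norm (F (of_real x0) (of_real y))"
        using c(4)[of "of_real y"] y \<rho> by simp
      have pos: "c * \<bar>y\<bar> ^ k > 0" using c y by simp
      have Z: "finite ?Z" "2 ^ card ?Z \<le> M / norm (F (of_real x0) (of_real y))"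
        using s y \<rho> x0(1) lb pos
        by (auto intro!: card_zeros_bound[where S="ball 0 r" and g="\<lambda>x. F x (of_real y)" and x="of_real x0"] M)
      have img: "of_real ` {x. \<bar>x\<bar> < \<rho> \<and> g x y = 0} \<subseteq> ?Z"
        using F(2)[of _ y] \<rho> s y by auto
      then have fin: "finite {x. \<bar>x\<bar> < \<rho> \<and> g x y = 0}"
        using Z(1) finite_subset finite_imageD[of of_real] by (metis (no_types, lifting) inj_of_real inj_on_subset subset_UNIV)
      have "card {x. \<bar>x\<bar> < \<rho> \<and> g x y = 0} = card (complex_of_real ` {x. \<bar>x\<bar> < \<rho> \<and> g x y = 0})"
        by (intro card_image[symmetric] inj_onI) simp
      also have "\<dots> \<le> card ?Z" by (rule card_mono[OF Z(1) img])
      finally have N: "real (card {x. \<bar>x\<bar> < \<rho> \<and> g x y = 0}) \<le> real (card ?Z)" by simp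
      have "2 ^ card ?Z \<le> M / (c * \<bar>y\<bar> ^ k)"
        using Z(2) divide_left_mono[OF lb, of M] pos lb M(1)
        by (smt (verit) mult_pos_pos)
      then have "ln (2 ^ card ?Z) \<le> ln (M / c / \<bar>y\<bar> ^ k)"
        using M(1) pos by (subst ln_le_cancel_iff) (auto simp: field_simps)
      also have "\<dots> = ln (M / c) - real k * ln \<bar>y\<bar>"
        using M(1) c(1) y by (simp add: ln_div ln_realpow ln_mult)
      also have "ln \<bar>y\<bar> = - 2 * ln (1 / sqrt \<bar>y\<bar>)"
        using y by (simp add: ln_div ln_sqrt)
      finally have "real (card ?Z) * ln 2 \<le> ln (M / c) + 2 * real k * ln (1 / sqrt \<bar>y\<bar>)"
        by (simp add: ln_realpow)
      also have "\<dots> \<le> \<bar>ln (M / c)\<bar> * (1 / sqrt \<bar>y\<bar>) + 2 * real k * (1 / sqrt \<bar>y\<bar>)"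
      proof (intro add_mono mult_left_mono)
        have "1 \<le> 1 / sqrt \<bar>y\<bar>" using y \<rho> by (simp add: le_divide_eq)
        then show "ln (M / c) \<le> \<bar>ln (M / c)\<bar> * (1 / sqrt \<bar>y\<bar>)"
          using mult_left_mono[of 1 "1 / sqrt \<bar>y\<bar>" "\<bar>ln (M / c)\<bar>"] by simp
        show "ln (1 / sqrt \<bar>y\<bar>) \<le> 1 / sqrt \<bar>y\<bar>"
          using ln_le_minus_one[of "1 / sqrt \<bar>y\<bar>"] y by simp
      qed simp
      also have "\<dots> = C / sqrt \<bar>y\<bar> * ln 2" proof -
        have "C * ln 2 = \<bar>ln (M / c)\<bar> + 2 * real k" by (simp add: C_def)
        then have "C / sqrt \<bar>y\<bar> * ln 2 = (\<bar>ln (M / c)\<bar> + 2 * real k) / sqrt \<bar>y\<bar>" by simp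
        then show ?thesis by (simp add: add_divide_distrib)
      qed
      finally have "real (card ?Z) \<le> C / sqrt \<bar>y\<bar>"
        by (rule mult_right_le_imp_le) simp
      then show ?thesis using fin N by linarith
    qed
    have "C \<ge> 0" by (simp add: C_def)
    then show ?thesis using that(2)[of \<rho> C] main \<rho>(1) by blast
  qed
qed

section \<open>The analytic implicit function theorem\<close>

lemma norm_power_diff_le:
  fixes z w :: complex
  assumes "norm z \<le> d" "norm w \<le> d"
  shows "norm (z ^ n - w ^ n) \<le> real n * d ^ (n - 1) * norm (z - w)"
proof (induction n)
  case (Suc n)
  have d: "d \<ge> 0" using assms(1) norm_ge_zero order_trans by blast
  have "norm (z ^ Suc n - w ^ Suc n) = norm (z * (z ^ n - w ^ n) + w ^ n * (z - w))"
    by (simp add: algebra_simps)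
  also have "\<dots> \<le> norm z * norm (z ^ n - w ^ n) + norm w ^ n * norm (z - w)"
    by (metis norm_mult norm_power norm_triangle_ineq)
  also have "\<dots> \<le> d * (real n * d ^ (n - 1) * norm (z - w)) + d ^ n * norm (z - w)"
    by (intro add_mono mult_mono Suc assms power_mono) (use d in auto)
  also have "\<dots> = real (Suc n) * d ^ (Suc n - 1) * norm (z - w)"
    by (cases n) (auto simp: algebra_simps)
  finally show ?case .
qed simp

lemma has_sum_norm_le:
  fixes f :: "'a \<Rightarrow> complex"
  assumes "(f has_sum a) S" "(g has_sum b) S" "\<And>x. x \<in> S \<Longrightarrow> norm (f x) \<le> g x"
  shows "norm a \<le> b"
proof -
  have abs: "(\<lambda>x. norm (f x)) summable_on S"
    by (rule summable_on_comparison_test[OF has_sum_imp_summable[OF assms(2)]]) (use assms(3) in auto)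
  have "norm a \<le> (\<Sum>\<^sub>\<infinity>x\<in>S. norm (f x))"
    using norm_infsum_bound[of f S] abs infsumI[OF assms(1)] by simp
  also have "\<dots> \<le> b"
    using has_sum_mono[OF has_sum_infsum[OF abs] assms(2)] assms(3) by blast
  finally show ?thesis .
qed

lemma has_sum_diff:
  fixes f g :: "'a \<Rightarrow> complex"
  assumes "(f has_sum a) S" "(g has_sum b) S"
  shows "((\<lambda>x. f x - g x) has_sum (a - b)) S"
  using has_sum_add[OF assms(1) has_sum_uminusI[OF assms(2)]] by simp

text \<open>A Taylor series with displacements \<open>x\<close>, \<open>y\<close>, \<open>z\<close>
  along the axes \<open>j\<close>, \<open>k\<close>, \<open>i\<close>; the equation will be solved
  for \<open>z\<close>. \<open>A\<close> is the sum of the absolute values of the terms at the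
  corner of the polydisc of radius \<open>s\<close>, and every estimate below compares with it term
  by term.\<close>

locale three_power_series =
  fixes a :: "(3 \<Rightarrow> nat) \<Rightarrow> real" and i j k :: 3 and s A :: real
  assumes ijk: "UNIV = {i, j, k}" "i \<noteq> j" "i \<noteq> k" "j \<noteq> k"
    and s: "s > 0" and A: "((\<lambda>\<alpha>. \<bar>a \<alpha>\<bar> * s ^ (\<alpha> j + \<alpha> k + \<alpha> i)) has_sum A) UNIV"
begin

definition P_term :: "(3 \<Rightarrow> nat) \<Rightarrow> complex \<Rightarrow> complex \<Rightarrow> complex \<Rightarrow> complex" where
  "P_term \<alpha> x y z = of_real (a \<alpha>) * x ^ \<alpha> j * y ^ \<alpha> k * z ^ \<alpha> i"

definition P :: "complex \<Rightarrow> complex \<Rightarrow> complex \<Rightarrow> complex" where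
  "P x y z = (\<Sum>\<^sub>\<infinity>\<alpha>. P_term \<alpha> x y z)"

lemma A_nonneg: "A \<ge> 0"
  by (rule has_sum_nonneg[OF A]) (use s in auto)

lemma index_eqI: "\<alpha> i = \<beta> i \<Longrightarrow> \<alpha> j = \<beta> j \<Longrightarrow> \<alpha> k = \<beta> k \<Longrightarrow> \<alpha> = \<beta>"
  for \<alpha> \<beta> :: "3 \<Rightarrow> nat"
proof
  fix t assume "\<alpha> i = \<beta> i" "\<alpha> j = \<beta> j" "\<alpha> k = \<beta> k"
  moreover have "t \<in> {i, j, k}" using ijk(1) by blast
  ultimately show "\<alpha> t = \<beta> t" by auto
qed

lemma P_term_bound:
  assumes "norm x \<le> s" "norm y \<le> s" "norm z \<le> s"
  shows "norm (P_term \<alpha> x y z) \<le> \<bar>a \<alpha>\<bar> * s ^ (\<alpha> j + \<alpha> k + \<alpha> i)"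
  unfolding P_term_def norm_mult norm_power norm_of_real power_add mult.assoc
  by (intro mult_left_mono mult_mono power_mono assms) (use s in auto)

lemma P_has_sum:
  assumes "norm x \<le> s" "norm y \<le> s" "norm z \<le> s"
  shows "((\<lambda>\<alpha>. P_term \<alpha> x y z) has_sum P x y z) UNIV"
proof -
  have "(\<lambda>\<alpha>. norm (P_term \<alpha> x y z)) summable_on UNIV"
    by (rule summable_on_comparison_test[OF has_sum_imp_summable[OF A]])
       (use P_term_bound[OF assms] in auto)
  then have "(\<lambda>\<alpha>. P_term \<alpha> x y z) summable_on UNIV"
    by (rule abs_summable_summable)
  then show ?thesis unfolding P_def by (rule has_sum_infsum)
qed

text \<open>The partial sums are polynomials in \<open>x\<close>, \<open>y\<close> and
  \<open>w\<close>, and the majorant \<open>A\<close> makes them converge uniformly. This carries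
  holomorphy from one iterate of the fixed point problem to the next.\<close>

lemma bihol_P:
  assumes w: "bihol r w" "r \<le> s" "\<And>x y. norm x < r \<Longrightarrow> norm y < r \<Longrightarrow> norm (w x y) \<le> s"
  shows "bihol r (\<lambda>x y. P x y (w x y))"
proof (rule bihol_uniform_limit)
  show "\<forall>\<^sub>F I in finite_subsets_at_top UNIV. bihol r (\<lambda>x y. \<Sum>\<alpha>\<in>I. P_term \<alpha> x y (w x y))"
    unfolding P_term_def
    by (intro always_eventually allI bihol_sum bihol_mult bihol_power bihol_const bihol_fst bihol_snd w)
  have "uniform_limit (ball 0 r \<times> ball 0 r) (\<lambda>I p. \<Sum>\<alpha>\<in>I. P_term \<alpha> (fst p) (snd p) (w (fst p) (snd p)))
      (\<lambda>p. P (fst p) (snd p) (w (fst p) (snd p))) (finite_subsets_at_top UNIV)"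
    unfolding P_def
    by (rule Weierstrass_m_test_general[OF _ has_sum_imp_summable[OF A]])
       (use w(2,3) in \<open>auto intro!: P_term_bound\<close>)
  then show "uniform_limit (ball 0 r \<times> ball 0 r) (\<lambda>I (x, y). \<Sum>\<alpha>\<in>I. P_term \<alpha> x y (w x y))
      (\<lambda>(x, y). P x y (w x y)) (finite_subsets_at_top UNIV)"
    by (simp add: split_def)
qed simp

text \<open>The coefficients are real. This later makes the solution real at real
  parameters.\<close>

lemma P_cnj:
  assumes "norm x \<le> s" "norm y \<le> s" "norm z \<le> s"
  shows "P (cnj x) (cnj y) (cnj z) = cnj (P x y z)"
proof -
  have "((\<lambda>\<alpha>. cnj (P_term \<alpha> x y z)) has_sum cnj (P x y z)) UNIV"
    using P_has_sum[OF assms] by simp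
  then show ?thesis unfolding P_def by (intro infsumI) (simp add: P_term_def)
qed

text \<open>The coefficient of the monomial \<open>z\<close>, that is the partial derivative of the
  series at its centre in direction \<open>i\<close>.\<close>

definition c :: real where "c = a (\<lambda>t. if t = i then 1 else 0)"

text \<open>At \<open>z = 0\<close> only monomials in \<open>x\<close> and \<open>y\<close> survive,
  and without a constant term each has positive degree; one factor of size \<open>r\<close> in place
  of \<open>s\<close> gains \<open>r / s\<close> over the majorant.\<close>

lemma P_zero_bound:
  assumes a0: "a (\<lambda>_. 0) = 0" and r: "0 \<le> r" "r \<le> s" and xy: "norm x \<le> r" "norm y \<le> r"
  shows "norm (P x y 0) \<le> r / s * A"
proof (rule has_sum_norm_le[OF P_has_sum has_sum_cmult_right[OF A]])
  fix \<alpha> :: "3 \<Rightarrow> nat"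
  show "norm (P_term \<alpha> x y 0) \<le> r / s * (\<bar>a \<alpha>\<bar> * s ^ (\<alpha> j + \<alpha> k + \<alpha> i))"
  proof (cases "\<alpha> i = 0 \<and> a \<alpha> \<noteq> 0")
    case False
    then have "P_term \<alpha> x y 0 = 0" by (auto simp: P_term_def)
    then show ?thesis using r s by simp
  next
    case True
    define n where "n = \<alpha> j + \<alpha> k"
    have "n \<noteq> 0"
    proof
      assume "n = 0"
      then have "\<alpha> = (\<lambda>_. 0)" using True by (intro index_eqI) (auto simp: n_def)
      then show False using True a0 by simp
    qed
    then obtain m where m: "n = Suc m" using not0_implies_Suc by blast
    have "norm (P_term \<alpha> x y 0) \<le> \<bar>a \<alpha>\<bar> * (r ^ \<alpha> j * r ^ \<alpha> k)"
      unfolding P_term_def norm_mult norm_power norm_of_real mult.assoc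
      using True xy r by (intro mult_left_mono) (auto intro!: mult_mono power_mono)
    also have "r ^ \<alpha> j * r ^ \<alpha> k = r * r ^ m" using m by (simp add: n_def flip: power_add)
    also have "\<dots> \<le> r * s ^ m" using r by (intro mult_left_mono power_mono) auto
    also have "\<dots> = r / s * s ^ (\<alpha> j + \<alpha> k + \<alpha> i)" using m s True by (simp add: n_def)
    finally have "norm (P_term \<alpha> x y 0) \<le> \<bar>a \<alpha>\<bar> * (r / s * s ^ (\<alpha> j + \<alpha> k + \<alpha> i))"
      by (simp add: mult_left_mono)
    then show ?thesis by (simp add: mult_ac)
  qed
qed (use xy r s in auto)

text \<open>Once the linear part \<open>c * z\<close> is removed, the terms that depend on
  \<open>z\<close> have total degree at least two, so their Lipschitz constant in \<open>z\<close>
  is of order \<open>d\<close> on a polydisc of radius \<open>d\<close>.\<close>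

lemma P_contraction:
  assumes d: "0 \<le> d" "d \<le> s / 2" and xy: "norm x \<le> d" "norm y \<le> d" and zw: "norm z \<le> d" "norm w \<le> d"
  shows "norm (P x y z - P x y w - of_real c * (z - w)) \<le> 2 * A / s\<^sup>2 * d * norm (z - w)"
proof -
  define e where "e = (\<lambda>t. if t = i then 1 else 0 :: nat)"
  have e: "\<alpha> = e \<longleftrightarrow> \<alpha> i = 1 \<and> \<alpha> j = 0 \<and> \<alpha> k = 0" for \<alpha>
    using index_eqI[of \<alpha> e] ijk by (auto simp: e_def)
  have "((\<lambda>\<alpha>. if \<alpha> \<in> {e} then of_real (a \<alpha>) * (z - w) else 0) has_sum (\<Sum>\<alpha>\<in>{e}. of_real (a \<alpha>) * (z - w))) UNIV"
    by (rule has_sum_finite_neutralI[of "{e}"]) auto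
  then have E: "((\<lambda>\<alpha>. if \<alpha> = e then of_real (a \<alpha>) * (z - w) else 0) has_sum of_real c * (z - w)) UNIV"
    by (simp add: c_def e_def cong: if_cong)
  have ds: "d \<le> s" using d s by auto
  have sum: "((\<lambda>\<alpha>. P_term \<alpha> x y z - P_term \<alpha> x y w - (if \<alpha> = e then of_real (a \<alpha>) * (z - w) else 0))
      has_sum (P x y z - P x y w - of_real c * (z - w))) UNIV"
    by (intro has_sum_diff P_has_sum E) (use xy zw ds in auto)
  have "norm (P x y z - P x y w - of_real c * (z - w)) \<le> 2 / s\<^sup>2 * d * norm (z - w) * A"
  proof (rule has_sum_norm_le[OF sum has_sum_cmult_right[OF A]])
    fix \<alpha> :: "3 \<Rightarrow> nat"
    define N where "N = \<alpha> j + \<alpha> k + \<alpha> i"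
    let ?t = "P_term \<alpha> x y z - P_term \<alpha> x y w - (if \<alpha> = e then of_real (a \<alpha>) * (z - w) else 0)"
    show "norm ?t \<le> 2 / s\<^sup>2 * d * norm (z - w) * (\<bar>a \<alpha>\<bar> * s ^ (\<alpha> j + \<alpha> k + \<alpha> i))"
    proof (cases "\<alpha> = e \<or> \<alpha> i = 0")
      case True
      then have "?t = 0" using e[of \<alpha>] by (auto simp: P_term_def algebra_simps)
      then show ?thesis using d s by simp
    next
      case False
      then have "N \<ge> 2" using e[of \<alpha>] unfolding N_def by linarith
      then obtain M where M: "N = M + 2" using le_Suc_ex by (metis add.commute)
      \<comment> \<open>The degree appears as a factor when powers of \<open>z\<close> and
        \<open>w\<close> are compared. The halved radius, \<open>d \<le> s / 2\<close>, pays for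
        it.\<close>
      have "real (M + 2) \<le> 2 * 2 ^ M" by (induction M) auto
      have "norm ?t = \<bar>a \<alpha>\<bar> * (norm x ^ \<alpha> j * norm y ^ \<alpha> k * norm (z ^ \<alpha> i - w ^ \<alpha> i))"
      proof -
        have "?t = of_real (a \<alpha>) * (x ^ \<alpha> j * y ^ \<alpha> k * (z ^ \<alpha> i - w ^ \<alpha> i))"
          using False by (simp add: P_term_def algebra_simps)
        then show ?thesis by (simp only: norm_mult norm_power norm_of_real)
      qed
      also have "\<dots> \<le> \<bar>a \<alpha>\<bar> * (d ^ \<alpha> j * d ^ \<alpha> k * (real (\<alpha> i) * d ^ (\<alpha> i - 1) * norm (z - w)))"
        by (intro mult_left_mono mult_mono power_mono xy norm_power_diff_le zw) (use d in auto)
      also have "d ^ \<alpha> j * d ^ \<alpha> k * (real (\<alpha> i) * d ^ (\<alpha> i - 1) * norm (z - w))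
          = real (\<alpha> i) * d ^ (N - 1) * norm (z - w)"
      proof -
        have "N - 1 = \<alpha> j + \<alpha> k + (\<alpha> i - 1)" using False by (simp add: N_def)
        then show ?thesis by (simp add: power_add)
      qed
      also have "\<dots> \<le> (2 / s\<^sup>2 * d * s ^ N) * norm (z - w)"
      proof (intro mult_right_mono)
        have "real (\<alpha> i) * d ^ (N - 1) \<le> (2 * 2 ^ M) * (d * (s / 2) ^ M)"
          unfolding M using \<open>real (M + 2) \<le> 2 * 2 ^ M\<close> M d
          by (intro mult_mono) (auto simp: N_def intro!: mult_left_mono power_mono)
        also have "\<dots> = 2 / s\<^sup>2 * d * s ^ N"
          using s by (simp add: M power_add power_divide power2_eq_square)
        finally show "real (\<alpha> i) * d ^ (N - 1) \<le> 2 / s\<^sup>2 * d * s ^ N" .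
      qed simp
      finally have "norm ?t \<le> \<bar>a \<alpha>\<bar> * (2 / s\<^sup>2 * d * s ^ N * norm (z - w))"
        by (simp add: mult_left_mono)
      also have "\<dots> = 2 / s\<^sup>2 * d * norm (z - w) * (\<bar>a \<alpha>\<bar> * s ^ (\<alpha> j + \<alpha> k + \<alpha> i))"
        by (simp add: N_def)
      finally show ?thesis .
    qed
  qed
  then show ?thesis by (simp add: mult_ac)
qed

text \<open>\<open>g\<close> is the fixed point of the contractions \<open>z \<mapsto> z - P x y z / c\<close>. The iterates starting at \<open>0\<close> are
  holomorphic in \<open>x\<close> and \<open>y\<close> and converge uniformly.\<close>

lemma implicit_function:
  assumes a0: "a (\<lambda>_. 0) = 0" and c: "c \<noteq> 0" and e: "e > 0"
  obtains \<rho> \<delta> g where "\<rho> > 0" "\<rho> \<le> e" "\<delta> > 0" "\<delta> \<le> e" "\<rho> \<le> s" "\<delta> \<le> s" "biana \<rho> g"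
    "\<And>x y. \<bar>x\<bar> < \<rho> \<Longrightarrow> \<bar>y\<bar> < \<rho> \<Longrightarrow> \<bar>g x y\<bar> < \<delta>"
    "\<And>x y z. \<bar>x\<bar> < \<rho> \<Longrightarrow> \<bar>y\<bar> < \<rho> \<Longrightarrow> \<bar>z\<bar> < \<delta> \<Longrightarrow>
       P (of_real x) (of_real y) (of_real z) = 0 \<longleftrightarrow> z = g x y"
proof -
  \<comment> \<open>The last entry makes \<open>T\<close> below contract by \<open>1 / 2\<close>.
    \<open>A + 1\<close> stands in for \<open>A\<close>, which may be zero.\<close>
  define \<delta> where "\<delta> = Min {s / 2, e, \<bar>c\<bar> / (4 * (A + 1) / s\<^sup>2)}"
  have \<delta>: "\<delta> > 0" "\<delta> \<le> s / 2" "\<delta> \<le> e" "\<delta> \<le> \<bar>c\<bar> / (4 * (A + 1) / s\<^sup>2)"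
  proof -
    show "\<delta> > 0" using s e c A_nonneg by (auto simp: \<delta>_def)
  qed (unfold \<delta>_def, (rule Min_le; simp)+)
  have cancel: "2 * B / s\<^sup>2 * (\<bar>c\<bar> / (4 * B / s\<^sup>2)) = \<bar>c\<bar> / 2"
    "(\<bar>c\<bar> * d * s / (4 * B)) / s * B = \<bar>c\<bar> * d / 4" if "B \<noteq> 0" for B d
    using s that by (auto simp: field_simps)
  have K: "2 * A / s\<^sup>2 * \<delta> \<le> \<bar>c\<bar> / 2"
  proof -
    have "2 * A / s\<^sup>2 * \<delta> \<le> 2 * (A + 1) / s\<^sup>2 * \<delta>"
      using s \<delta> A_nonneg by (intro mult_right_mono divide_right_mono) auto
    also have "\<dots> \<le> 2 * (A + 1) / s\<^sup>2 * (\<bar>c\<bar> / (4 * (A + 1) / s\<^sup>2))"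
      using s A_nonneg by (intro mult_left_mono \<delta>) auto
    also have "\<dots> = \<bar>c\<bar> / 2" using A_nonneg by (intro cancel) simp
    finally show ?thesis .
  qed
  \<comment> \<open>Chosen so that \<open>T x y 0\<close> has norm at most
    \<open>\<delta> / 4\<close>. With the contraction factor \<open>1 / 2\<close>,
    \<open>T x y\<close> then maps the closed disc of radius \<open>\<delta>\<close> into the open
    one.\<close>
  define \<rho> where "\<rho> = min \<delta> (\<bar>c\<bar> * \<delta> * s / (4 * (A + 1)))"
  have \<rho>: "\<rho> > 0" "\<rho> \<le> \<delta>" "\<rho> \<le> \<bar>c\<bar> * \<delta> * s / (4 * (A + 1))"
    using s c A_nonneg \<delta> by (auto simp: \<rho>_def)
  have R: "\<rho> / s * A \<le> \<bar>c\<bar> * \<delta> / 4"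
  proof -
    have "\<rho> / s * A \<le> \<rho> / s * (A + 1)" using s \<rho> by (intro mult_left_mono) auto
    also have "\<dots> \<le> (\<bar>c\<bar> * \<delta> * s / (4 * (A + 1))) / s * (A + 1)"
      using s A_nonneg by (intro mult_right_mono divide_right_mono \<rho>) auto
    also have "\<dots> = \<bar>c\<bar> * \<delta> / 4" using A_nonneg by (intro cancel) simp
    finally show ?thesis .
  qed
  define T where "T x y z = z - P x y z / of_real c" for x y z
  have T_fix: "T x y z = z \<longleftrightarrow> P x y z = 0" for x y z
    using c by (simp add: T_def)
  have T_lip: "norm (T x y z - T x y w) \<le> 1 / 2 * norm (z - w)"
    if "norm x < \<rho>" "norm y < \<rho>" "norm z \<le> \<delta>" "norm w \<le> \<delta>" for x y z w
  proof -
    have "norm (P x y z - P x y w - of_real c * (z - w)) \<le> 2 * A / s\<^sup>2 * \<delta> * norm (z - w)"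
      by (rule P_contraction) (use that \<delta> \<rho> in auto)
    also have "\<dots> \<le> \<bar>c\<bar> / 2 * norm (z - w)" by (intro mult_right_mono K) simp
    finally have *: "norm (P x y z - P x y w - of_real c * (z - w)) \<le> \<bar>c\<bar> / 2 * norm (z - w)" .
    have "T x y z - T x y w = - (P x y z - P x y w - of_real c * (z - w)) / of_real c"
      using c by (simp add: T_def field_simps)
    then have "norm (T x y z - T x y w) = norm (P x y z - P x y w - of_real c * (z - w)) / \<bar>c\<bar>"
      by (metis norm_divide norm_minus_cancel norm_of_real)
    then show ?thesis using * c by (simp add: divide_le_eq mult_ac)
  qed
  have T_zero: "norm (T x y 0) \<le> \<delta> / 4" if "norm x < \<rho>" "norm y < \<rho>" for x y
  proof -
    have "norm (P x y 0) \<le> \<rho> / s * A"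
      by (rule P_zero_bound[OF a0]) (use that \<rho> \<delta> in auto)
    then have "norm (P x y 0) \<le> \<bar>c\<bar> * \<delta> / 4" using R by linarith
    then show ?thesis using c by (simp add: T_def norm_divide divide_le_eq mult_ac)
  qed
  have T_in: "norm (T x y z) < \<delta>" if "norm x < \<rho>" "norm y < \<rho>" "norm z \<le> \<delta>" for x y z
    using T_lip[OF that(1,2,3), of 0] T_zero[OF that(1,2)] that(3) \<delta>(1)
      norm_triangle_sub[of "T x y z" "T x y 0"] by simp
  have ex1: "\<exists>!z\<in>cball 0 \<delta>. T x y z = z" if "norm x < \<rho>" "norm y < \<rho>" for x y
  proof (rule Banach_fix[where c="1/2"])
    show "T x y ` cball 0 \<delta> \<subseteq> cball 0 \<delta>" using less_imp_le[OF T_in[OF that]] by auto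
    show "dist (T x y z) (T x y w) \<le> 1 / 2 * dist z w" if "z \<in> cball 0 \<delta>" "w \<in> cball 0 \<delta>" for z w
      using T_lip[of x y z w] \<open>norm x < \<rho>\<close> \<open>norm y < \<rho>\<close> that by (simp add: dist_norm)
  qed (use \<delta> in \<open>auto simp: complete_eq_closed\<close>)
  define f where "f x y = (THE z. z \<in> cball 0 \<delta> \<and> T x y z = z)" for x y
  have f: "norm (f x y) \<le> \<delta> \<and> T x y (f x y) = f x y" if "norm x < \<rho>" "norm y < \<rho>" for x y
    using theI'[OF ex1[OF that]] unfolding f_def by simp
  have f_uniq: "z = f x y" if "norm x < \<rho>" "norm y < \<rho>" "norm z \<le> \<delta>" "T x y z = z" for x y z
    using ex1[OF that(1,2)] f[OF that(1,2)] that(3,4) by auto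
  define F where "F n x y = (T x y ^^ n) 0" for n x y
  have F: "norm (F n x y) \<le> \<delta> \<and> norm (F n x y - f x y) \<le> (1 / 2) ^ n * \<delta>"
    if "norm x < \<rho>" "norm y < \<rho>" for n x y
  proof (induction n)
    case 0 then show ?case using f[OF that] \<delta> by (simp add: F_def)
  next
    case (Suc n)
    have "F (Suc n) x y = T x y (F n x y)" by (simp add: F_def)
    moreover have "norm (T x y (F n x y) - f x y) \<le> 1 / 2 * norm (F n x y - f x y)"
      using T_lip[OF that, of "F n x y" "f x y"] f[OF that] Suc by simp
    moreover have "1 / 2 * norm (F n x y - f x y) \<le> (1 / 2) ^ Suc n * \<delta>"
      using Suc by simp
    ultimately show ?case
      using T_in[OF that, of "F n x y"] Suc by auto
  qed
  have "bihol \<rho> (F n)" for n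
  proof (induction n)
    case 0 then show ?case by (simp add: F_def)
  next
    case (Suc n)
    have "bihol \<rho> (\<lambda>x y. P x y (F n x y))"
      by (rule bihol_P[OF Suc]) (use \<rho> \<delta> F[of _ _ n] in force)+
    then have "bihol \<rho> (\<lambda>x y. F n x y + (- 1 / of_real c) * P x y (F n x y))"
      by (intro bihol_add bihol_mult bihol_const Suc)
    then show ?case by (simp add: F_def T_def)
  qed
  moreover have "uniform_limit (ball 0 \<rho> \<times> ball 0 \<rho>) (\<lambda>n (x, y). F n x y) (\<lambda>(x, y). f x y) sequentially"
  proof (rule uniform_limitI)
    fix e' :: real assume e': "e' > 0"
    have "(\<lambda>n. (1 / 2) ^ n * \<delta>) \<longlonglongrightarrow> 0 * \<delta>" by (intro tendsto_intros LIMSEQ_power_zero) simp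
    then have "\<forall>\<^sub>F n in sequentially. (1 / 2) ^ n * \<delta> < e'" using e' order_tendstoD(2) by fastforce
    then show "\<forall>\<^sub>F n in sequentially. \<forall>p\<in>ball 0 \<rho> \<times> ball 0 \<rho>.
        dist (case p of (x, y) \<Rightarrow> F n x y) (case p of (x, y) \<Rightarrow> f x y) < e'"
    proof eventually_elim
      case (elim n)
      show ?case
      proof clarsimp
        fix x y :: complex assume "norm x < \<rho>" "norm y < \<rho>"
        then show "dist (F n x y) (f x y) < e'" using F[of x y n] elim by (simp add: dist_norm)
      qed
    qed
  qed
  ultimately have hol: "bihol \<rho> f"
    by (intro bihol_uniform_limit[of \<rho> F sequentially]) auto
  define g where "g x y = Re (f (of_real x) (of_real y))" for x y
  \<comment> \<open>At real parameters the conjugate of the fixed point is again a fixed point, so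
    uniqueness makes it real.\<close>
  have f_real: "f (of_real x) (of_real y) = of_real (g x y)" if "\<bar>x\<bar> < \<rho>" "\<bar>y\<bar> < \<rho>" for x y
  proof -
    let ?z = "f (of_real x) (of_real y)"
    have z: "norm ?z \<le> \<delta>" "P (of_real x) (of_real y) ?z = 0" using f[of "of_real x" "of_real y"] that T_fix by auto
    have "P (of_real x) (of_real y) (cnj ?z) = cnj (P (of_real x) (of_real y) ?z)"
      using P_cnj[of "of_real x" "of_real y" ?z] that \<rho> \<delta> z by simp
    then have "cnj ?z = ?z" using z that by (intro f_uniq) (auto simp: T_fix)
    then show ?thesis unfolding g_def by (simp add: complex_eq_iff)
  qed
  show thesis
  proof (rule that[of \<rho> \<delta> g])
    show "biana \<rho> g" unfolding biana_def using hol f_real by blast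
    show "\<bar>g x y\<bar> < \<delta>" if "\<bar>x\<bar> < \<rho>" "\<bar>y\<bar> < \<rho>" for x y
      using f[of "of_real x" "of_real y"] T_in[of "of_real x" "of_real y" "f (of_real x) (of_real y)"] that
      by (simp add: f_real[OF that])
    show "P (of_real x) (of_real y) (of_real z) = 0 \<longleftrightarrow> z = g x y"
      if xyz: "\<bar>x\<bar> < \<rho>" "\<bar>y\<bar> < \<rho>" "\<bar>z\<bar> < \<delta>" for x y z
    proof
      assume "P (of_real x) (of_real y) (of_real z) = 0"
      then have "of_real z = f (of_real x) (of_real y)"
        by (intro f_uniq) (use xyz T_fix in auto)
      then show "z = g x y" by (metis g_def Re_complex_of_real)
    next
      assume "z = g x y"
      then show "P (of_real x) (of_real y) (of_real z) = 0"
        using f[of "of_real x" "of_real y"] xyz T_fix by (simp flip: f_real)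
    qed
  qed (use \<rho> \<delta> in auto)
qed

end

lemma analytic_implicit_function:
  fixes u :: "real ^ 3 \<Rightarrow> real"
  assumes ijk: "UNIV = {i, j, k}" "i \<noteq> j" "i \<noteq> k" "j \<noteq> k"
    and u: "real_analytic_on u U" "p \<in> U" "u p = 0"
    and du: "u differentiable (at p)" "frechet_derivative u (at p) (axis i 1) \<noteq> 0" and e: "e > 0"
  obtains \<rho> \<delta> g where "\<rho> > 0" "\<rho> \<le> e" "\<delta> > 0" "\<delta> \<le> e" "biana \<rho> g"
    "\<And>x y. \<bar>x\<bar> < \<rho> \<Longrightarrow> \<bar>y\<bar> < \<rho> \<Longrightarrow> \<bar>g x y\<bar> < \<delta>"
    "\<And>x y z. \<bar>x\<bar> < \<rho> \<Longrightarrow> \<bar>y\<bar> < \<rho> \<Longrightarrow> \<bar>z\<bar> < \<delta> \<Longrightarrow>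
       u (p + x *\<^sub>R axis j 1 + y *\<^sub>R axis k 1 + z *\<^sub>R axis i 1) = 0 \<longleftrightarrow> z = g x y"
proof -
  obtain a r where r: "r > 0"
    and a: "\<And>q. q \<in> ball p r \<Longrightarrow> ((\<lambda>\<alpha>. a \<alpha> * (\<Prod>i\<in>UNIV. (q $ i - p $ i) ^ \<alpha> i)) has_sum u q) UNIV"
    using u(1,2) unfolding real_analytic_on_def by blast
  \<comment> \<open>Displacements of size at most \<open>s\<close> along the three axes add up to at
    most \<open>3 * s < r\<close>.\<close>
  define s where "s = r / 4"
  have s: "s > 0" using r by (simp add: s_def)
  define q where "q x y z = p + x *\<^sub>R axis j 1 + y *\<^sub>R axis k 1 + z *\<^sub>R axis i 1" for x y z :: real
  have sum: "((\<lambda>\<alpha>. a \<alpha> * (x ^ \<alpha> j * y ^ \<alpha> k * z ^ \<alpha> i)) has_sum u (q x y z)) UNIV"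
    if "\<bar>x\<bar> \<le> s" "\<bar>y\<bar> \<le> s" "\<bar>z\<bar> \<le> s" for x y z
  proof -
    have "norm (q x y z - p) \<le> \<bar>x\<bar> + \<bar>y\<bar> + \<bar>z\<bar>"
      unfolding q_def using norm_triangle_ineq[of "x *\<^sub>R axis j 1 + y *\<^sub>R axis k 1" "z *\<^sub>R axis i (1::real)"]
        norm_triangle_ineq[of "x *\<^sub>R axis j (1::real)" "y *\<^sub>R axis k 1"]
      by (simp add: norm_axis_1 algebra_simps)
    then have "q x y z \<in> ball p r" using that s by (simp add: dist_norm norm_minus_commute s_def)
    moreover have "(\<Prod>t\<in>UNIV. (q x y z $ t - p $ t) ^ \<alpha> t) = x ^ \<alpha> j * y ^ \<alpha> k * z ^ \<alpha> i" for \<alpha>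
    proof -
      have "(\<Prod>t\<in>UNIV. (q x y z $ t - p $ t) ^ \<alpha> t) = (\<Prod>t\<in>{i, j, k}. (q x y z $ t - p $ t) ^ \<alpha> t)"
        by (simp only: ijk(1))
      then show ?thesis using ijk(2-4) by (simp add: q_def axis_def mult_ac)
    qed
    ultimately show ?thesis using a[of "q x y z"] by simp
  qed
  \<comment> \<open>Summability at the corner \<open>(s, s, s)\<close> is unconditional, hence
    absolute; this produces the majorant.\<close>
  have "(\<lambda>\<alpha>. \<bar>a \<alpha> * (s ^ \<alpha> j * s ^ \<alpha> k * s ^ \<alpha> i)\<bar>) summable_on UNIV"
    using has_sum_imp_summable[OF sum[of s s s]] s
      iffD1[OF summable_on_iff_abs_summable_on_real, of "\<lambda>\<alpha>. a \<alpha> * (s ^ \<alpha> j * s ^ \<alpha> k * s ^ \<alpha> i)"]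
    by simp
  then have "(\<lambda>\<alpha>. \<bar>a \<alpha>\<bar> * s ^ (\<alpha> j + \<alpha> k + \<alpha> i)) summable_on UNIV"
    using s by (simp add: abs_mult power_add)
  then obtain A where "((\<lambda>\<alpha>. \<bar>a \<alpha>\<bar> * s ^ (\<alpha> j + \<alpha> k + \<alpha> i)) has_sum A) UNIV"
    unfolding summable_on_def by blast
  then interpret three_power_series a i j k s A
    by (rule three_power_series.intro[OF ijk s])
  have P: "P (of_real x) (of_real y) (of_real z) = of_real (u (q x y z))"
    if "\<bar>x\<bar> \<le> s" "\<bar>y\<bar> \<le> s" "\<bar>z\<bar> \<le> s" for x y z
  proof -
    have "((\<lambda>\<alpha>. complex_of_real (a \<alpha> * (x ^ \<alpha> j * y ^ \<alpha> k * z ^ \<alpha> i))) has_sum of_real (u (q x y z))) UNIV"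
      by (rule has_sum_of_real[OF sum[OF that]])
    then show ?thesis unfolding P_def by (intro infsumI) (simp add: P_term_def mult.assoc)
  qed
  have a0: "a (\<lambda>_. 0) = 0"
  proof -
    have "((\<lambda>\<alpha>. if \<alpha> \<in> {\<lambda>_. 0} then a \<alpha> else 0) has_sum (\<Sum>\<alpha>\<in>{\<lambda>_. 0}. a \<alpha>)) UNIV"
      by (rule has_sum_finite_neutralI[of "{\<lambda>_. 0}"]) auto
    also have "(\<lambda>\<alpha>. if \<alpha> \<in> {\<lambda>_. 0} then a \<alpha> else 0) = (\<lambda>\<alpha>. a \<alpha> * (0 ^ \<alpha> j * 0 ^ \<alpha> k * 0 ^ \<alpha> i))"
    proof
      fix \<alpha> :: "3 \<Rightarrow> nat"
      show "(if \<alpha> \<in> {\<lambda>_. 0} then a \<alpha> else 0) = a \<alpha> * (0 ^ \<alpha> j * 0 ^ \<alpha> k * 0 ^ \<alpha> i)"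
      proof (cases "\<alpha> i = 0 \<and> \<alpha> j = 0 \<and> \<alpha> k = 0")
        case True
        then have "\<alpha> = (\<lambda>_. 0)" by (intro index_eqI) auto
        then show ?thesis by simp
      qed auto
    qed
    finally show ?thesis using has_sum_unique[OF _ sum[of 0 0 0]] s u(3) by (simp add: q_def)
  qed
  \<comment> \<open>\<open>c\<close> is identified with the partial derivative of \<open>u\<close>
    in direction \<open>i\<close>: on the axis \<open>x = y = 0\<close>,
    \<open>P_contraction\<close> makes the error of the linear approximation \<open>c * z\<close>
    quadratic.\<close>
  have c: "c \<noteq> 0"
  proof -
    have bound: "\<bar>u (q 0 0 z) - c * z\<bar> \<le> 2 * A / s\<^sup>2 * \<bar>z\<bar> * \<bar>z\<bar>" if "\<bar>z\<bar> \<le> s / 2" for z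
    proof -
      have "norm (P 0 0 (of_real z) - P 0 0 0 - of_real c * (of_real z - 0)) \<le> 2 * A / s\<^sup>2 * \<bar>z\<bar> * norm (of_real z - 0 :: complex)"
        by (rule P_contraction) (use that in auto)
      also have "P 0 0 (of_real z) - P 0 0 0 - of_real c * (of_real z - 0) = of_real (u (q 0 0 z) - c * z)"
        using P[of 0 0 z] P[of 0 0 0] that s u(3) by (simp add: q_def)
      finally show ?thesis by (simp only: norm_of_real) simp
    qed
    have "((\<lambda>z. u (q 0 0 z)) has_field_derivative c) (at 0)"
      unfolding DERIV_def
    proof (rule Lim_null_comparison[where g="\<lambda>h. 2 * A / s\<^sup>2 * \<bar>h\<bar>", THEN LIM_zero_cancel])
      show "(\<lambda>h. 2 * A / s\<^sup>2 * \<bar>h\<bar>) \<midarrow>0\<rightarrow> 0" using s by (auto intro!: tendsto_eq_intros)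
      have "\<forall>\<^sub>F h in at (0::real). h \<in> {-(s/2)<..<s/2} - {0}"
        using s by (intro eventually_at_in_open) auto
      then show "\<forall>\<^sub>F h in at 0. norm ((u (q 0 0 (0 + h)) - u (q 0 0 0)) / h - c) \<le> 2 * A / s\<^sup>2 * \<bar>h\<bar>"
      proof eventually_elim
        case (elim h)
        then have "(u (q 0 0 (0 + h)) - u (q 0 0 0)) / h - c = (u (q 0 0 h) - c * h) / h"
          using u(3) by (simp add: q_def field_simps)
        moreover have "\<bar>h\<bar> \<le> s / 2" using elim unfolding abs_le_iff by auto
        ultimately show ?case using bound[of h] elim by (simp add: abs_divide divide_le_eq mult_ac)
      qed
    qed
    moreover have "((\<lambda>z. u (q 0 0 z)) has_field_derivative frechet_derivative u (at p) (axis i 1)) (at 0)"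
    proof -
      have D: "(u has_derivative frechet_derivative u (at p)) (at (q 0 0 0))"
        using du(1) by (simp add: q_def frechet_derivative_works)
      have "((\<lambda>z. q 0 0 z) has_derivative (\<lambda>h. h *\<^sub>R axis i 1)) (at 0)"
        unfolding q_def by (auto intro!: derivative_eq_intros)
      from has_derivative_compose[OF this D]
      have "((\<lambda>z. u (q 0 0 z)) has_derivative (\<lambda>h. frechet_derivative u (at p) (h *\<^sub>R axis i 1))) (at 0)" .
      moreover have "linear (frechet_derivative u (at p))" using du(1) by (rule linear_frechet_derivative)
      ultimately have "((\<lambda>z. u (q 0 0 z)) has_derivative (\<lambda>h. h * frechet_derivative u (at p) (axis i 1))) (at 0)"
        by (simp add: linear_cmul)
      then show ?thesis
        unfolding has_field_derivative_def by (simp only: mult_commute_abs)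
    qed
    ultimately show ?thesis using DERIV_unique du(2) by metis
  qed
  show thesis
  proof (rule implicit_function[OF a0 c e], goal_cases)
    case (1 \<rho> \<delta> g)
    have "u (q x y z) = 0 \<longleftrightarrow> z = g x y" if "\<bar>x\<bar> < \<rho>" "\<bar>y\<bar> < \<rho>" "\<bar>z\<bar> < \<delta>" for x y z
      using 1(9)[OF that] P[of x y z] that 1(5,6) by simp
    then show ?thesis using that[of \<rho> \<delta> g] 1 unfolding q_def by blast
  qed
qed

section \<open>Integrability of the derivative of an angle\<close>

text \<open>\<open>F\<close> is not given at the endpoints, so the interval is exhausted by compact
  ones; on each the integral is a difference of two values of \<open>F\<close>, at most
  \<open>2 * B\<close>.\<close>

lemma nn_integral_bounded_antiderivative:
  fixes f F :: "real \<Rightarrow> real"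
  assumes ab: "a < b" and f: "f \<in> borel_measurable borel"
    and F: "\<And>x. a < x \<Longrightarrow> x < b \<Longrightarrow> DERIV F x :> f x"
    and nn: "\<And>x. a < x \<Longrightarrow> x < b \<Longrightarrow> 0 \<le> f x"
    and B: "\<And>x. a < x \<Longrightarrow> x < b \<Longrightarrow> \<bar>F x\<bar> \<le> B"
  shows "(\<integral>\<^sup>+x. ennreal (f x) * indicator {a<..<b} x \<partial>lborel) \<le> ennreal (2 * B)"
proof -
  \<comment> \<open>\<open>+ 3\<close> keeps \<open>2 * h n\<close> below \<open>b - a\<close>, so
    that every compact interval is nondegenerate.\<close>
  define h where "h n = (b - a) / (real n + 3)" for n
  define I where "I n = {a + h n..b - h n}" for n
  have h: "h n > 0" "2 * h n < b - a" for n
    using ab mult_strict_left_mono[of 2 "real n + 3" "b - a"]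
    by (simp_all add: h_def pos_divide_less_eq mult.commute)
  have hmono: "h n \<le> h m" if "m \<le> n" for m n
    unfolding h_def using that ab by (intro divide_left_mono) auto
  have h0: "\<exists>n. h n < e" if "e > 0" for e
  proof -
    obtain n :: nat where "(b - a) / e < n" using reals_Archimedean2 by blast
    then have "b - a < real n * e" using that by (simp add: field_simps)
    also have "\<dots> \<le> (real n + 3) * e" using that by simp
    finally show ?thesis by (intro exI[of _ n]) (simp add: h_def field_simps)
  qed
  have "(\<Union>n. I n) = {a<..<b}"
  proof (intro set_eqI iffI)
    fix x assume "x \<in> (\<Union>n. I n)"
    then obtain n where "x \<in> I n" by blast
    then show "x \<in> {a<..<b}" using h[of n] by (auto simp: I_def)
  next
    fix x assume x: "x \<in> {a<..<b}"
    then obtain n where "h n < min (x - a) (b - x)" using h0[of "min (x - a) (b - x)"] by auto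
    then show "x \<in> (\<Union>n. I n)" by (auto simp: I_def intro!: exI[of _ n])
  qed
  moreover have "incseq I"
    unfolding incseq_def I_def using hmono by fastforce
  ultimately have "emeasure (density lborel f) {a<..<b} = (SUP n. emeasure (density lborel f) (I n))"
    by (subst SUP_emeasure_incseq) (auto simp: I_def)
  also have "\<dots> \<le> ennreal (2 * B)"
  proof (rule SUP_least)
    fix n
    have sub: "a < x \<and> x < b" if "x \<in> {a + h n..b - h n}" for x using that h(1)[of n] by auto
    have "emeasure (density lborel f) (I n) = (\<integral>\<^sup>+x. ennreal (f x) * indicator {a + h n..b - h n} x \<partial>lborel)"
      using f by (simp add: I_def emeasure_density)
    also have "\<dots> = F (b - h n) - F (a + h n)"
      by (rule nn_integral_FTC_Icc[OF f]) (use sub F nn h(2)[of n] in auto)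
    also have "F (b - h n) - F (a + h n) \<le> 2 * B"
      using B[of "b - h n"] B[of "a + h n"] sub[of "b - h n"] sub[of "a + h n"] h(2)[of n] by auto
    finally show "emeasure (density lborel f) (I n) \<le> ennreal (2 * B)"
      using ennreal_leI by simp
  qed
  finally show ?thesis using f by (simp add: emeasure_density)
qed

text \<open>Cut at one point of \<open>Z\<close> and induct on their number. The \<open>+ 1\<close>
  is there because the pieces outnumber the cut points by one; a cut point itself is a null
  set.\<close>

lemma nn_integral_interval_pieces:
  fixes f :: "real \<Rightarrow> ennreal"
  assumes f: "f \<in> borel_measurable borel" and Z: "finite Z"
    and piece: "\<And>a b. lo \<le> a \<Longrightarrow> a < b \<Longrightarrow> b \<le> hi \<Longrightarrow> {a<..<b} \<inter> Z = {} \<Longrightarrow>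
      (\<integral>\<^sup>+x. f x * indicator {a<..<b} x \<partial>lborel) \<le> K"
    and ab: "lo \<le> a" "a < b" "b \<le> hi"
  shows "(\<integral>\<^sup>+x. f x * indicator {a<..<b} x \<partial>lborel) \<le> of_nat (card ({a<..<b} \<inter> Z) + 1) * K"
  using ab
proof (induction "card ({a<..<b} \<inter> Z)" arbitrary: a b rule: less_induct)
  case less
  show ?case
  proof (cases "{a<..<b} \<inter> Z = {}")
    case True
    then show ?thesis using piece[OF less.prems True] by simp
  next
    case False
    then obtain z where z: "z \<in> Z" "a < z" "z < b" by auto
    let ?n = "\<lambda>a b. card ({a<..<b} \<inter> Z)"
    have split: "{a<..<b} \<inter> Z = insert z (({a<..<z} \<inter> Z) \<union> ({z<..<b} \<inter> Z))" using z by auto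
    have "?n a b = Suc (card (({a<..<z} \<inter> Z) \<union> ({z<..<b} \<inter> Z)))"
      unfolding split using Z by (subst card_insert_disjoint) auto
    also have "card (({a<..<z} \<inter> Z) \<union> ({z<..<b} \<inter> Z)) = ?n a z + ?n z b"
      using Z by (intro card_Un_disjoint) auto
    finally have n: "?n a b = ?n a z + ?n z b + 1" by simp
    have "(\<integral>\<^sup>+x. f x * indicator {a<..<b} x \<partial>lborel) =
        (\<integral>\<^sup>+x. f x * indicator {a<..<z} x + f x * indicator {z<..<b} x \<partial>lborel)"
      by (rule nn_integral_cong_AE)
         (use AE_lborel_singleton[of z] z in \<open>auto split: split_indicator elim!: eventually_mono\<close>)
    also have "\<dots> = (\<integral>\<^sup>+x. f x * indicator {a<..<z} x \<partial>lborel) + (\<integral>\<^sup>+x. f x * indicator {z<..<b} x \<partial>lborel)"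
      using f by (intro nn_integral_add) auto
    also have "\<dots> \<le> of_nat (?n a z + 1) * K + of_nat (?n z b + 1) * K"
      using n less.prems z by (intro add_mono less.hyps) auto
    also have "\<dots> = of_nat (?n a b + 1) * K"
      unfolding n by (simp add: algebra_simps)
    finally show ?thesis .
  qed
qed

lemma continuous_no_zero_sign:
  fixes w :: "real \<Rightarrow> real"
  assumes "continuous_on {a<..<b} w" "\<And>x. a < x \<Longrightarrow> x < b \<Longrightarrow> w x \<noteq> 0"
  shows "(\<forall>x\<in>{a<..<b}. w x > 0) \<or> (\<forall>x\<in>{a<..<b}. w x < 0)"
proof (rule ccontr)
  assume "\<not> ?thesis"
  then obtain x y where xy: "x \<in> {a<..<b}" "y \<in> {a<..<b}" "w x \<le> 0" "w y \<ge> 0"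
    by (metis linorder_not_le)
  have "connected (w ` {a<..<b})" using assms(1) by (intro connected_continuous_image) auto
  then have "0 \<in> w ` {a<..<b}"
    by (rule connectedD_interval[of _ "w x" "w y"]) (use xy in auto)
  then show False using assms(2) by auto
qed

text \<open>The integrand is the absolute value of the derivative of the angle of \<open>(g1, g2)\<close>. Between
  consecutive zeros of \<open>g1\<close> and of the derivative, the angle is monotone and varies by at
  most \<open>pi\<close>.\<close>

lemma nn_integral_angle_derivative:
  fixes g1 g2 g1' g2' :: "real \<Rightarrow> real"
  defines "w \<equiv> \<lambda>x. g1 x * g2' x - g2 x * g1' x"
  assumes r: "lo < hi"
    and D: "\<And>x. lo < x \<Longrightarrow> x < hi \<Longrightarrow> DERIV g1 x :> g1' x" "\<And>x. lo < x \<Longrightarrow> x < hi \<Longrightarrow> DERIV g2 x :> g2' x"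
    and w: "continuous_on {lo<..<hi} w"
    and Z: "finite {x. lo < x \<and> x < hi \<and> g1 x = 0}" "finite {x. lo < x \<and> x < hi \<and> w x = 0}"
  shows "(\<integral>\<^sup>+x. ennreal (\<bar>w x\<bar> / ((g1 x)\<^sup>2 + (g2 x)\<^sup>2)) * indicator {lo<..<hi} x \<partial>lborel)
    \<le> ennreal (pi * (real (card {x. lo < x \<and> x < hi \<and> g1 x = 0})
                    + real (card {x. lo < x \<and> x < hi \<and> w x = 0}) + 1))"
proof -
  let ?Z1 = "{x. lo < x \<and> x < hi \<and> g1 x = 0}" and ?Z2 = "{x. lo < x \<and> x < hi \<and> w x = 0}"
  define I where "I = {lo<..<hi}"
  \<comment> \<open>Continuity is only known on the open interval; cutting off by the indicator
    gives Borel functions on the whole line.\<close>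
  define wI g1I g2I where I: "wI x = indicator I x * w x" "g1I x = indicator I x * g1 x"
    "g2I x = indicator I x * g2 x" for x
  define q where "q x = indicator I x * (\<bar>wI x\<bar> / ((g1I x)\<^sup>2 + (g2I x)\<^sup>2))" for x
  have cont: "continuous_on I g1" "continuous_on I g2"
    using D by (auto simp: I_def intro!: continuous_at_imp_continuous_on DERIV_isCont)
  have meas: "(\<lambda>x. indicator I x * g x) \<in> borel_measurable borel" if "continuous_on I g" for g :: "real \<Rightarrow> real"
    using borel_measurable_continuous_on_indicator[OF _ that] by (simp add: I_def)
  have [measurable]: "wI \<in> borel_measurable borel" "g1I \<in> borel_measurable borel"
    "g2I \<in> borel_measurable borel" "I \<in> sets borel"
    unfolding I[abs_def] using meas[OF cont(1)] meas[OF cont(2)] meas[OF w[folded I_def]]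
    by (auto simp: I_def)
  have [measurable]: "q \<in> borel_measurable borel"
    unfolding q_def by measurable
  have q: "q x = \<bar>w x\<bar> / ((g1 x)\<^sup>2 + (g2 x)\<^sup>2)" if "lo < x" "x < hi" for x
    using that by (simp add: q_def I I_def)
  have "(\<integral>\<^sup>+x. ennreal (\<bar>w x\<bar> / ((g1 x)\<^sup>2 + (g2 x)\<^sup>2)) * indicator {lo<..<hi} x \<partial>lborel)
      = (\<integral>\<^sup>+x. ennreal (q x) * indicator {lo<..<hi} x \<partial>lborel)"
    by (intro nn_integral_cong) (auto simp: q split: split_indicator)
  also have "\<dots> \<le> of_nat (card ({lo<..<hi} \<inter> (?Z1 \<union> ?Z2)) + 1) * ennreal pi"
  proof (rule nn_integral_interval_pieces[of _ _ lo hi])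
    fix a b assume ab: "lo \<le> a" "a < b" "b \<le> hi" "{a<..<b} \<inter> (?Z1 \<union> ?Z2) = {}"
    have nz: "g1 x \<noteq> 0" "w x \<noteq> 0" if "a < x" "x < b" for x
      using ab that by auto
    have "continuous_on {a<..<b} w" using w by (rule continuous_on_subset) (use ab in auto)
    then have sgn: "(\<forall>x\<in>{a<..<b}. w x > 0) \<or> (\<forall>x\<in>{a<..<b}. w x < 0)"
      by (rule continuous_no_zero_sign) (rule nz)
    \<comment> \<open>The constant sign of \<open>w\<close> on the piece. It gives the integrand the
      antiderivative \<open>s * arctan (g2 x / g1 x)\<close>, with values in an interval of length
      \<open>pi\<close>.\<close>
    obtain s :: real where s: "\<bar>s\<bar> = 1" "\<And>x. x \<in> {a<..<b} \<Longrightarrow> \<bar>w x\<bar> = s * w x"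
      using sgn by (metis abs_1 abs_minus_cancel abs_of_neg abs_of_pos mult_1 mult_minus1)
    have "(\<integral>\<^sup>+x. ennreal (q x) * indicator {a<..<b} x \<partial>lborel) \<le> ennreal (2 * (pi / 2))"
    proof (rule nn_integral_bounded_antiderivative[where F="\<lambda>x. s * arctan (g2 x / g1 x)"])
      fix x assume x: "a < x" "x < b"
      have x': "lo < x" "x < hi" using x ab by auto
      have "DERIV (\<lambda>x. s * arctan (g2 x / g1 x)) x :>
          s * (inverse (1 + (g2 x / g1 x)\<^sup>2) * ((g2' x * g1 x - g2 x * g1' x) / (g1 x * g1 x)))"
        using nz(1)[OF x] D(1)[OF x'] D(2)[OF x']
        by (auto intro!: derivative_eq_intros DERIV_cmult)
      moreover have "s * (inverse (1 + (g2 x / g1 x)\<^sup>2) * ((g2' x * g1 x - g2 x * g1' x) / (g1 x * g1 x))) = q x"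
      proof -
        have "(1 + (g2 x / g1 x)\<^sup>2) * (g1 x * g1 x) = (g1 x)\<^sup>2 + (g2 x)\<^sup>2"
          using nz(1)[OF x] by (simp add: field_simps power2_eq_square)
        then show ?thesis
          unfolding q[OF x'] s(2)[of x, simplified, OF conjI[OF x]]
          by (simp add: w_def divide_inverse mult_ac flip: inverse_mult_distrib)
      qed
      ultimately show "DERIV (\<lambda>x. s * arctan (g2 x / g1 x)) x :> q x" by simp
      show "\<bar>s * arctan (g2 x / g1 x)\<bar> \<le> pi / 2"
      proof -
        have "\<bar>arctan (g2 x / g1 x)\<bar> \<le> pi / 2"
          using arctan_bounded[of "g2 x / g1 x"] by linarith
        then show ?thesis using s(1) by (simp only: abs_mult mult_1)
      qed
      show "0 \<le> q x" using q[OF x'] by simp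
    qed (use ab in auto)
    then show "(\<integral>\<^sup>+x. ennreal (q x) * indicator {a<..<b} x \<partial>lborel) \<le> ennreal pi" by simp
  qed (use Z r in auto)
  also have "\<dots> \<le> ennreal (pi * (real (card ?Z1) + real (card ?Z2) + 1))"
  proof -
    have "card ({lo<..<hi} \<inter> (?Z1 \<union> ?Z2)) \<le> card (?Z1 \<union> ?Z2)"
      using Z by (intro card_mono) auto
    also have "\<dots> \<le> card ?Z1 + card ?Z2" by (rule card_Un_le)
    finally have "real (card ({lo<..<hi} \<inter> (?Z1 \<union> ?Z2)) + 1) * pi \<le> (real (card ?Z1) + real (card ?Z2) + 1) * pi"
      by (intro mult_right_mono) auto
    then have "ennreal (real (card ({lo<..<hi} \<inter> (?Z1 \<union> ?Z2)) + 1) * pi)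
        \<le> ennreal ((real (card ?Z1) + real (card ?Z2) + 1) * pi)"
      by (rule ennreal_leI)
    then show ?thesis
      by (simp only: ennreal_of_nat_eq_real_of_nat ennreal_mult'' pi_ge_zero mult.commute[of pi] of_nat_0_le_iff)
  qed
  finally show ?thesis .
qed

lemma nn_integral_inverse_sqrt_finite:
  assumes r: "r > 0"
  shows "(\<integral>\<^sup>+y. ennreal (1 / sqrt \<bar>y\<bar>) * indicator {-r<..<r} y \<partial>lborel) < \<infinity>"
proof -
  have 1: "(\<integral>\<^sup>+y. ennreal (1 / sqrt \<bar>y\<bar>) * indicator {0<..<r} y \<partial>lborel) \<le> ennreal (2 * (2 * sqrt r))"
    by (rule nn_integral_bounded_antiderivative[where F="\<lambda>y. 2 * sqrt y"])
       (use r in \<open>auto intro!: derivative_eq_intros simp: field_simps\<close>)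
  have 2: "(\<integral>\<^sup>+y. ennreal (1 / sqrt \<bar>y\<bar>) * indicator {-r<..<0} y \<partial>lborel) \<le> ennreal (2 * (2 * sqrt r))"
    by (rule nn_integral_bounded_antiderivative[where F="\<lambda>y. - 2 * sqrt (- y)"])
       (use r in \<open>auto intro!: derivative_eq_intros simp: field_simps\<close>)
  have "(\<integral>\<^sup>+y. ennreal (1 / sqrt \<bar>y\<bar>) * indicator {-r<..<r} y \<partial>lborel)
      = (\<integral>\<^sup>+y. ennreal (1 / sqrt \<bar>y\<bar>) * indicator {0<..<r} y
           + ennreal (1 / sqrt \<bar>y\<bar>) * indicator {-r<..<0} y \<partial>lborel)"
    by (rule nn_integral_cong_AE)
       (use AE_lborel_singleton[of 0] r in \<open>auto split: split_indicator elim!: eventually_mono\<close>)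
  also have "\<dots> = (\<integral>\<^sup>+y. ennreal (1 / sqrt \<bar>y\<bar>) * indicator {0<..<r} y \<partial>lborel)
      + (\<integral>\<^sup>+y. ennreal (1 / sqrt \<bar>y\<bar>) * indicator {-r<..<0} y \<partial>lborel)"
    by (intro nn_integral_add) auto
  also have "\<dots> \<le> ennreal (2 * (2 * sqrt r)) + ennreal (2 * (2 * sqrt r))"
    by (intro add_mono 1 2)
  also have "\<dots> < \<infinity>" by simp
  finally show ?thesis .
qed

text \<open>Integrate over \<open>x\<close> first: at height \<open>y\<close> the angle estimate and
  the zero counts of \<open>g1\<close> and \<open>w\<close> give
  \<open>O(1 / sqrt \<bar>y\<bar>)\<close>, which is integrable in \<open>y\<close>. If one of the
  two functions vanishes identically near the origin, the integrand is zero there.\<close>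

lemma biana_angle_integrable:
  assumes r: "r > 0" and g: "biana r g1" "biana r g2" "biana r g1'" "biana r g2'"
    and D: "\<And>x y. \<bar>x\<bar> < r \<Longrightarrow> \<bar>y\<bar> < r \<Longrightarrow> DERIV (\<lambda>t. g1 t y) x :> g1' x y"
      "\<And>x y. \<bar>x\<bar> < r \<Longrightarrow> \<bar>y\<bar> < r \<Longrightarrow> DERIV (\<lambda>t. g2 t y) x :> g2' x y"
  obtains \<rho> where "0 < \<rho>" "\<rho> < r"
    "(\<integral>\<^sup>+p. (case p of (x, y) \<Rightarrow> ennreal (\<bar>g1 x y * g2' x y - g2 x y * g1' x y\<bar> / ((g1 x y)\<^sup>2 + (g2 x y)\<^sup>2)))
       * indicator ({-\<rho><..<\<rho>} \<times> {-\<rho><..<\<rho>}) p \<partial>(lborel \<Otimes>\<^sub>M lborel)) < \<infinity>"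
proof -
  define w where "w x y = g1 x y * g2' x y - g2 x y * g1' x y" for x y
  have w: "biana r w"
    unfolding w_def by (intro biana_diff biana_mult g)
  define f where "f p = (case p of (x, y) \<Rightarrow> ennreal (\<bar>w x y\<bar> / ((g1 x y)\<^sup>2 + (g2 x y)\<^sup>2)))" for p
  define B :: "real \<Rightarrow> (real \<times> real) set" where "B \<rho> = {-\<rho><..<\<rho>} \<times> {-\<rho><..<\<rho>}" for \<rho>
  note result = that[folded w_def, folded f_def, folded B_def]
  have zero: thesis if "\<rho> > 0" "\<And>x y. \<bar>x\<bar> < \<rho> \<Longrightarrow> \<bar>y\<bar> < \<rho> \<Longrightarrow> w x y = 0" for \<rho>
  proof (rule result[of "min \<rho> (r / 2)"])
    have "(\<integral>\<^sup>+p. f p * indicator (B (min \<rho> (r / 2))) p \<partial>(lborel \<Otimes>\<^sub>M lborel)) = (\<integral>\<^sup>+(p :: real \<times> real). 0 \<partial>(lborel \<Otimes>\<^sub>M lborel))"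
      by (intro nn_integral_cong) (use that(2) in \<open>auto simp: f_def B_def split: split_indicator\<close>)
    then show "(\<integral>\<^sup>+p. f p * indicator (B (min \<rho> (r / 2))) p \<partial>(lborel \<Otimes>\<^sub>M lborel)) < \<infinity>" by simp
  qed (use that r in auto)
  show thesis
  proof (rule biana_card_zeros[OF w r])
    show ?thesis if "\<rho> > 0" "\<And>x y. \<bar>x\<bar> < \<rho> \<Longrightarrow> \<bar>y\<bar> < \<rho> \<Longrightarrow> w x y = 0" for \<rho>
      by (rule zero[OF that])
  next
    fix \<rho>2 C2 assume 2: "\<rho>2 > 0" "C2 \<ge> 0"
      "\<And>y. 0 < \<bar>y\<bar> \<Longrightarrow> \<bar>y\<bar> < \<rho>2 \<Longrightarrow> finite {x. \<bar>x\<bar> < \<rho>2 \<and> w x y = 0}"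
      "\<And>y. 0 < \<bar>y\<bar> \<Longrightarrow> \<bar>y\<bar> < \<rho>2 \<Longrightarrow> real (card {x. \<bar>x\<bar> < \<rho>2 \<and> w x y = 0}) \<le> C2 / sqrt \<bar>y\<bar>"
    show thesis
    proof (rule biana_card_zeros[OF g(1) r])
      \<comment> \<open>If \<open>g1\<close> vanishes identically, so does its derivative in
        \<open>x\<close>, and with both of them \<open>w\<close>.\<close>
      fix \<rho> assume \<rho>: "\<rho> > 0" "\<And>x y. \<bar>x\<bar> < \<rho> \<Longrightarrow> \<bar>y\<bar> < \<rho> \<Longrightarrow> g1 x y = 0"
      show thesis
      proof (rule zero[of "min \<rho> r"])
        fix x y assume xy: "\<bar>x\<bar> < min \<rho> r" "\<bar>y\<bar> < min \<rho> r"
        have "DERIV (\<lambda>t. 0) x :> g1' x y"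
          by (rule has_field_derivative_transform_within_open[OF D(1), where S="{-\<rho><..<\<rho>}"])
             (use xy \<rho> in auto)
        then have "g1' x y = 0" using DERIV_unique DERIV_const by blast
        then show "w x y = 0" using \<rho>(2)[of x y] xy by (simp add: w_def)
      qed (use \<rho> r in auto)
    next
      fix \<rho>1 C1 assume 1: "\<rho>1 > 0" "C1 \<ge> 0"
        "\<And>y. 0 < \<bar>y\<bar> \<Longrightarrow> \<bar>y\<bar> < \<rho>1 \<Longrightarrow> finite {x. \<bar>x\<bar> < \<rho>1 \<and> g1 x y = 0}"
        "\<And>y. 0 < \<bar>y\<bar> \<Longrightarrow> \<bar>y\<bar> < \<rho>1 \<Longrightarrow> real (card {x. \<bar>x\<bar> < \<rho>1 \<and> g1 x y = 0}) \<le> C1 / sqrt \<bar>y\<bar>"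
      define \<rho> where "\<rho> = Min {\<rho>1, \<rho>2, r / 2}"
      have \<rho>: "0 < \<rho>" "\<rho> \<le> \<rho>1" "\<rho> \<le> \<rho>2" "\<rho> < r" using 1 2 r by (auto simp: \<rho>_def min_less_iff_disj)
      have line: "(\<integral>\<^sup>+x. f (x, y) * indicator {-\<rho><..<\<rho>} x \<partial>lborel) \<le> ennreal (pi * (C1 + C2) * (1 / sqrt \<bar>y\<bar>) + pi)"
        if y: "y \<noteq> 0" "\<bar>y\<bar> < \<rho>" for y
      proof -
        have sub: "{x. -\<rho> < x \<and> x < \<rho> \<and> g1 x y = 0} \<subseteq> {x. \<bar>x\<bar> < \<rho>1 \<and> g1 x y = 0}"
          "{x. -\<rho> < x \<and> x < \<rho> \<and> w x y = 0} \<subseteq> {x. \<bar>x\<bar> < \<rho>2 \<and> w x y = 0}"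
          using \<rho> by auto
        have fin: "finite {x. \<bar>x\<bar> < \<rho>1 \<and> g1 x y = 0}" "finite {x. \<bar>x\<bar> < \<rho>2 \<and> w x y = 0}"
          using 1(3)[of y] 2(3)[of y] y \<rho> by auto
        have "continuous_on {-\<rho><..<\<rho>} (\<lambda>x. (\<lambda>(x, y). w x y) (x, y))"
          by (rule continuous_on_compose2[OF biana_continuous_on[OF w \<rho>(4)]])
             (use y in \<open>auto intro!: continuous_intros\<close>)
        then have "(\<integral>\<^sup>+x. f (x, y) * indicator {-\<rho><..<\<rho>} x \<partial>lborel)
          \<le> ennreal (pi * (real (card {x. -\<rho> < x \<and> x < \<rho> \<and> g1 x y = 0})
                    + real (card {x. -\<rho> < x \<and> x < \<rho> \<and> w x y = 0}) + 1))"
          using nn_integral_angle_derivative[of "-\<rho>" \<rho> "\<lambda>t. g1 t y" "\<lambda>t. g1' t y" "\<lambda>t. g2 t y" "\<lambda>t. g2' t y"]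
            finite_subset[OF sub(1) fin(1)] finite_subset[OF sub(2) fin(2)] \<rho> D[of _ y] y
          by (simp add: f_def w_def abs_less_iff)
        also have "\<dots> \<le> ennreal (pi * (C1 + C2) * (1 / sqrt \<bar>y\<bar>) + pi)"
        proof (rule ennreal_leI)
          have "real (card {x. -\<rho> < x \<and> x < \<rho> \<and> g1 x y = 0}) + real (card {x. -\<rho> < x \<and> x < \<rho> \<and> w x y = 0})
              \<le> C1 / sqrt \<bar>y\<bar> + C2 / sqrt \<bar>y\<bar>"
            using 1(4)[of y] 2(4)[of y] card_mono[OF fin(1) sub(1)] card_mono[OF fin(2) sub(2)] y \<rho> by simp
          then have "pi * (real (card {x. -\<rho> < x \<and> x < \<rho> \<and> g1 x y = 0})
              + real (card {x. -\<rho> < x \<and> x < \<rho> \<and> w x y = 0}) + 1) \<le> pi * (C1 / sqrt \<bar>y\<bar> + C2 / sqrt \<bar>y\<bar> + 1)"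
            by (intro mult_left_mono) auto
          then show "pi * (real (card {x. -\<rho> < x \<and> x < \<rho> \<and> g1 x y = 0})
              + real (card {x. -\<rho> < x \<and> x < \<rho> \<and> w x y = 0}) + 1) \<le> pi * (C1 + C2) * (1 / sqrt \<bar>y\<bar>) + pi"
            by (simp add: algebra_simps add_divide_distrib)
        qed
        finally show ?thesis .
      qed
      have Bm: "B \<rho> \<in> sets borel" by (auto simp: B_def intro!: borel_open open_Times)
      have meas: "(\<lambda>p. indicator (B \<rho>) p * (\<lambda>(x, y). g x y) p) \<in> borel_measurable borel"
        if "biana r g" for g
        using borel_measurable_continuous_on_indicator[OF Bm biana_continuous_on[OF that \<rho>(4), folded B_def]]
        by simp
      have "(\<lambda>p. ennreal (\<bar>indicator (B \<rho>) p * (\<lambda>(x, y). w x y) p\<bar> /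
            ((indicator (B \<rho>) p * (\<lambda>(x, y). g1 x y) p)\<^sup>2 + (indicator (B \<rho>) p * (\<lambda>(x, y). g2 x y) p)\<^sup>2)))
          \<in> borel_measurable borel"
        by (intro measurable_compose[OF _ measurable_ennreal] borel_measurable_divide borel_measurable_abs
            borel_measurable_add borel_measurable_power meas w g)
      also have "?this \<longleftrightarrow> (\<lambda>p. f p * indicator (B \<rho>) p) \<in> borel_measurable borel"
        by (intro measurable_cong) (auto simp: f_def split: split_indicator)
      finally have [measurable]: "(\<lambda>p. f p * indicator (B \<rho>) p) \<in> borel_measurable (lborel \<Otimes>\<^sub>M lborel)"
        by (simp add: lborel_prod)
      have "(\<integral>\<^sup>+p. f p * indicator (B \<rho>) p \<partial>(lborel \<Otimes>\<^sub>M lborel))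
          = (\<integral>\<^sup>+y. (\<integral>\<^sup>+x. f (x, y) * indicator (B \<rho>) (x, y) \<partial>lborel) \<partial>lborel)"
        by (rule lborel_pair.nn_integral_snd[symmetric]) measurable
      also have "\<dots> \<le> (\<integral>\<^sup>+y. ennreal (pi * (C1 + C2)) * (ennreal (1 / sqrt \<bar>y\<bar>) * indicator {-\<rho><..<\<rho>} y)
            + ennreal pi * indicator {-\<rho><..<\<rho>} y \<partial>lborel)"
      proof (rule nn_integral_mono_AE, use AE_lborel_singleton[of 0] in eventually_elim)
        fix y :: real assume y: "y \<noteq> 0"
        show "(\<integral>\<^sup>+x. f (x, y) * indicator (B \<rho>) (x, y) \<partial>lborel)
          \<le> ennreal (pi * (C1 + C2)) * (ennreal (1 / sqrt \<bar>y\<bar>) * indicator {-\<rho><..<\<rho>} y)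
            + ennreal pi * indicator {-\<rho><..<\<rho>} y"
        proof (cases "\<bar>y\<bar> < \<rho>")
          case True
          have "(\<lambda>x. f (x, y) * indicator (B \<rho>) (x, y)) = (\<lambda>x. f (x, y) * indicator {-\<rho><..<\<rho>} x)"
            using True by (auto simp: B_def fun_eq_iff split: split_indicator)
          moreover have "ennreal (pi * (C1 + C2) * (1 / sqrt \<bar>y\<bar>) + pi)
              = ennreal (pi * (C1 + C2)) * ennreal (1 / sqrt \<bar>y\<bar>) + ennreal pi"
          proof -
            have "0 \<le> pi * (C1 + C2)" "0 \<le> 1 / sqrt \<bar>y\<bar>" using 1(2) 2(2) by auto
            then show ?thesis by (simp only: ennreal_plus ennreal_mult mult_nonneg_nonneg pi_ge_zero)
          qed
          ultimately show ?thesis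
            using line[OF y True] True by (simp add: abs_less_iff)
        next
          case False
          then have "(\<lambda>x. f (x, y) * indicator (B \<rho>) (x, y)) = (\<lambda>x. 0)"
            by (auto simp: B_def fun_eq_iff split: split_indicator)
          then show ?thesis by simp
        qed
      qed
      also have "\<dots> = ennreal (pi * (C1 + C2)) * (\<integral>\<^sup>+y. ennreal (1 / sqrt \<bar>y\<bar>) * indicator {-\<rho><..<\<rho>} y \<partial>lborel)
          + ennreal pi * ennreal (2 * \<rho>)"
        using \<rho>(1) by (subst nn_integral_add) (auto simp: nn_integral_cmult nn_integral_cmult_indicator)
      also have "\<dots> < \<infinity>"
        using nn_integral_inverse_sqrt_finite[OF \<rho>(1)] by (simp add: ennreal_mult_less_top)
      finally show thesis using result[of \<rho>] \<rho> by simp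
    qed
  qed
qed

section \<open>Lebesgue measure on the plane as a product\<close>

lemma vector_2_eq_axis: "(vector [x, y] :: real ^ 2) = x *\<^sub>R axis 1 1 + y *\<^sub>R axis 2 1"
  by (simp add: vec_eq_iff forall_2 axis_def)

lemma lborel_real2:
  "(lborel :: (real ^ 2) measure) = distr (lborel \<Otimes>\<^sub>M lborel) borel (\<lambda>(x, y). vector [x, y])"
proof (rule lborel_eqI)
  let ?T = "\<lambda>(x, y). vector [x, y] :: real ^ 2"
  have T: "continuous_on UNIV ?T"
    unfolding vector_2_eq_axis split_def by (intro continuous_intros)
  then have [measurable]: "?T \<in> borel_measurable (lborel \<Otimes>\<^sub>M lborel)"
    by (simp add: lborel_prod borel_measurable_continuous_onI)
  fix l u :: "real ^ 2" assume lu: "\<And>b. b \<in> Basis \<Longrightarrow> l \<bullet> b \<le> u \<bullet> b"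
  have lu': "l $ i \<le> u $ i" for i using lu[of "axis i 1"] by (simp add: inner_axis axis_in_Basis_iff)
  have "?T -` box l u \<inter> space (lborel \<Otimes>\<^sub>M lborel) = {l $ 1<..<u $ 1} \<times> {l $ 2<..<u $ 2}"
    by (auto simp: mem_box_cart forall_2 space_pair_measure)
  then have "emeasure (distr (lborel \<Otimes>\<^sub>M lborel) borel ?T) (box l u)
      = emeasure (lborel \<Otimes>\<^sub>M lborel) ({l $ 1<..<u $ 1} \<times> {l $ 2<..<u $ 2})"
    by (subst emeasure_distr) auto
  also have "\<dots> = emeasure lborel {l $ 1<..<u $ 1} * emeasure lborel {l $ 2<..<u $ 2}"
    by (rule lborel.emeasure_pair_measure_Times) auto
  also have "\<dots> = ennreal ((u $ 1 - l $ 1) * (u $ 2 - l $ 2))"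
    using lu' by (simp add: ennreal_mult)
  also have "(u $ 1 - l $ 1) * (u $ 2 - l $ 2) = (\<Prod>b\<in>Basis. (u - l) \<bullet> b)"
  proof -
    have B: "(Basis :: (real ^ 2) set) = {axis 1 1, axis 2 1}" by (auto simp: Basis_vec_def UNIV_2)
    have "axis 1 1 \<noteq> (axis 2 1 :: real ^ 2)" by (simp add: axis_eq_axis)
    then show ?thesis unfolding B by (simp add: inner_axis)
  qed
  finally show "emeasure (distr (lborel \<Otimes>\<^sub>M lborel) borel ?T) (box l u) = (\<Prod>b\<in>Basis. (u - l) \<bullet> b)" .
qed simp

section \<open>Graph charts of a surface\<close>

lemma horizontal_space_eq: "horizontal_space p = {a *\<^sub>R X_field p + b *\<^sub>R Y_field p | a b. True}"
proof (intro set_eqI iffI)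
  fix v assume "v \<in> horizontal_space p"
  then have "v = v $ 1 *\<^sub>R X_field p + v $ 2 *\<^sub>R Y_field p"
    by (simp add: horizontal_space_def X_field_def Y_field_def vec_eq_iff forall_3 field_simps)
  then show "v \<in> {a *\<^sub>R X_field p + b *\<^sub>R Y_field p | a b. True}" by blast
qed (auto simp: horizontal_space_def X_field_def Y_field_def field_simps)

text \<open>\<open>X_field\<close> and \<open>Y_field\<close> are divergence free for Lebesgue
  measure, so only the derivatives of the coefficients along the fields survive.\<close>

lemma divergence_horizontal:
  assumes "(f has_derivative f') (at q)" "(h has_derivative h') (at q)"
  shows "divergence (\<lambda>q. f q *\<^sub>R X_field q + h q *\<^sub>R Y_field q) q = f' (X_field q) + h' (Y_field q)"
proof -
  let ?V = "\<lambda>q. f q *\<^sub>R X_field q + h q *\<^sub>R Y_field q"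
  have V: "?V = (\<lambda>q. f q *\<^sub>R axis 1 1 + h q *\<^sub>R axis 2 1 + (1 / 2 * (h q * q $ 1 - f q * q $ 2)) *\<^sub>R axis 3 1)"
    by (auto simp: fun_eq_iff vec_eq_iff forall_3 X_field_def Y_field_def axis_def field_simps)
  have t: "((\<lambda>q. 1 / 2 * (h q * q $ 1 - f q * q $ 2)) has_derivative
      (\<lambda>v. 1 / 2 * (h' v * q $ 1 + h q * v $ 1 - (f' v * q $ 2 + f q * v $ 2)))) (at q)"
    by (auto intro!: derivative_eq_intros assms bounded_linear.has_derivative[OF bounded_linear_vec_nth]
        simp: field_simps fun_eq_iff)
  have "(?V has_derivative (\<lambda>v. f' v *\<^sub>R axis 1 1 + h' v *\<^sub>R axis 2 1 +
      (1 / 2 * (h' v * q $ 1 + h q * v $ 1 - (f' v * q $ 2 + f q * v $ 2))) *\<^sub>R axis 3 1)) (at q)"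
    unfolding V
    by (rule has_derivative_eq_rhs, (rule has_derivative_add has_derivative_scaleR has_derivative_const assms t)+)
       simp
  then have D: "frechet_derivative ?V (at q) = (\<lambda>v. f' v *\<^sub>R axis 1 1 + h' v *\<^sub>R axis 2 1 +
      (1 / 2 * (h' v * q $ 1 + h q * v $ 1 - (f' v * q $ 2 + f q * v $ 2))) *\<^sub>R axis 3 1)"
    by (rule frechet_derivative_at[symmetric])
  have lin: "linear f'" "linear h'" using assms has_derivative_linear by auto
  have "X_field q = axis 1 1 + (- (q $ 2) / 2) *\<^sub>R axis 3 1" "Y_field q = axis 2 1 + (q $ 1 / 2) *\<^sub>R axis 3 1"
    by (auto simp: vec_eq_iff forall_3 X_field_def Y_field_def axis_def)
  then have XY: "f' (X_field q) = f' (axis 1 1) + (- (q $ 2) / 2) * f' (axis 3 1)"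
    "h' (Y_field q) = h' (axis 2 1) + (q $ 1 / 2) * h' (axis 3 1)"
    using lin by (simp_all only: linear_add linear_cmul real_scaleR_def)
  have ax: "axis a (1 :: real) $ b = (if b = a then 1 else 0)" for a b :: 3
    by (simp add: axis_def)
  show ?thesis
    unfolding divergence_def D XY by (simp add: sum_3 ax algebra_simps)
qed

lemma C_on_2_derivative_differentiable:
  assumes "C_on 2 u U" "q \<in> U"
  shows "u differentiable (at q)" "(\<lambda>q. frechet_derivative u (at q) v) differentiable (at q)"
  using assms by (auto simp: numeral_2_eq_2)

lemma differentiable_transform_open:
  assumes "f differentiable (at q)" "open U" "q \<in> U" "\<And>x. x \<in> U \<Longrightarrow> h x = f x"
  shows "h differentiable (at q)"
proof -
  obtain D where "(f has_derivative D) (at q)" using assms(1) by (auto simp: differentiable_def)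
  then have "(h has_derivative D) (at q)"
    by (rule has_derivative_transform_within_open[OF _ assms(2,3)]) (simp add: assms(4))
  then show ?thesis by (auto simp: differentiable_def)
qed

lemma isCont_eventually_nhds:
  assumes "isCont f a" "open U" "f a \<in> U" shows "\<forall>\<^sub>F x in nhds a. f x \<in> U"
  by (rule topological_tendstoD) (use assms in \<open>auto simp: isCont_def tendsto_at_iff_tendsto_nhds\<close>)

lemma dir_deriv_differentiable:
  assumes U: "open U" "q \<in> U" and u: "C_on 2 u U"
  shows "(dir_deriv X_field u) differentiable (at q)" "(dir_deriv Y_field u) differentiable (at q)"
proof -
  define d where "d t = (\<lambda>q. frechet_derivative u (at q) (axis t 1))" for t :: 3
  have d: "d t differentiable (at q)" for t
    unfolding d_def using C_on_2_derivative_differentiable(2)[OF u U(2)] by blast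
  have coord: "(\<lambda>q :: real ^ 3. q $ t) differentiable (at q)" for t
    by (rule bounded_linear_imp_differentiable) (rule bounded_linear_vec_nth)
  have lin: "linear (frechet_derivative u (at q))" if "q \<in> U" for q
    using C_on_2_derivative_differentiable(1)[OF u that] by (rule linear_frechet_derivative)
  have XY: "X_field q = axis 1 1 + (- (q $ 2) / 2) *\<^sub>R axis 3 1" "Y_field q = axis 2 1 + (q $ 1 / 2) *\<^sub>R axis 3 1" for q
    by (auto simp: vec_eq_iff forall_3 X_field_def Y_field_def axis_def)
  have "(\<lambda>q. d 1 q + (- (q $ 2) / 2) * d 3 q) differentiable (at q)"
    by (intro derivative_intros d coord) auto
  then show "(dir_deriv X_field u) differentiable (at q)"
    by (rule differentiable_transform_open[OF _ U])
       (simp add: dir_deriv_def XY d_def linear_add[OF lin] linear_cmul[OF lin] del: scaleR_minus_left)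
  have "(\<lambda>q. d 2 q + (q $ 1 / 2) * d 3 q) differentiable (at q)"
    by (intro derivative_intros d coord) auto
  then show "(dir_deriv Y_field u) differentiable (at q)"
    by (rule differentiable_transform_open[OF _ U])
       (simp add: dir_deriv_def XY d_def linear_add[OF lin] linear_cmul[OF lin])
qed

text \<open>Since \<open>(\<nu>1, \<nu>2)\<close> has unit length, its derivative in direction \<open>\<nu>1 X + \<nu>2 Y\<close> is orthogonal
  to it, so the divergence only involves the derivative in the orthogonal direction.\<close>

lemma divergence_unit_horizontal:
  fixes \<nu>1 \<nu>2 :: "real ^ 3 \<Rightarrow> real"
  assumes D: "(\<nu>1 has_derivative d1) (at q)" "(\<nu>2 has_derivative d2) (at q)"
    and unit: "\<forall>\<^sub>F q in nhds q. (\<nu>1 q)\<^sup>2 + (\<nu>2 q)\<^sup>2 = 1"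
  defines "T \<equiv> - \<nu>2 q *\<^sub>R X_field q + \<nu>1 q *\<^sub>R Y_field q"
  shows "divergence (\<lambda>q. \<nu>1 q *\<^sub>R X_field q + \<nu>2 q *\<^sub>R Y_field q) q = \<nu>1 q * d2 T - \<nu>2 q * d1 T"
proof -
  have lin: "linear d1" "linear d2" using D has_derivative_linear by auto
  obtain O1 where O1: "open O1" "q \<in> O1" "\<And>q. q \<in> O1 \<Longrightarrow> (\<nu>1 q)\<^sup>2 + (\<nu>2 q)\<^sup>2 = 1"
    using unit unfolding eventually_nhds by blast
  have "((\<lambda>q. (\<nu>1 q)\<^sup>2 + (\<nu>2 q)\<^sup>2) has_derivative (\<lambda>v. 2 * \<nu>1 q * d1 v + 2 * \<nu>2 q * d2 v)) (at q)"
    by (auto intro!: derivative_eq_intros D simp: algebra_simps)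
  then have "((\<lambda>q. 1) has_derivative (\<lambda>v. 2 * \<nu>1 q * d1 v + 2 * \<nu>2 q * d2 v)) (at q)"
    by (rule has_derivative_transform_within_open[OF _ O1(1,2)]) (use O1(3) in auto)
  then have "(\<lambda>v. 2 * \<nu>1 q * d1 v + 2 * \<nu>2 q * d2 v) = (\<lambda>v. 0)"
    using has_derivative_unique has_derivative_const by blast
  then have orth: "\<nu>1 q * d1 v + \<nu>2 q * d2 v = 0" for v
    by (metis (no_types, lifting) distrib_left mult.assoc mult_eq_0_iff zero_neq_numeral)
  have one: "(\<nu>1 q)\<^sup>2 + (\<nu>2 q)\<^sup>2 = 1" using O1 by blast
  let ?a = "d1 (X_field q)" and ?b = "d1 (Y_field q)" and ?c = "d2 (X_field q)" and ?d = "d2 (Y_field q)"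
  have "\<nu>1 q * d2 T - \<nu>2 q * d1 T
      = \<nu>1 q * (\<nu>1 q * ?d - \<nu>2 q * ?c) - \<nu>2 q * (\<nu>1 q * ?b - \<nu>2 q * ?a)"
    using lin by (simp add: T_def linear_add linear_diff linear_cmul linear_neg algebra_simps)
  \<comment> \<open>The two subtracted groups are the orthogonality relation in the directions
    \<open>X_field q\<close> and \<open>Y_field q\<close>; only the term with the unit length is
    left.\<close>
  also have "\<dots> = ((\<nu>1 q)\<^sup>2 + (\<nu>2 q)\<^sup>2) * (?a + ?d)
      - \<nu>1 q * (\<nu>1 q * ?a + \<nu>2 q * ?c) - \<nu>2 q * (\<nu>1 q * ?b + \<nu>2 q * ?d)"
    by (simp add: algebra_simps power2_eq_square)
  also have "\<dots> = ?a + ?d" using orth[of "X_field q"] orth[of "Y_field q"] one by simp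
  finally show ?thesis using divergence_horizontal[OF D] by simp
qed

text \<open>In the box about \<open>p\<close> whose half-height along the axis \<open>i\<close> is
  \<open>\<delta>\<close>, \<open>S\<close> is exactly the graph: the equivalence in
  \<open>graph\<close> excludes further sheets. Hence chart images are open in \<open>S\<close>, and
  curves in \<open>S\<close> satisfy the graph equation while they stay in the box.\<close>

locale graph_chart =
  fixes S :: "(real ^ 3) set" and p :: "real ^ 3" and i j k :: 3 and r \<delta> :: real
    and g gx gy :: "real \<Rightarrow> real \<Rightarrow> real"
  assumes ijk: "UNIV = {i, j, k}" "i \<noteq> j" "i \<noteq> k" "j \<noteq> k"
    and r: "r > 0"
    and g: "biana r g" "biana r gx" "biana r gy"
    and g_deriv: "\<And>x y. \<bar>x\<bar> < r \<Longrightarrow> \<bar>y\<bar> < r \<Longrightarrow>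
      ((\<lambda>(x,y). g x y) has_derivative (\<lambda>(s,t). gx x y * s + gy x y * t)) (at (x, y))"
    and g_bound: "\<And>x y. \<bar>x\<bar> < r \<Longrightarrow> \<bar>y\<bar> < r \<Longrightarrow> \<bar>g x y\<bar> < \<delta>"
    and graph: "\<And>q. \<bar>q $ j - p $ j\<bar> < r \<Longrightarrow> \<bar>q $ k - p $ k\<bar> < r \<Longrightarrow> \<bar>q $ i - p $ i\<bar> < \<delta> \<Longrightarrow>
      q \<in> S \<longleftrightarrow> q $ i - p $ i = g (q $ j - p $ j) (q $ k - p $ k)"
begin

definition Box :: "real \<Rightarrow> (real ^ 2) set" where
  "Box \<rho> = {x. \<bar>x $ 1\<bar> < \<rho> \<and> \<bar>x $ 2\<bar> < \<rho>}"

definition \<phi> :: "real ^ 2 \<Rightarrow> real ^ 3" where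
  "\<phi> x = p + x $ 1 *\<^sub>R axis j 1 + x $ 2 *\<^sub>R axis k 1 + g (x $ 1) (x $ 2) *\<^sub>R axis i 1"

definition \<phi>' :: "real ^ 2 \<Rightarrow> real ^ 2 \<Rightarrow> real ^ 3" where
  "\<phi>' x v = v $ 1 *\<^sub>R axis j 1 + v $ 2 *\<^sub>R axis k 1 +
     (gx (x $ 1) (x $ 2) * v $ 1 + gy (x $ 1) (x $ 2) * v $ 2) *\<^sub>R axis i 1"

definition \<psi> :: "real ^ 3 \<Rightarrow> real ^ 2" where
  "\<psi> q = vector [q $ j - p $ j, q $ k - p $ k]"

text \<open>The differential of the local defining function \<open>q $ i - p $ i - g (q $ j - p $ j) (q $ k - p $ k)\<close>.\<close>

definition L :: "real ^ 2 \<Rightarrow> real ^ 3 \<Rightarrow> real" where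
  "L x v = v $ i - gx (x $ 1) (x $ 2) * v $ j - gy (x $ 1) (x $ 2) * v $ k"

definition G1 :: "real ^ 2 \<Rightarrow> real" where "G1 x = L x (X_field (\<phi> x))"
definition G2 :: "real ^ 2 \<Rightarrow> real" where "G2 x = L x (Y_field (\<phi> x))"

lemma all_ijk: "(\<forall>t. Q t) \<longleftrightarrow> Q i \<and> Q j \<and> Q k" for Q :: "3 \<Rightarrow> bool"
proof
  assume Q: "Q i \<and> Q j \<and> Q k"
  show "\<forall>t. Q t"
  proof
    fix t :: 3
    have "t \<in> {i, j, k}" using ijk(1) by blast
    then show "Q t" using Q by auto
  qed
qed simp

lemma axis_ijk [simp]:
  "axis i 1 $ i = (1::real)" "axis i 1 $ j = (0::real)" "axis i 1 $ k = (0::real)"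
  "axis j 1 $ i = (0::real)" "axis j 1 $ j = (1::real)" "axis j 1 $ k = (0::real)"
  "axis k 1 $ i = (0::real)" "axis k 1 $ j = (0::real)" "axis k 1 $ k = (1::real)"
  using ijk(2-4) by (auto simp: axis_def)

lemma phi_nth [simp]: "\<phi> x $ j = p $ j + x $ 1" "\<phi> x $ k = p $ k + x $ 2"
  "\<phi> x $ i = p $ i + g (x $ 1) (x $ 2)"
  by (auto simp: \<phi>_def)

lemma psi_phi [simp]: "\<psi> (\<phi> x) = x"
  by (simp add: \<psi>_def vec_eq_iff forall_2)

lemma Box_mono: "\<rho> \<le> \<rho>' \<Longrightarrow> Box \<rho> \<subseteq> Box \<rho>'" by (auto simp: Box_def)

lemma open_Box: "open (Box \<rho>)"
  unfolding Box_def by (intro open_Collect_conj open_Collect_less continuous_intros)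

lemma phi_in_S: "x \<in> Box r \<Longrightarrow> \<phi> x \<in> S"
  using graph[of "\<phi> x"] g_bound[of "x $ 1" "x $ 2"] by (simp add: Box_def)

text \<open>A tangent part plus a multiple of the axis over which the graph rises: the kernel of
  \<open>L x\<close> is the image of \<open>\<phi>' x\<close>.\<close>

lemma L_decomp: "v = \<phi>' x (vector [v $ j, v $ k]) + L x v *\<^sub>R axis i 1"
  by (simp add: vec_eq_iff all_ijk \<phi>'_def L_def algebra_simps)

lemma L_phi' [simp]: "L x (\<phi>' x v) = 0"
  by (simp add: L_def \<phi>'_def)

lemma L_linear: "L x (a *\<^sub>R v + b *\<^sub>R w) = a * L x v + b * L x w"
  by (simp add: L_def algebra_simps)

lemma g_deriv': "\<bar>x $ 1\<bar> < r \<Longrightarrow> \<bar>x $ 2\<bar> < r \<Longrightarrow>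
  ((\<lambda>x :: real ^ 2. g (x $ 1) (x $ 2)) has_derivative
     (\<lambda>v. gx (x $ 1) (x $ 2) * v $ 1 + gy (x $ 1) (x $ 2) * v $ 2)) (at x)"
  by (rule has_derivative_compose[where f="\<lambda>x :: real ^ 2. (x $ 1, x $ 2)" and f'="\<lambda>x :: real ^ 2. (x $ 1, x $ 2)"
        and g="\<lambda>(x, y). g x y", OF _ g_deriv, simplified])
     (auto intro!: has_derivative_Pair bounded_linear.has_derivative[OF bounded_linear_vec_nth])

lemma phi_has_derivative:
  assumes "x \<in> Box r" shows "(\<phi> has_derivative \<phi>' x) (at x)"
proof -
  have x: "\<bar>x $ 1\<bar> < r" "\<bar>x $ 2\<bar> < r" using assms by (auto simp: Box_def)
  have c: "((\<lambda>x :: real ^ 2. x $ t) has_derivative (\<lambda>v. v $ t)) (at x)" for t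
    by (auto intro!: bounded_linear.has_derivative[OF bounded_linear_vec_nth])
  show ?thesis
    unfolding \<phi>_def[abs_def] \<phi>'_def[abs_def]
    by (auto intro!: derivative_eq_intros c g_deriv'[OF x])
qed

lemma frechet_phi: "x \<in> Box r \<Longrightarrow> frechet_derivative \<phi> (at x) = \<phi>' x"
  by (rule frechet_derivative_at[OF phi_has_derivative, symmetric])

text \<open>A vector in the kernel of \<open>L x\<close> is the velocity of the lift of a straight
  line in the parameter plane. Conversely, continuity at \<open>0\<close> keeps a curve in the box
  for small times, where the graph equation holds and can be differentiated at
  \<open>0\<close>.\<close>

lemma tangent_space_phi:
  assumes x: "x \<in> Box r" shows "v \<in> tangent_space S (\<phi> x) \<longleftrightarrow> L x v = 0"
proof
  assume "L x v = 0"
  then have v: "\<phi>' x (vector [v $ j, v $ k]) = v" using L_decomp[of v x, symmetric] by simp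
  define t :: "real ^ 2" where "t = vector [v $ j, v $ k]"
  have lin: "linear (\<phi>' x)" using phi_has_derivative[OF x] has_derivative_linear by blast
  have l: "((\<lambda>s. x + s *\<^sub>R t) has_derivative (\<lambda>s. s *\<^sub>R t)) (at 0)"
    by (auto intro!: derivative_eq_intros)
  have "((\<lambda>s. \<phi> (x + s *\<^sub>R t)) has_derivative (\<lambda>s. \<phi>' x (s *\<^sub>R t))) (at 0)"
    by (rule has_derivative_compose[OF l]) (use phi_has_derivative[OF x] in simp)
  then have "((\<lambda>s. \<phi> (x + s *\<^sub>R t)) has_vector_derivative v) (at 0)"
    unfolding has_vector_derivative_def using v lin by (simp add: linear_cmul t_def)
  moreover have "\<forall>\<^sub>F s in nhds 0. x + s *\<^sub>R t \<in> Box r"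
  proof -
    have "isCont (\<lambda>s. x + s *\<^sub>R t) 0" by (intro continuous_intros)
    then show ?thesis using x open_Box[of r] by (intro isCont_eventually_nhds) auto
  qed
  then obtain e where "e > 0" "\<And>s. \<bar>s\<bar> < e \<Longrightarrow> x + s *\<^sub>R t \<in> Box r"
    unfolding eventually_nhds_metric by (auto simp: dist_real_def)
  ultimately show "v \<in> tangent_space S (\<phi> x)"
    unfolding tangent_space_def using phi_in_S
    by (intro CollectI exI[of _ "\<lambda>s. \<phi> (x + s *\<^sub>R t)"] exI[of _ e]) auto
next
  assume "v \<in> tangent_space S (\<phi> x)"
  then obtain \<gamma> e where \<gamma>: "e > 0" "\<And>t. \<bar>t\<bar> < e \<Longrightarrow> \<gamma> t \<in> S" "\<gamma> 0 = \<phi> x"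
    "(\<gamma> has_vector_derivative v) (at 0)"
    unfolding tangent_space_def by blast
  have x': "\<bar>x $ 1\<bar> < r" "\<bar>x $ 2\<bar> < r" using x by (auto simp: Box_def)
  have D: "(\<gamma> has_derivative (\<lambda>s. s *\<^sub>R v)) (at 0)"
    using \<gamma>(4) by (simp add: has_vector_derivative_def)
  have c: "((\<lambda>s. \<gamma> s $ t - p $ t) has_derivative (\<lambda>s. s * v $ t)) (at 0)" for t
    using bounded_linear.has_derivative[OF bounded_linear_vec_nth D, of t]
    by (auto intro!: derivative_eq_intros)
  have cont: "isCont (\<lambda>s. \<gamma> s $ t - p $ t) 0" for t
    using c has_derivative_continuous by blast
  have nb: "\<forall>\<^sub>F s in nhds 0. \<bar>\<gamma> s $ t - p $ t\<bar> < b" if "\<bar>\<gamma> 0 $ t - p $ t\<bar> < b" for t b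
    by (rule eventually_mono[OF isCont_eventually_nhds[OF cont[of t], of "{-b<..<b}"]]) (use that in auto)
  have "\<forall>\<^sub>F s in nhds (0::real). \<bar>s\<bar> < e"
    using \<gamma>(1) by (auto simp: eventually_nhds_metric dist_real_def)
  moreover have "\<forall>\<^sub>F s in nhds 0. \<bar>\<gamma> s $ j - p $ j\<bar> < r" "\<forall>\<^sub>F s in nhds 0. \<bar>\<gamma> s $ k - p $ k\<bar> < r"
    "\<forall>\<^sub>F s in nhds 0. \<bar>\<gamma> s $ i - p $ i\<bar> < \<delta>"
    using nb x' g_bound[OF x'] by (auto simp: \<gamma>(3))
  ultimately have "\<forall>\<^sub>F s in nhds 0. \<gamma> s $ i - p $ i - g (\<gamma> s $ j - p $ j) (\<gamma> s $ k - p $ k) = 0"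
  proof eventually_elim
    case (elim s) then show ?case using graph[of "\<gamma> s"] \<gamma>(2) by simp
  qed
  then obtain O1 where O1: "open O1" "0 \<in> O1"
    "\<And>s. s \<in> O1 \<Longrightarrow> \<gamma> s $ i - p $ i - g (\<gamma> s $ j - p $ j) (\<gamma> s $ k - p $ k) = 0"
    unfolding eventually_nhds by blast
  have "((\<lambda>s. (\<lambda>(x, y). g x y) (\<gamma> s $ j - p $ j, \<gamma> s $ k - p $ k)) has_derivative
      (\<lambda>s. (\<lambda>(s,t). gx (x $ 1) (x $ 2) * s + gy (x $ 1) (x $ 2) * t) (s * v $ j, s * v $ k))) (at 0)"
    by (rule has_derivative_compose[OF has_derivative_Pair[OF c c]]) (use g_deriv[OF x'] in \<open>simp add: \<gamma>(3)\<close>)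
  then have "((\<lambda>s. \<gamma> s $ i - p $ i - g (\<gamma> s $ j - p $ j) (\<gamma> s $ k - p $ k)) has_derivative
      (\<lambda>s. s * v $ i - (gx (x $ 1) (x $ 2) * (s * v $ j) + gy (x $ 1) (x $ 2) * (s * v $ k)))) (at 0)"
    by (intro has_derivative_diff c) simp
  then have "((\<lambda>s. 0) has_derivative
      (\<lambda>s. s * v $ i - (gx (x $ 1) (x $ 2) * (s * v $ j) + gy (x $ 1) (x $ 2) * (s * v $ k)))) (at (0::real))"
    by (rule has_derivative_transform_within_open[OF _ O1(1,2)]) (use O1(3) in auto)
  then have "(\<lambda>s. s * v $ i - (gx (x $ 1) (x $ 2) * (s * v $ j) + gy (x $ 1) (x $ 2) * (s * v $ k))) = (\<lambda>s. 0)"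
    using has_derivative_unique has_derivative_const by blast
  from fun_cong[OF this, of 1] show "L x v = 0" by (simp add: L_def algebra_simps)
qed

lemma characteristic_phi:
  assumes x: "x \<in> Box r" shows "\<phi> x \<in> characteristic_set S \<longleftrightarrow> G1 x = 0 \<and> G2 x = 0"
proof
  assume "\<phi> x \<in> characteristic_set S"
  then have "horizontal_space (\<phi> x) \<subseteq> tangent_space S (\<phi> x)" by (simp add: characteristic_set_def)
  moreover have "1 *\<^sub>R X_field (\<phi> x) + 0 *\<^sub>R Y_field (\<phi> x) \<in> horizontal_space (\<phi> x)"
    "0 *\<^sub>R X_field (\<phi> x) + 1 *\<^sub>R Y_field (\<phi> x) \<in> horizontal_space (\<phi> x)"
    unfolding horizontal_space_eq by blast+
  ultimately show "G1 x = 0 \<and> G2 x = 0"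
    unfolding G1_def G2_def using tangent_space_phi[OF x] by auto
next
  assume "G1 x = 0 \<and> G2 x = 0"
  then have "L x v = 0" if "v \<in> horizontal_space (\<phi> x)" for v
    using that unfolding horizontal_space_eq G1_def G2_def by (auto simp: L_linear)
  then show "\<phi> x \<in> characteristic_set S"
    unfolding characteristic_set_def using phi_in_S[OF x] tangent_space_phi[OF x] by blast
qed

text \<open>\<open>u\<close> is zero along the chart, so its differential kills tangent vectors and
  sees only the component \<open>L x v\<close> along the axis \<open>i\<close>. This applies to
  whichever defining function realizes \<open>H\<close> at a point.\<close>

lemma defining_function_derivative:
  assumes x: "x \<in> Box r" and U: "open U" "\<phi> x \<in> U" and u: "u differentiable (at (\<phi> x))"
    and S: "S \<inter> U = {q \<in> U. u q = 0}"
  shows "frechet_derivative u (at (\<phi> x)) v = L x v * frechet_derivative u (at (\<phi> x)) (axis i 1)"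
proof -
  let ?D = "frechet_derivative u (at (\<phi> x))"
  have D: "(u has_derivative ?D) (at (\<phi> x))" using u by (simp add: frechet_derivative_works)
  have lin: "linear ?D" using u by (rule linear_frechet_derivative)
  have "isCont \<phi> x" using phi_has_derivative[OF x] has_derivative_continuous by blast
  then have "\<forall>\<^sub>F y in nhds x. \<phi> y \<in> U"
    using U by (rule isCont_eventually_nhds)
  then obtain O1 where O1: "open O1" "x \<in> O1" "\<And>y. y \<in> O1 \<Longrightarrow> \<phi> y \<in> U"
    unfolding eventually_nhds by blast
  have "((\<lambda>y. u (\<phi> y)) has_derivative (\<lambda>v. ?D (\<phi>' x v))) (at x)"
    by (rule has_derivative_compose[OF phi_has_derivative[OF x] D])
  then have "((\<lambda>y. 0) has_derivative (\<lambda>v. ?D (\<phi>' x v))) (at x)"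
    by (rule has_derivative_transform_within_open[of _ _ _ _ "O1 \<inter> Box r"])
       (use O1 x open_Box phi_in_S S in auto)
  then have "(\<lambda>v. ?D (\<phi>' x v)) = (\<lambda>v. 0)"
    using has_derivative_unique has_derivative_const by blast
  then have "?D (\<phi>' x w) = 0" for w by (rule fun_cong)
  then show ?thesis
    by (subst L_decomp[of v x]) (simp add: linear_add[OF lin] linear_cmul[OF lin])
qed

end

text \<open>By compactness the quadratic form has a positive minimum over \<open>K\<close> and the
  Euclidean unit sphere; scaling turns it into a bound on the unit vectors of
  \<open>G\<close>.\<close>

lemma riemannian_metric_bound:
  assumes G: "riemannian_metric G" and K: "compact K"
  obtains C where "C > 0" "\<And>q v. q \<in> K \<Longrightarrow> G q v v = 1 \<Longrightarrow> norm v \<le> C"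
proof -
  have bil: "bilinear (G q)" and pos: "v \<noteq> 0 \<Longrightarrow> G q v v > 0" for q v
    using G unfolding riemannian_metric_def by blast+
  have cont: "continuous_on UNIV (\<lambda>q. G q v w)" for v w
  proof -
    have "smooth_on (\<lambda>q. G q v w) UNIV" using G unfolding riemannian_metric_def by blast
    then have "C_on 0 (\<lambda>q. G q v w) UNIV" unfolding smooth_on_def by blast
    then show ?thesis by simp
  qed
  \<comment> \<open>Continuity is known for \<open>G q v w\<close> with fixed \<open>v\<close> and
    \<open>w\<close>; expanding in a basis makes it joint in \<open>q\<close> and
    \<open>v\<close>.\<close>
  have expand: "G q v v = (\<Sum>b\<in>Basis. \<Sum>d\<in>Basis. (v \<bullet> b) * (v \<bullet> d) * G q b d)" for q v
  proof -
    have l: "linear (\<lambda>v. G q v w)" "linear (G q v)" for v w using bil[of q] by (auto simp: bilinear_def)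
    have "G q v v = G q (\<Sum>b\<in>Basis. (v \<bullet> b) *\<^sub>R b) (\<Sum>d\<in>Basis. (v \<bullet> d) *\<^sub>R d)"
      by (simp only: euclidean_representation)
    also have "\<dots> = (\<Sum>b\<in>Basis. \<Sum>d\<in>Basis. (v \<bullet> b) * (v \<bullet> d) * G q b d)"
      using l by (subst linear_sum[OF l(1)], subst linear_sum[OF l(2)])
        (simp add: linear_cmul[OF l(1)] linear_cmul[OF l(2)] sum_distrib_left mult.assoc mult.left_commute)
    finally show ?thesis .
  qed
  have c: "continuous_on (K \<times> sphere 0 1) (\<lambda>p. G (fst p) (snd p) (snd p))"
    unfolding expand
    by (intro continuous_intros continuous_on_compose2[OF cont]) auto
  show thesis
  proof (cases "K = {}")
    case True then show ?thesis using that[of 1] by simp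
  next
    case False
    have "K \<times> sphere (0 :: real ^ 3) 1 \<noteq> {}"
      using False by (auto intro!: exI[of _ "axis 1 1"])
    then obtain m where m: "m \<in> K \<times> sphere (0 :: real ^ 3) 1"
      "\<And>p. p \<in> K \<times> sphere 0 1 \<Longrightarrow> G (fst m) (snd m) (snd m) \<le> G (fst p) (snd p) (snd p)"
      using continuous_attains_inf[OF compact_Times[OF K compact_sphere] _ c] by blast
    define \<mu> where "\<mu> = G (fst m) (snd m) (snd m)"
    have "snd m \<noteq> 0" using m(1) by auto
    then have \<mu>: "\<mu> > 0" unfolding \<mu>_def by (rule pos)
    show ?thesis
    proof (rule that[of "1 / sqrt \<mu>"])
      fix q v assume q: "q \<in> K" and v: "G q v v = 1"
      have l: "linear (\<lambda>v. G q v w)" "linear (G q v)" for v w using bil[of q] by (auto simp: bilinear_def)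
      have "v \<noteq> 0" using v linear_0[OF l(2), of 0] by auto
      then have "\<mu> \<le> G q (v /\<^sub>R norm v) (v /\<^sub>R norm v)"
        using m(2)[of "(q, v /\<^sub>R norm v)"] q by (simp add: \<mu>_def)
      also have "\<dots> = 1 / (norm v)\<^sup>2"
        by (simp add: linear_cmul[OF l(1)] linear_cmul[OF l(2)] v power2_eq_square divide_simps)
      finally have "(norm v)\<^sup>2 \<le> 1 / \<mu>" using \<mu> \<open>v \<noteq> 0\<close> by (simp add: field_simps)
      then have "norm v \<le> sqrt (1 / \<mu>)" using real_le_rsqrt by blast
      then show "norm v \<le> 1 / sqrt \<mu>" by (simp add: real_sqrt_divide)
    qed (use \<mu> in simp)
  qed
qed

lemma det_3_bound: "\<bar>det (vector [a, b, c] :: real ^ 3 ^ 3)\<bar> \<le> 6 * norm a * norm b * norm c"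
proof -
  have t: "\<bar>a $ x * b $ y * c $ z\<bar> \<le> norm a * norm b * norm c" for x y z
    unfolding abs_mult by (intro mult_mono component_le_norm_cart) auto
  show ?thesis
    unfolding det_3 vector_3
    using t[of 1 2 3] t[of 2 3 1] t[of 3 1 2] t[of 1 3 2] t[of 2 1 3] t[of 3 2 1]
    by (simp add: abs_le_iff)
qed

lemma biana_bounded:
  assumes "biana r g" obtains M where "M > 0" "\<And>x y. \<bar>x\<bar> < r \<Longrightarrow> \<bar>y\<bar> < r \<Longrightarrow> \<bar>g x y\<bar> \<le> M"
proof -
  obtain F where F: "bihol r F"
    "\<And>x y. \<bar>x\<bar> < r \<Longrightarrow> \<bar>y\<bar> < r \<Longrightarrow> F (of_real x) (of_real y) = of_real (g x y)"
    using assms unfolding biana_def by blast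
  obtain M where M: "\<forall>x\<in>ball 0 r. \<forall>y\<in>ball 0 r. norm (F x y) \<le> M"
    using F(1) unfolding bihol_def by blast
  show thesis
  proof (rule that[of "max M 1"])
    fix x y assume xy: "\<bar>x\<bar> < r" "\<bar>y\<bar> < r"
    have "norm (F (of_real x) (of_real y)) \<le> M" using M xy by simp
    then show "\<bar>g x y\<bar> \<le> max M 1" using F(2)[OF xy] by simp
  qed simp
qed

section \<open>Curvature and induced measure in a chart\<close>

context graph_chart
begin

text \<open>\<open>(\<nu>1, \<nu>2)\<close> is parallel to \<open>(G1, G2)\<close> along the chart. Differentiating \<open>\<nu>1 G2 - \<nu>2 G1 = 0\<close> in the
  parameter direction \<open>t\<close> of the horizontal tangent vector avoids having to follow the sign of the
  factor.\<close>

lemma curvature_phi: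
  assumes x: "x \<in> Box r" and u: "local_defining_function S (\<phi> x) U u"
    and nz: "G1 x \<noteq> 0 \<or> G2 x \<noteq> 0"
    and D: "(G1 has_derivative D1) (at x)" "(G2 has_derivative D2) (at x)"
  defines "t \<equiv> vector [G1 x * Y_field (\<phi> x) $ j - G2 x * X_field (\<phi> x) $ j,
                      G1 x * Y_field (\<phi> x) $ k - G2 x * X_field (\<phi> x) $ k] :: real ^ 2"
  shows "\<bar>divergence (\<lambda>q. horizontal_gradient u q /\<^sub>R horizontal_gradient_norm u q) (\<phi> x)\<bar>
    = \<bar>G1 x * D2 t - G2 x * D1 t\<bar> / sqrt ((G1 x)\<^sup>2 + (G2 x)\<^sup>2) ^ 3"
proof -
  define q where "q = \<phi> x"
  define a where "a = dir_deriv X_field u"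
  define b where "b = dir_deriv Y_field u"
  define n where "n = horizontal_gradient_norm u"
  define N where "N = sqrt ((G1 x)\<^sup>2 + (G2 x)\<^sup>2)"
  have U: "open U" "q \<in> U" "C_on 2 u U" and SU: "S \<inter> U = {q \<in> U. u q = 0}"
    and du: "\<And>q. q \<in> S \<inter> U \<Longrightarrow> frechet_derivative u (at q) \<noteq> (\<lambda>v. 0)"
    using u unfolding local_defining_function_def q_def by auto
  have N: "N > 0" unfolding N_def using nz by (auto simp: sum_power2_gt_zero_iff)
  have ab: "a (\<phi> y) = G1 y * frechet_derivative u (at (\<phi> y)) (axis i 1)"
    "b (\<phi> y) = G2 y * frechet_derivative u (at (\<phi> y)) (axis i 1)" if "y \<in> Box r" "\<phi> y \<in> U" for y
    unfolding a_def b_def dir_deriv_def G1_def G2_def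
    using defining_function_derivative[OF that(1) U(1) that(2) _ SU]
      C_on_2_derivative_differentiable(1)[OF U(3) that(2)] by blast+
  \<comment> \<open>The ratio between \<open>(a q, b q)\<close> and \<open>(G1 x, G2 x)\<close>. If
    it were zero, \<open>defining_function_derivative\<close> would make the whole differential of
    \<open>u\<close> vanish.\<close>
  define c where "c = frechet_derivative u (at q) (axis i 1)"
  have c: "c \<noteq> 0"
  proof
    assume "c = 0"
    then have "frechet_derivative u (at q) v = 0" for v
      using defining_function_derivative[OF x U(1,2)[unfolded q_def] _ SU, of v]
        C_on_2_derivative_differentiable(1)[OF U(3,2)] by (simp add: c_def q_def)
    then show False using du[of q] U(2) phi_in_S[OF x] by (auto simp: q_def fun_eq_iff)
  qed
  have abq: "a q = G1 x * c" "b q = G2 x * c"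
    using ab[OF x] U(2) by (auto simp: q_def c_def)
  have n_def': "n = (\<lambda>q. sqrt ((a q)\<^sup>2 + (b q)\<^sup>2))"
    by (auto simp: n_def a_def b_def horizontal_gradient_norm_def)
  have nq: "n q = N * \<bar>c\<bar>"
    by (simp add: n_def' abq N_def power_mult_distrib real_sqrt_mult flip: distrib_right)
  have diff: "a differentiable (at q)" "b differentiable (at q)"
    unfolding a_def b_def using dir_deriv_differentiable[OF U] by auto
  have sq: "(\<lambda>q. (a q)\<^sup>2 + (b q)\<^sup>2) differentiable (at q)"
    unfolding power2_eq_square by (intro derivative_intros diff)
  have pos: "(a q)\<^sup>2 + (b q)\<^sup>2 > 0" using nz c by (auto simp: abq sum_power2_gt_zero_iff)
  have "n differentiable (at q)"
  proof -
    obtain D' where "((\<lambda>q. (a q)\<^sup>2 + (b q)\<^sup>2) has_derivative D') (at q)"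
      using sq by (auto simp: differentiable_def)
    from has_derivative_real_sqrt[OF pos this] show ?thesis
      unfolding n_def' differentiable_def by blast
  qed
  moreover have "n q \<noteq> 0" using N c nq by simp
  ultimately have "(\<lambda>q. a q / n q) differentiable (at q)" "(\<lambda>q. b q / n q) differentiable (at q)"
    using diff by (auto intro!: derivative_intros)
  then obtain d1 d2 where d: "((\<lambda>q. a q / n q) has_derivative d1) (at q)" "((\<lambda>q. b q / n q) has_derivative d2) (at q)"
    by (auto simp: differentiable_def)
  have unit: "\<forall>\<^sub>F q in nhds q. (a q / n q)\<^sup>2 + (b q / n q)\<^sup>2 = 1"
  proof -
    have "isCont (\<lambda>q. (a q)\<^sup>2 + (b q)\<^sup>2) q"
      using sq by (rule differentiable_imp_continuous_within)
    then have "\<forall>\<^sub>F q in nhds q. (a q)\<^sup>2 + (b q)\<^sup>2 \<in> {0<..}"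
      using pos by (intro isCont_eventually_nhds) auto
    then show ?thesis
      by eventually_elim (auto simp: n_def' power_divide simp flip: add_divide_distrib)
  qed
  \<comment> \<open>The coefficients of the unit normal are \<open>\<kappa> * G1 x\<close> and
    \<open>\<kappa> * G2 x\<close>; the unknown sign of \<open>c\<close> is confined to
    \<open>\<kappa>\<close>.\<close>
  define \<kappa> where "\<kappa> = c / (N * \<bar>c\<bar>)"
  have \<kappa>: "a q / n q = \<kappa> * G1 x" "b q / n q = \<kappa> * G2 x"
    by (auto simp: abq nq \<kappa>_def)
  have abs_\<kappa>: "\<bar>\<kappa>\<bar> = 1 / N" using N c by (simp add: \<kappa>_def abs_divide abs_mult)
  define T where "T = - (b q / n q) *\<^sub>R X_field q + (a q / n q) *\<^sub>R Y_field q"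
  have T: "T = \<kappa> *\<^sub>R (G1 x *\<^sub>R Y_field q - G2 x *\<^sub>R X_field q)"
    by (simp add: T_def \<kappa> algebra_simps)
  \<comment> \<open>\<open>T\<close> is tangent to \<open>S\<close>, hence the image under
    \<open>\<phi>' x\<close> of a parameter vector, which is a multiple of \<open>t\<close>.
    Derivatives along \<open>T\<close> thus become derivatives in the parameter plane.\<close>
  have "L x T = - (b q / n q) * G1 x + (a q / n q) * G2 x"
    unfolding T_def q_def G1_def G2_def by (rule L_linear)
  then have "L x T = 0" by (simp add: \<kappa>)
  then have "\<phi>' x (vector [T $ j, T $ k]) = T"
    using L_decomp[of T x, symmetric] by simp
  moreover have "vector [T $ j, T $ k] = \<kappa> *\<^sub>R t"
    by (simp add: vec_eq_iff forall_2 T t_def q_def)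
  ultimately have phiT: "\<phi>' x (\<kappa> *\<^sub>R t) = T" by simp
  have "isCont \<phi> x" using phi_has_derivative[OF x] has_derivative_continuous by blast
  then have "\<forall>\<^sub>F y in nhds x. \<phi> y \<in> U"
    using U(1,2) unfolding q_def by (rule isCont_eventually_nhds)
  then obtain O1 where O1: "open O1" "x \<in> O1" "\<And>y. y \<in> O1 \<Longrightarrow> \<phi> y \<in> U"
    unfolding eventually_nhds by blast
  have comp: "((\<lambda>y. a (\<phi> y) / n (\<phi> y)) has_derivative (\<lambda>v. d1 (\<phi>' x v))) (at x)"
    "((\<lambda>y. b (\<phi> y) / n (\<phi> y)) has_derivative (\<lambda>v. d2 (\<phi>' x v))) (at x)"
    by (rule has_derivative_compose[OF phi_has_derivative[OF x], of "\<lambda>q. a q / n q", OF d(1)[unfolded q_def]],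
        rule has_derivative_compose[OF phi_has_derivative[OF x], of "\<lambda>q. b q / n q", OF d(2)[unfolded q_def]])
  have "((\<lambda>y. a (\<phi> y) / n (\<phi> y) * G2 y - b (\<phi> y) / n (\<phi> y) * G1 y) has_derivative
      (\<lambda>v. (a q / n q * D2 v + d1 (\<phi>' x v) * G2 x) - (b q / n q * D1 v + d2 (\<phi>' x v) * G1 x))) (at x)"
    unfolding q_def by (intro has_derivative_diff has_derivative_mult comp D)
  then have "((\<lambda>y. 0) has_derivative
      (\<lambda>v. (a q / n q * D2 v + d1 (\<phi>' x v) * G2 x) - (b q / n q * D1 v + d2 (\<phi>' x v) * G1 x))) (at x)"
    by (rule has_derivative_transform_within_open[of _ _ _ _ "O1 \<inter> Box r"])
       (use O1 x open_Box ab in auto)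
  then have "(\<lambda>v. (a q / n q * D2 v + d1 (\<phi>' x v) * G2 x) - (b q / n q * D1 v + d2 (\<phi>' x v) * G1 x)) = (\<lambda>v. 0)"
    using has_derivative_unique has_derivative_const by blast
  from fun_cong[OF this, of "\<kappa> *\<^sub>R t"]
  have key: "G1 x * d2 T - G2 x * d1 T = \<kappa> * (G1 x * D2 (\<kappa> *\<^sub>R t) - G2 x * D1 (\<kappa> *\<^sub>R t))"
    by (simp add: phiT \<kappa> algebra_simps)
  have lin: "linear D1" "linear D2" using D has_derivative_linear by auto
  have "(\<lambda>q. horizontal_gradient u q /\<^sub>R horizontal_gradient_norm u q)
      = (\<lambda>q. (a q / n q) *\<^sub>R X_field q + (b q / n q) *\<^sub>R Y_field q)"
    by (simp add: fun_eq_iff horizontal_gradient_def a_def b_def n_def scaleR_right_distrib divide_inverse mult.commute)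
  then have "divergence (\<lambda>q. horizontal_gradient u q /\<^sub>R horizontal_gradient_norm u q) q
      = a q / n q * d2 T - b q / n q * d1 T"
    using divergence_unit_horizontal[OF d unit] by (simp add: T_def)
  also have "\<dots> = \<kappa> * (G1 x * d2 T - G2 x * d1 T)" by (simp add: \<kappa> algebra_simps)
  \<comment> \<open>One factor comes from the normal, one from \<open>key\<close>, and one from the
    direction \<open>\<kappa> *\<^sub>R t\<close>.\<close>
  also have "\<dots> = \<kappa> ^ 3 * (G1 x * D2 t - G2 x * D1 t)"
    unfolding key by (simp add: linear_cmul[OF lin(1)] linear_cmul[OF lin(2)] algebra_simps power3_eq_cube)
  finally show ?thesis
    by (simp add: abs_mult power_abs abs_\<kappa> power_divide flip: q_def N_def)
qed

lemma biana_phi: "biana r (\<lambda>x y. \<phi> (vector [x, y]) $ t)"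
proof -
  have "\<forall>t. biana r (\<lambda>x y. \<phi> (vector [x, y]) $ t)"
    unfolding all_ijk using g by (simp add: biana_add biana_const biana_fst biana_snd)
  then show ?thesis by blast
qed

lemma biana_fields:
  "biana r (\<lambda>x y. X_field (\<phi> (vector [x, y])) $ t)" "biana r (\<lambda>x y. Y_field (\<phi> (vector [x, y])) $ t)"
proof -
  have "\<forall>t. biana r (\<lambda>x y. X_field (\<phi> (vector [x, y])) $ t)"
    using biana_mult[OF biana_const[of r "- 1 / 2"] biana_phi[of 2]]
    by (simp add: forall_3 X_field_def biana_const)
  moreover have "\<forall>t. biana r (\<lambda>x y. Y_field (\<phi> (vector [x, y])) $ t)"
    using biana_mult[OF biana_const[of r "1 / 2"] biana_phi[of 1]]
    by (simp add: forall_3 Y_field_def biana_const)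
  ultimately show "biana r (\<lambda>x y. X_field (\<phi> (vector [x, y])) $ t)" "biana r (\<lambda>x y. Y_field (\<phi> (vector [x, y])) $ t)"
    by blast+
qed

lemma biana_G: "biana r (\<lambda>x y. G1 (vector [x, y]))" "biana r (\<lambda>x y. G2 (vector [x, y]))"
  unfolding G1_def G2_def L_def by (simp_all add: biana_diff biana_mult biana_fields g)

lemma phi_surface_chart:
  assumes "0 < \<rho>" "\<rho> < r" shows "surface_chart S (Box \<rho>) \<phi>"
  unfolding surface_chart_def
proof (intro conjI)
  have sub: "Box \<rho> \<subseteq> Box r" using assms by (intro Box_mono) simp
  have D: "(\<phi> has_derivative \<phi>' x) (at x)" if "x \<in> Box \<rho>" for x
    using phi_has_derivative that sub by blast
  show "open (Box \<rho>)" by (rule open_Box)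
  have cont: "continuous_on (Box \<rho>) (\<lambda>x. h (x $ 1) (x $ 2))" if "biana r h" for h
  proof -
    have "continuous_on (Box \<rho>) (\<lambda>x. (\<lambda>(x, y). h x y) (x $ 1, x $ 2))"
      by (rule continuous_on_compose2[OF biana_continuous_on[OF that assms(2)]])
         (auto simp: Box_def intro!: continuous_intros)
    then show ?thesis by simp
  qed
  have "continuous_on (Box \<rho>) (\<lambda>x. frechet_derivative \<phi> (at x) v)" for v
  proof -
    have "continuous_on (Box \<rho>) (\<lambda>x. \<phi>' x v)"
      unfolding \<phi>'_def by (intro continuous_intros cont g)
    then show ?thesis
      by (rule continuous_on_eq) (use sub frechet_phi in auto)
  qed
  then show "C_on 1 \<phi> (Box \<rho>)"
    using D by (auto simp: One_nat_def differentiable_def)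
  show "\<forall>x\<in>Box \<rho>. inj (frechet_derivative \<phi> (at x))"
  proof
    fix x assume "x \<in> Box \<rho>"
    then have "frechet_derivative \<phi> (at x) = \<phi>' x" using sub frechet_phi by blast
    moreover have "vector [\<phi>' x v $ j, \<phi>' x v $ k] = v" for v
      by (simp add: \<phi>'_def vec_eq_iff forall_2)
    ultimately show "inj (frechet_derivative \<phi> (at x))" by (metis injI)
  qed
  let ?W = "{q. \<bar>q $ j - p $ j\<bar> < \<rho>} \<inter> {q. \<bar>q $ k - p $ k\<bar> < \<rho>} \<inter> {q. \<bar>q $ i - p $ i\<bar> < \<delta>}"
  have W: "open ?W"
    by (intro open_Int open_Collect_less continuous_intros)
  have img: "\<phi> ` Box \<rho> = S \<inter> ?W"
  proof (intro set_eqI iffI)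
    fix q assume "q \<in> \<phi> ` Box \<rho>"
    then obtain x where x: "x \<in> Box \<rho>" "q = \<phi> x" by blast
    then show "q \<in> S \<inter> ?W"
      using phi_in_S[of x] g_bound[of "x $ 1" "x $ 2"] sub assms by (auto simp: Box_def)
  next
    fix q assume q: "q \<in> S \<inter> ?W"
    then have "q $ i - p $ i = g (q $ j - p $ j) (q $ k - p $ k)" using graph[of q] assms by auto
    then have "q = \<phi> (\<psi> q)" by (simp add: vec_eq_iff all_ijk \<psi>_def)
    moreover have "\<psi> q \<in> Box \<rho>" using q by (simp add: Box_def \<psi>_def)
    ultimately show "q \<in> \<phi> ` Box \<rho>" by blast
  qed
  then show "openin (top_of_set S) (\<phi> ` Box \<rho>)" using W by (auto simp: openin_open)
  show "\<exists>\<psi>. homeomorphism (Box \<rho>) (\<phi> ` Box \<rho>) \<phi> \<psi>"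
  proof (intro exI homeomorphismI)
    show "continuous_on (Box \<rho>) \<phi>"
      using D by (meson continuous_at_imp_continuous_on has_derivative_continuous)
    show "continuous_on (\<phi> ` Box \<rho>) \<psi>"
      unfolding \<psi>_def[abs_def] vector_2_eq_axis by (intro continuous_intros)
  qed auto
qed

text \<open>Only an upper bound of the density is needed, so nothing has to be known about the
  measurability of the unit normal field.\<close>

lemma induced_measure_bound:
  assumes G: "riemannian_metric G" and \<sigma>: "is_riemannian_induced_measure G S \<sigma>"
    and \<rho>: "0 < \<rho>" "\<rho> < r"
  obtains C where "C > 0" "\<And>A. A \<in> sets \<sigma> \<Longrightarrow> A \<subseteq> \<phi> ` Box \<rho> \<Longrightarrow>
     emeasure \<sigma> A \<le> (\<integral>\<^sup>+x. ennreal C * indicator (Box \<rho> \<inter> \<phi> -` A) x \<partial>lborel)"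
proof -
  obtain n where n: "unit_normal_field G S n"
    and em: "\<And>V \<phi> A. surface_chart S V \<phi> \<Longrightarrow> A \<in> sets \<sigma> \<Longrightarrow> A \<subseteq> \<phi> ` V \<Longrightarrow> emeasure \<sigma> A =
               (\<integral>\<^sup>+x. ennreal \<bar>det (vector [n (\<phi> x),
                                  frechet_derivative \<phi> (at x) (axis 1 1),
                                  frechet_derivative \<phi> (at x) (axis 2 1)] :: real ^ 3 ^ 3)\<bar>
                      * indicator (V \<inter> \<phi> -` A) x \<partial>lborel)"
    using \<sigma> unfolding is_riemannian_induced_measure_def by blast
  obtain Mg where Mg: "Mg > 0" "\<And>x y. \<bar>x\<bar> < r \<Longrightarrow> \<bar>y\<bar> < r \<Longrightarrow> \<bar>gx x y\<bar> \<le> Mg"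
    using biana_bounded[OF g(2)] by blast
  obtain Mh where Mh: "Mh > 0" "\<And>x y. \<bar>x\<bar> < r \<Longrightarrow> \<bar>y\<bar> < r \<Longrightarrow> \<bar>gy x y\<bar> \<le> Mh"
    using biana_bounded[OF g(3)] by blast
  \<comment> \<open>\<open>2 * r + \<delta>\<close> bounds the distance from \<open>p\<close> to the
    points of the chart, so one compact ball contains its image.\<close>
  obtain Cn where Cn: "Cn > 0" "\<And>q v. q \<in> cball p (2 * r + \<delta>) \<Longrightarrow> G q v v = 1 \<Longrightarrow> norm v \<le> Cn"
    using riemannian_metric_bound[OF G compact_cball] by blast
  \<comment> \<open>\<open>6\<close> counts the products in the determinant; \<open>1 + Mg\<close>
    and \<open>1 + Mh\<close> bound the two coordinate tangent vectors.\<close>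
  define C where "C = 6 * Cn * (1 + Mg) * (1 + Mh)"
  have bound: "\<bar>det (vector [n (\<phi> x), frechet_derivative \<phi> (at x) (axis 1 1),
      frechet_derivative \<phi> (at x) (axis 2 1)] :: real ^ 3 ^ 3)\<bar> \<le> C" if x: "x \<in> Box \<rho>" for x
  proof -
    have xr: "x \<in> Box r" using x Box_mono[of \<rho> r] \<rho> by auto
    then have x': "\<bar>x $ 1\<bar> < r" "\<bar>x $ 2\<bar> < r" by (auto simp: Box_def)
    have D: "frechet_derivative \<phi> (at x) = \<phi>' x" using frechet_phi xr by blast
    have "norm (\<phi> x - p) \<le> norm (x $ 1 *\<^sub>R axis j (1::real)) + norm (x $ 2 *\<^sub>R axis k (1::real))
        + norm (g (x $ 1) (x $ 2) *\<^sub>R axis i (1::real))"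
    proof -
      have "\<phi> x - p = x $ 1 *\<^sub>R axis j 1 + x $ 2 *\<^sub>R axis k 1 + g (x $ 1) (x $ 2) *\<^sub>R axis i 1"
        by (simp add: \<phi>_def)
      then show ?thesis by (simp only:) (intro norm_triangle_le add_right_mono norm_triangle_ineq)
    qed
    also have "\<dots> \<le> r + r + \<delta>" using x' g_bound[OF x'] by simp
    finally have "\<phi> x \<in> cball p (2 * r + \<delta>)" by (simp add: dist_norm norm_minus_commute)
    moreover have "G (\<phi> x) (n (\<phi> x)) (n (\<phi> x)) = 1"
      using n phi_in_S[OF xr] unfolding unit_normal_field_def by blast
    ultimately have n1: "norm (n (\<phi> x)) \<le> Cn" by (rule Cn(2))
    have a1: "norm (\<phi>' x (axis 1 1)) \<le> 1 + Mg" 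
      using norm_triangle_ineq[of "axis j (1::real)" "gx (x $ 1) (x $ 2) *\<^sub>R axis i 1"] Mg(2)[OF x']
      by (simp add: \<phi>'_def axis_def[of 1 "1::real"])
    have a2: "norm (\<phi>' x (axis 2 1)) \<le> 1 + Mh"
      using norm_triangle_ineq[of "axis k (1::real)" "gy (x $ 1) (x $ 2) *\<^sub>R axis i 1"] Mh(2)[OF x']
      by (simp add: \<phi>'_def axis_def[of 2 "1::real"])
    have "\<bar>det (vector [n (\<phi> x), \<phi>' x (axis 1 1), \<phi>' x (axis 2 1)] :: real ^ 3 ^ 3)\<bar>
        \<le> 6 * norm (n (\<phi> x)) * norm (\<phi>' x (axis 1 1)) * norm (\<phi>' x (axis 2 1))"
      by (rule det_3_bound)
    also have "\<dots> \<le> C" unfolding C_def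
      by (intro mult_mono n1 a1 a2) (use Cn Mg Mh in auto)
    finally show ?thesis by (simp add: D)
  qed
  show thesis
  proof (rule that[of C])
    show "C > 0" using Cn Mg Mh by (simp add: C_def)
    fix A assume A: "A \<in> sets \<sigma>" "A \<subseteq> \<phi> ` Box \<rho>"
    show "emeasure \<sigma> A \<le> (\<integral>\<^sup>+x. ennreal C * indicator (Box \<rho> \<inter> \<phi> -` A) x \<partial>lborel)"
      unfolding em[OF phi_surface_chart[OF \<rho>] A]
      by (intro nn_integral_mono) (use bound in \<open>auto split: split_indicator intro: ennreal_leI\<close>)
  qed
qed

end

lemma measurable_vector_2 [measurable]:
  "(\<lambda>(x, y). vector [x, y] :: real ^ 2) \<in> borel_measurable (lborel \<Otimes>\<^sub>M lborel)"
  unfolding lborel_prod vector_2_eq_axis split_def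
  by (auto intro!: borel_measurable_continuous_onI continuous_intros)

lemma nn_integral_real2:
  fixes f :: "real ^ 2 \<Rightarrow> ennreal"
  assumes [measurable]: "f \<in> borel_measurable borel"
  shows "(\<integral>\<^sup>+v. f v \<partial>lborel) = (\<integral>\<^sup>+p. f (case p of (x, y) \<Rightarrow> vector [x, y]) \<partial>(lborel \<Otimes>\<^sub>M lborel))"
  by (subst lborel_real2, subst nn_integral_distr) auto

text \<open>\<open>biana_angle_integrable\<close> differentiates in the first argument. The reversed
  order brings the derivative in the second coordinate into that form.\<close>

lemma nn_integral_real2_swap:
  fixes f :: "real ^ 2 \<Rightarrow> ennreal"
  assumes [measurable]: "f \<in> borel_measurable borel"
  shows "(\<integral>\<^sup>+v. f v \<partial>lborel) = (\<integral>\<^sup>+p. f (case p of (x, y) \<Rightarrow> vector [y, x]) \<partial>(lborel \<Otimes>\<^sub>M lborel))"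
proof -
  have m: "(\<lambda>(x, y). vector [y, x] :: real ^ 2) \<in> borel_measurable (lborel \<Otimes>\<^sub>M lborel)"
    unfolding lborel_prod vector_2_eq_axis split_def
    by (auto intro!: borel_measurable_continuous_onI continuous_intros)
  have "(\<integral>\<^sup>+v. f v \<partial>lborel) = (\<integral>\<^sup>+y. \<integral>\<^sup>+x. f (vector [x, y]) \<partial>lborel \<partial>lborel)"
    unfolding nn_integral_real2[OF assms]
    by (subst lborel_pair.nn_integral_snd[symmetric]) auto
  also have "\<dots> = (\<integral>\<^sup>+p. f (case p of (x, y) \<Rightarrow> vector [y, x]) \<partial>(lborel \<Otimes>\<^sub>M lborel))"
    by (subst lborel.nn_integral_fst[symmetric]) (auto intro!: measurable_compose[OF m])
  finally show ?thesis .
qed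

lemma has_derivative_partials:
  assumes "((\<lambda>(x, y). g x y) has_derivative (\<lambda>(s, t). a * s + b * t)) (at (x, y :: real))"
  shows "DERIV (\<lambda>t. g t y) x :> (a :: real)" "DERIV (\<lambda>t. g x t) y :> b"
proof -
  have "((\<lambda>t. (t, y)) has_derivative (\<lambda>s. (s, 0))) (at x)" "((\<lambda>t. (x, t)) has_derivative (\<lambda>s. (0, s))) (at y)"
    by (auto intro!: derivative_eq_intros)
  from has_derivative_compose[OF this(1) assms] has_derivative_compose[OF this(2) assms]
  show "DERIV (\<lambda>t. g t y) x :> a" "DERIV (\<lambda>t. g x t) y :> b"
    by (simp_all add: has_field_derivative_def)
qed

context graph_chart
begin

lemma biana_measurable_Box:
  assumes "biana r' h" "\<rho> < r'"
  shows "(\<lambda>x. indicator (Box \<rho>) x * h (x $ 1) (x $ 2)) \<in> borel_measurable borel"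
proof -
  have "continuous_on (Box \<rho>) (\<lambda>x. (\<lambda>(x, y). h x y) (x $ 1, x $ 2))"
    by (rule continuous_on_compose2[OF biana_continuous_on[OF assms]])
       (auto simp: Box_def intro!: continuous_intros)
  from borel_measurable_continuous_on_indicator[OF borel_open[OF open_Box] this] show ?thesis by simp
qed

lemma vector_nth_2 [simp]: "vector [x $ 1, x $ 2] = x" for x :: "real ^ 2"
  by (simp add: vec_eq_iff forall_2)

text \<open>Off the origin of the box, |H| along the chart equals a Borel function \<open>h\<close>
  of the parameters, which is bounded by the two angle derivatives. As \<open>\<sigma>\<close> is
  only bounded from above on chart images, its integrals are compared with those of a push-forward
  of Lebesgue measure.\<close>

lemma curvature_integrable:
  assumes metric: "riemannian_metric G" and \<sigma>: "is_riemannian_induced_measure G S \<sigma>"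
    and H: "is_horizontal_mean_curvature S H" and p: "p \<in> S"
    and \<rho>1: "0 < \<rho>1" "\<rho>1 \<le> r"
    and nz: "\<And>x. x \<in> Box \<rho>1 \<Longrightarrow> x \<noteq> 0 \<Longrightarrow> G1 x \<noteq> 0 \<or> G2 x \<noteq> 0"
  shows "\<exists>N. openin (top_of_set S) N \<and> p \<in> N \<and> set_integrable \<sigma> N (\<lambda>q. \<bar>H q\<bar>)"
proof -
  have phi0: "\<phi> 0 = p"
    using graph[of p] p r g_bound[of 0 0] by (simp add: \<phi>_def)
  define b1 b2 where b: "b1 x y = G1 (vector [x, y])" "b2 x y = G2 (vector [x, y])" for x y
  have bG: "biana r b1" "biana r b2" using biana_G by (simp_all add: b[abs_def])
  have r2: "r / 2 < r" "r / 2 > 0" using r by auto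
  obtain b1x b1y where b1: "biana (r / 2) b1x" "biana (r / 2) b1y"
    "\<And>x y. \<bar>x\<bar> < r / 2 \<Longrightarrow> \<bar>y\<bar> < r / 2 \<Longrightarrow>
      ((\<lambda>(x,y). b1 x y) has_derivative (\<lambda>(s,t). b1x x y * s + b1y x y * t)) (at (x, y))"
    using biana_has_derivative[OF bG(1) r2(1)] by metis
  obtain b2x b2y where b2: "biana (r / 2) b2x" "biana (r / 2) b2y"
    "\<And>x y. \<bar>x\<bar> < r / 2 \<Longrightarrow> \<bar>y\<bar> < r / 2 \<Longrightarrow>
      ((\<lambda>(x,y). b2 x y) has_derivative (\<lambda>(s,t). b2x x y * s + b2y x y * t)) (at (x, y))"
    using biana_has_derivative[OF bG(2) r2(1)] by metis
  have b': "biana (r / 2) b1" "biana (r / 2) b2" using bG r2 biana_mono[of r _ "r / 2"] by auto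
  \<comment> \<open>Divided by \<open>b1^2 + b2^2\<close>, \<open>Wx\<close> and \<open>Wy\<close>
    are the partial derivatives of the angle of \<open>(b1, b2)\<close>.\<close>
  define Wx where "Wx x y = b1 x y * b2x x y - b2 x y * b1x x y" for x y
  define Wy where "Wy x y = b1 x y * b2y x y - b2 x y * b1y x y" for x y
  have W: "biana (r / 2) Wx" "biana (r / 2) Wy"
    unfolding Wx_def Wy_def by (intro biana_diff biana_mult b' b1 b2)+
  obtain \<rho>x where \<rho>x: "0 < \<rho>x" "\<rho>x < r / 2"
    "(\<integral>\<^sup>+p. (case p of (x, y) \<Rightarrow> ennreal (\<bar>Wx x y\<bar> / ((b1 x y)\<^sup>2 + (b2 x y)\<^sup>2)))
       * indicator ({-\<rho>x<..<\<rho>x} \<times> {-\<rho>x<..<\<rho>x}) p \<partial>(lborel \<Otimes>\<^sub>M lborel)) < \<infinity>"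
    using biana_angle_integrable[OF r2(2) b' b1(1) b2(1) has_derivative_partials(1)[OF b1(3)]
        has_derivative_partials(1)[OF b2(3)]] unfolding Wx_def by blast
  obtain \<rho>y where \<rho>y: "0 < \<rho>y" "\<rho>y < r / 2"
    "(\<integral>\<^sup>+p. (case p of (x, y) \<Rightarrow> ennreal (\<bar>Wy y x\<bar> / ((b1 y x)\<^sup>2 + (b2 y x)\<^sup>2)))
       * indicator ({-\<rho>y<..<\<rho>y} \<times> {-\<rho>y<..<\<rho>y}) p \<partial>(lborel \<Otimes>\<^sub>M lborel)) < \<infinity>"
    using biana_angle_integrable[OF r2(2) biana_swap[OF b'(1)] biana_swap[OF b'(2)]
        biana_swap[OF b1(2)] biana_swap[OF b2(2)] has_derivative_partials(2)[OF b1(3)]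
        has_derivative_partials(2)[OF b2(3)]] unfolding Wy_def by blast
  define \<rho> where "\<rho> = Min {\<rho>1 / 2, \<rho>x, \<rho>y}"
  have \<rho>: "\<rho> > 0" using \<rho>1 \<rho>x \<rho>y by (simp add: \<rho>_def)
  have "\<rho> \<le> \<rho>1 / 2" "\<rho> \<le> \<rho>x" "\<rho> \<le> \<rho>y" unfolding \<rho>_def by (rule Min_le; simp)+
  then have \<rho>_le: "\<rho> \<le> \<rho>1" "\<rho> \<le> \<rho>x" "\<rho> \<le> \<rho>y" "\<rho> < r / 2" "\<rho> < r"
    using \<rho>x \<rho>y \<rho>1 r by auto
  have Br: "x \<in> Box r" if "x \<in> Box \<rho>" for x using that Box_mono[of \<rho> r] \<rho>_le by auto
  define fx where "fx v = indicator (Box \<rho>) v * (\<bar>Wx (v $ 1) (v $ 2)\<bar> / ((b1 (v $ 1) (v $ 2))\<^sup>2 + (b2 (v $ 1) (v $ 2))\<^sup>2))" for v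
  define fy where "fy v = indicator (Box \<rho>) v * (\<bar>Wy (v $ 1) (v $ 2)\<bar> / ((b1 (v $ 1) (v $ 2))\<^sup>2 + (b2 (v $ 1) (v $ 2))\<^sup>2))" for v
  have meas: "(\<lambda>x. indicator (Box \<rho>) x * h (x $ 1) (x $ 2)) \<in> borel_measurable borel" if "biana (r / 2) h" for h
    by (rule biana_measurable_Box[OF that \<rho>_le(4)])
  \<comment> \<open>Outside the box both sides are zero because of \<open>0 / 0 = 0\<close>. The
    right-hand side is assembled from Borel functions.\<close>
  have ind_quot: "indicator (Box \<rho>) v * (\<bar>w\<bar> / (c\<^sup>2 + d\<^sup>2)) =
      \<bar>indicator (Box \<rho>) v * w\<bar> / ((indicator (Box \<rho>) v * c)\<^sup>2 + (indicator (Box \<rho>) v * d)\<^sup>2)" for v and w c d :: real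
    by (simp split: split_indicator)
  have [measurable]: "fx \<in> borel_measurable borel" "fy \<in> borel_measurable borel"
    unfolding fx_def[abs_def] fy_def[abs_def] ind_quot
    by (intro borel_measurable_divide borel_measurable_abs borel_measurable_add borel_measurable_power
        meas W b')+
  have fin_x: "(\<integral>\<^sup>+v. ennreal (fx v) \<partial>lborel) < \<infinity>"
  proof -
    have "(\<integral>\<^sup>+v. ennreal (fx v) \<partial>lborel) = (\<integral>\<^sup>+p. ennreal (fx (case p of (x, y) \<Rightarrow> vector [x, y])) \<partial>(lborel \<Otimes>\<^sub>M lborel))"
      by (rule nn_integral_real2) measurable
    also have "\<dots> \<le> (\<integral>\<^sup>+p. (case p of (x, y) \<Rightarrow> ennreal (\<bar>Wx x y\<bar> / ((b1 x y)\<^sup>2 + (b2 x y)\<^sup>2)))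
       * indicator ({-\<rho>x<..<\<rho>x} \<times> {-\<rho>x<..<\<rho>x}) p \<partial>(lborel \<Otimes>\<^sub>M lborel))"
      by (intro nn_integral_mono) (use \<rho>_le in \<open>auto simp: fx_def Box_def split: split_indicator\<close>)
    also note \<rho>x(3)
    finally show ?thesis .
  qed
  have fin_y: "(\<integral>\<^sup>+v. ennreal (fy v) \<partial>lborel) < \<infinity>"
  proof -
    have "(\<integral>\<^sup>+v. ennreal (fy v) \<partial>lborel) = (\<integral>\<^sup>+p. ennreal (fy (case p of (x, y) \<Rightarrow> vector [y, x])) \<partial>(lborel \<Otimes>\<^sub>M lborel))"
      by (rule nn_integral_real2_swap) measurable
    also have "\<dots> \<le> (\<integral>\<^sup>+p. (case p of (x, y) \<Rightarrow> ennreal (\<bar>Wy y x\<bar> / ((b1 y x)\<^sup>2 + (b2 y x)\<^sup>2)))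
       * indicator ({-\<rho>y<..<\<rho>y} \<times> {-\<rho>y<..<\<rho>y}) p \<partial>(lborel \<Otimes>\<^sub>M lborel))"
      by (intro nn_integral_mono) (use \<rho>_le in \<open>auto simp: fy_def Box_def split: split_indicator\<close>)
    also note \<rho>y(3)
    finally show ?thesis .
  qed
  define Xc where "Xc t x y = X_field (\<phi> (vector [x, y])) $ t" for t x y
  define Yc where "Yc t x y = Y_field (\<phi> (vector [x, y])) $ t" for t x y
  have XY: "biana r (Xc t)" "biana r (Yc t)" for t
    using biana_fields by (simp_all add: Xc_def[abs_def] Yc_def[abs_def])
  \<comment> \<open>\<open>\<tau> j\<close> and \<open>\<tau> k\<close> are the components of the
    vector \<open>t\<close> in \<open>curvature_phi\<close>; the function \<open>num\<close> below
    is the numerator there.\<close>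
  define \<tau> where "\<tau> t x y = b1 x y * Yc t x y - b2 x y * Xc t x y" for t x y
  have \<tau>: "biana (r / 2) (\<tau> t)" for t
    unfolding \<tau>_def using biana_mono[OF XY(1), of "r / 2" t] biana_mono[OF XY(2), of "r / 2" t] r2
    by (intro biana_diff biana_mult b') auto
  define num where "num x y = \<tau> j x y * Wx x y + \<tau> k x y * Wy x y" for x y
  have num: "biana (r / 2) num" unfolding num_def by (intro biana_add biana_mult \<tau> W)
  define h where "h v = indicator (Box \<rho>) v *
      (\<bar>num (v $ 1) (v $ 2)\<bar> / sqrt ((b1 (v $ 1) (v $ 2))\<^sup>2 + (b2 (v $ 1) (v $ 2))\<^sup>2) ^ 3)" for v
  have ind_quot3: "indicator (Box \<rho>) v * (\<bar>w\<bar> / sqrt (c\<^sup>2 + d\<^sup>2) ^ 3) =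
      \<bar>indicator (Box \<rho>) v * w\<bar> / sqrt ((indicator (Box \<rho>) v * c)\<^sup>2 + (indicator (Box \<rho>) v * d)\<^sup>2) ^ 3" for v and w c d :: real
    by (simp split: split_indicator)
  have h_meas [measurable]: "h \<in> borel_measurable borel"
    unfolding h_def[abs_def] ind_quot3
    by (intro borel_measurable_divide borel_measurable_abs borel_measurable_add borel_measurable_power
        measurable_compose[OF _ borel_measurable_sqrt] meas num b')
  have h_nonneg: "h v \<ge> 0" for v by (simp add: h_def)
  obtain K where K: "K > 0" "\<And>t x y. t = j \<or> t = k \<Longrightarrow> \<bar>x\<bar> < r \<Longrightarrow> \<bar>y\<bar> < r \<Longrightarrow> \<bar>Xc t x y\<bar> \<le> K \<and> \<bar>Yc t x y\<bar> \<le> K"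
  proof -
    obtain K1 where K1: "K1 > 0" "\<And>x y. \<bar>x\<bar> < r \<Longrightarrow> \<bar>y\<bar> < r \<Longrightarrow> \<bar>Xc j x y\<bar> \<le> K1" using biana_bounded[OF XY(1)] by metis
    obtain K2 where K2: "K2 > 0" "\<And>x y. \<bar>x\<bar> < r \<Longrightarrow> \<bar>y\<bar> < r \<Longrightarrow> \<bar>Xc k x y\<bar> \<le> K2" using biana_bounded[OF XY(1)] by metis
    obtain K3 where K3: "K3 > 0" "\<And>x y. \<bar>x\<bar> < r \<Longrightarrow> \<bar>y\<bar> < r \<Longrightarrow> \<bar>Yc j x y\<bar> \<le> K3" using biana_bounded[OF XY(2)] by metis
    obtain K4 where K4: "K4 > 0" "\<And>x y. \<bar>x\<bar> < r \<Longrightarrow> \<bar>y\<bar> < r \<Longrightarrow> \<bar>Yc k x y\<bar> \<le> K4" using biana_bounded[OF XY(2)] by metis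
    show thesis
    proof (rule that[of "K1 + K2 + K3 + K4"])
      fix t x y assume "t = j \<or> t = k" "\<bar>x\<bar> < r" "\<bar>y\<bar> < r"
      then show "\<bar>Xc t x y\<bar> \<le> K1 + K2 + K3 + K4 \<and> \<bar>Yc t x y\<bar> \<le> K1 + K2 + K3 + K4"
        using K1(2)[of x y] K2(2)[of x y] K3(2)[of x y] K4(2)[of x y] K1(1) K2(1) K3(1) K4(1) by auto
    qed (use K1 K2 K3 K4 in simp)
  qed
  \<comment> \<open>\<open>\<tau>\<close> is of size \<open>2 * K * N\<close>, which cancels one of
    the three powers of \<open>N\<close> and leaves the angle derivatives.\<close>
  have h_le: "h v \<le> 2 * K * (fx v + fy v)" for v
  proof (cases "v \<in> Box \<rho>")
    case False then show ?thesis by (simp add: h_def fx_def fy_def)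
  next
    case True
    then have v: "\<bar>v $ 1\<bar> < r" "\<bar>v $ 2\<bar> < r" using Br by (auto simp: Box_def)
    let ?c = "b1 (v $ 1) (v $ 2)" and ?d = "b2 (v $ 1) (v $ 2)"
    let ?Wx = "\<bar>Wx (v $ 1) (v $ 2)\<bar>" and ?Wy = "\<bar>Wy (v $ 1) (v $ 2)\<bar>"
    define N where "N = sqrt (?c\<^sup>2 + ?d\<^sup>2)"
    have N: "N \<ge> 0" "N\<^sup>2 = ?c\<^sup>2 + ?d\<^sup>2" "\<bar>?c\<bar> \<le> N" "\<bar>?d\<bar> \<le> N"
      by (auto simp: N_def real_le_rsqrt)
    have t: "\<bar>\<tau> t (v $ 1) (v $ 2)\<bar> \<le> 2 * K * N" if "t = j \<or> t = k" for t
    proof -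
      have "\<bar>\<tau> t (v $ 1) (v $ 2)\<bar> \<le> \<bar>?c\<bar> * \<bar>Yc t (v $ 1) (v $ 2)\<bar> + \<bar>?d\<bar> * \<bar>Xc t (v $ 1) (v $ 2)\<bar>"
        unfolding \<tau>_def abs_mult[symmetric] by (rule abs_triangle_ineq4)
      also have "\<dots> \<le> N * K + N * K"
        using K(2)[OF that v] N K(1) by (intro add_mono mult_mono) auto
      finally show ?thesis by simp
    qed
    have "\<bar>num (v $ 1) (v $ 2)\<bar> \<le> \<bar>\<tau> j (v $ 1) (v $ 2)\<bar> * ?Wx + \<bar>\<tau> k (v $ 1) (v $ 2)\<bar> * ?Wy"
      unfolding num_def abs_mult[symmetric] by (rule abs_triangle_ineq)
    also have "\<dots> \<le> (2 * K * N) * ?Wx + (2 * K * N) * ?Wy"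
      by (intro add_mono mult_right_mono t) auto
    finally have "\<bar>num (v $ 1) (v $ 2)\<bar> / N ^ 3 \<le> ((2 * K * N) * ?Wx + (2 * K * N) * ?Wy) / N ^ 3"
      using N by (intro divide_right_mono) auto
    \<comment> \<open>At \<open>N = 0\<close> both sides are zero, by the convention for
      division.\<close>
    also have "\<dots> = 2 * K * (?Wx / N\<^sup>2 + ?Wy / N\<^sup>2)"
      by (cases "N = 0") (simp_all add: power3_eq_cube power2_eq_square field_simps)
    finally show ?thesis using True by (simp add: h_def fx_def fy_def N_def)
  qed
  have fin: "(\<integral>\<^sup>+v. ennreal (h v) \<partial>lborel) < \<infinity>"
  proof -
    have "(\<integral>\<^sup>+v. ennreal (h v) \<partial>lborel) \<le> (\<integral>\<^sup>+v. ennreal (2 * K) * (ennreal (fx v) + ennreal (fy v)) \<partial>lborel)"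
    proof (intro nn_integral_mono)
      fix v
      have "fx v \<ge> 0" "fy v \<ge> 0" by (auto simp: fx_def fy_def)
      then have "ennreal (2 * K) * (ennreal (fx v) + ennreal (fy v)) = ennreal (2 * K * (fx v + fy v))"
        using K(1) by (simp add: ennreal_mult ennreal_plus)
      then show "ennreal (h v) \<le> ennreal (2 * K) * (ennreal (fx v) + ennreal (fy v))"
        using h_le[of v] by (simp add: ennreal_leI)
    qed
    also have "\<dots> = ennreal (2 * K) * ((\<integral>\<^sup>+v. ennreal (fx v) \<partial>lborel) + (\<integral>\<^sup>+v. ennreal (fy v) \<partial>lborel))"
      by (subst nn_integral_cmult) (auto simp: nn_integral_add)
    also have "\<dots> < \<infinity>" using fin_x fin_y by (simp add: ennreal_mult_less_top)
    finally show ?thesis .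
  qed
  \<comment> \<open>\<open>H\<close> may use another defining function at each point;
    \<open>curvature_phi\<close> yields the same absolute value for all of them.\<close>
  have curv: "\<bar>H (\<phi> x)\<bar> = h x" if x: "x \<in> Box \<rho>" "x \<noteq> 0" for x
  proof -
    have xr: "x \<in> Box r" using Br x by blast
    have nzx: "G1 x \<noteq> 0 \<or> G2 x \<noteq> 0" using nz[of x] x Box_mono[OF \<rho>_le(1)] by auto
    then have "\<phi> x \<in> S - characteristic_set S"
      using characteristic_phi[OF xr] phi_in_S[OF xr] by auto
    then obtain U u where u: "local_defining_function S (\<phi> x) U u"
      "H (\<phi> x) = - divergence (\<lambda>q. horizontal_gradient u q /\<^sub>R horizontal_gradient_norm u q) (\<phi> x)"
      using H unfolding is_horizontal_mean_curvature_def by blast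
    have x2: "\<bar>x $ 1\<bar> < r / 2" "\<bar>x $ 2\<bar> < r / 2" using x \<rho>_le by (auto simp: Box_def)
    have c: "((\<lambda>x :: real ^ 2. (x $ 1, x $ 2)) has_derivative (\<lambda>v. (v $ 1, v $ 2))) (at x)"
      by (auto intro!: has_derivative_Pair bounded_linear.has_derivative[OF bounded_linear_vec_nth])
    have D: "(G1 has_derivative (\<lambda>v. b1x (x $ 1) (x $ 2) * v $ 1 + b1y (x $ 1) (x $ 2) * v $ 2)) (at x)"
      "(G2 has_derivative (\<lambda>v. b2x (x $ 1) (x $ 2) * v $ 1 + b2y (x $ 1) (x $ 2) * v $ 2)) (at x)"
      using has_derivative_compose[OF c b1(3)[OF x2]] has_derivative_compose[OF c b2(3)[OF x2]]
      by (simp_all add: b)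
    show ?thesis
      unfolding u(2) abs_minus_cancel curvature_phi[OF xr u(1) nzx D] h_def num_def \<tau>_def Wx_def Wy_def Xc_def Yc_def b
      using x by (simp add: algebra_simps)
  qed
  obtain C where C: "C > 0" "\<And>A. A \<in> sets \<sigma> \<Longrightarrow> A \<subseteq> \<phi> ` Box \<rho> \<Longrightarrow>
     emeasure \<sigma> A \<le> (\<integral>\<^sup>+x. ennreal C * indicator (Box \<rho> \<inter> \<phi> -` A) x \<partial>lborel)"
    using induced_measure_bound[OF metric \<sigma> \<rho> \<rho>_le(5)] by blast
  define N where "N = \<phi> ` Box \<rho>"
  have chart: "surface_chart S (Box \<rho>) \<phi>" by (rule phi_surface_chart[OF \<rho> \<rho>_le(5)])
  have N_open: "openin (top_of_set S) N"
    using chart unfolding surface_chart_def N_def by blast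
  then obtain W0 where W0: "open W0" "N = S \<inter> W0" unfolding openin_open by blast
  have zero_Box: "0 \<in> Box \<rho>" using \<rho> by (simp add: Box_def)
  then have pN: "p \<in> N" unfolding N_def using phi0 by (metis imageI)
  have sp: "space \<sigma> = S" "sets \<sigma> = sets (restrict_space borel S)"
    using \<sigma> unfolding is_riemannian_induced_measure_def by auto
  have N_sets [measurable]: "N \<in> sets \<sigma>"
    unfolding sp W0(2) sets_restrict_space using W0(1) by auto
  \<comment> \<open>A Borel substitute for |H| on \<open>N\<close>, as \<open>H\<close> is only
    known to agree with a measurable function up to sign and away from \<open>p\<close>. The
    arbitrary value at \<open>p\<close> gets its own term.\<close>
  define F where "F q = indicator {p} q * \<bar>H p\<bar> + indicator (W0 - {p}) q * h (\<psi> q)" for q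
  have \<psi>m: "\<psi> \<in> borel_measurable borel"
    unfolding \<psi>_def[abs_def] vector_2_eq_axis
    by (intro borel_measurable_continuous_onI continuous_intros)
  have Fm: "F \<in> borel_measurable borel"
    unfolding F_def[abs_def] using borel_open[OF open_delete[OF W0(1)], of p] measurable_compose[OF \<psi>m h_meas]
    by (intro borel_measurable_add borel_measurable_times) auto
  have F_nonneg: "F q \<ge> 0" for q using h_nonneg by (simp add: F_def)
  have Fr: "F \<in> borel_measurable (restrict_space borel S)" using Fm by (rule measurable_restrict_space1)
  have F\<sigma>: "F \<in> borel_measurable \<sigma>"
    using Fr measurable_cong_sets[OF sp(2) refl] by blast
  have HF: "indicator N q * \<bar>H q\<bar> = F q * indicator N q" if "q \<in> S" for q
  proof (cases "q \<in> N")
    case True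
    then obtain x where x: "x \<in> Box \<rho>" "q = \<phi> x" unfolding N_def by blast
    show ?thesis
    proof (cases "x = 0")
      case True then show ?thesis using x phi0 pN by (simp add: F_def)
    next
      case False
      then have "q \<noteq> p" using x(2) phi0 psi_phi by metis
      then show ?thesis using True curv[OF x(1) False] x W0 by (auto simp: F_def)
    qed
  qed simp
  \<comment> \<open>The default value \<open>p\<close> lies in \<open>S\<close>, so this is a map
    into the space of \<open>\<sigma>\<close>.\<close>
  define \<phi>2 where "\<phi>2 x = (if x \<in> Box \<rho> then \<phi> x else p)" for x
  define M0 where "M0 = density lborel (\<lambda>x. ennreal C * indicator (Box \<rho>) x)"
  have Bm [measurable]: "Box \<rho> \<in> sets borel" using open_Box by (rule borel_open)
  have \<phi>2b: "\<phi>2 \<in> borel_measurable borel"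
  proof -
    have "continuous_on (Box \<rho>) \<phi>"
      using chart unfolding surface_chart_def homeomorphism_def by blast
    then have "(\<lambda>x. indicator (Box \<rho>) x *\<^sub>R \<phi> x) \<in> borel_measurable borel"
      by (rule borel_measurable_continuous_on_indicator[OF Bm])
    moreover have "(\<lambda>x. indicator (- Box \<rho>) x *\<^sub>R p) \<in> borel_measurable borel" by measurable
    ultimately have "(\<lambda>x. indicator (Box \<rho>) x *\<^sub>R \<phi> x + indicator (- Box \<rho>) x *\<^sub>R p) \<in> borel_measurable borel"
      by (rule borel_measurable_add)
    also have "(\<lambda>x. indicator (Box \<rho>) x *\<^sub>R \<phi> x + indicator (- Box \<rho>) x *\<^sub>R p) = \<phi>2"
      by (auto simp: \<phi>2_def fun_eq_iff)
    finally show ?thesis .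
  qed
  have \<phi>2m: "\<phi>2 \<in> measurable M0 (restrict_space borel S)"
    using \<phi>2b p phi_in_S Br by (intro measurable_restrict_space2) (auto simp: M0_def \<phi>2_def)
  \<comment> \<open>The bound on small sets becomes an inequality of measures, under which integrals
    of nonnegative functions over \<open>N\<close> reduce to Lebesgue integrals over the
    box.\<close>
  have le: "density \<sigma> (indicator N) \<le> distr M0 (restrict_space borel S) \<phi>2"
  proof (subst le_measure)
    show "\<forall>A\<in>sets (density \<sigma> (indicator N)). emeasure (density \<sigma> (indicator N)) A \<le> emeasure (distr M0 (restrict_space borel S) \<phi>2) A"
    proof
      fix A assume "A \<in> sets (density \<sigma> (indicator N))"
      then have A: "A \<in> sets \<sigma>" by simp
      have "emeasure (density \<sigma> (indicator N)) A = (\<integral>\<^sup>+q. indicator (N \<inter> A) q \<partial>\<sigma>)"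
        using A by (simp add: emeasure_density indicator_inter_arith)
      also have "\<dots> = emeasure \<sigma> (N \<inter> A)" using A by simp
      also have "\<dots> \<le> (\<integral>\<^sup>+x. ennreal C * indicator (Box \<rho> \<inter> \<phi> -` (N \<inter> A)) x \<partial>lborel)"
      proof (rule C(2))
        show "N \<inter> A \<in> sets \<sigma>" using A by auto
      qed (auto simp: N_def)
      also have "\<dots> = (\<integral>\<^sup>+x. ennreal C * indicator (Box \<rho>) x * indicator (\<phi>2 -` A \<inter> space M0) x \<partial>lborel)"
        by (intro nn_integral_cong) (auto simp: \<phi>2_def N_def M0_def split: split_indicator)
      also have "\<dots> = emeasure M0 (\<phi>2 -` A \<inter> space M0)"
        using measurable_sets[OF \<phi>2m] A sp(2) unfolding M0_def
        by (subst emeasure_density) auto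
      also have "\<dots> = emeasure (distr M0 (restrict_space borel S) \<phi>2) A"
        using A sp(2) \<phi>2m by (subst emeasure_distr) auto
      finally show "emeasure (density \<sigma> (indicator N)) A \<le> emeasure (distr M0 (restrict_space borel S) \<phi>2) A" .
    qed
  qed (use sp in simp)
  have "(\<integral>\<^sup>+q. ennreal (F q * indicator N q) \<partial>\<sigma>) = (\<integral>\<^sup>+q. indicator N q * ennreal (F q) \<partial>\<sigma>)"
    by (intro nn_integral_cong) (auto split: split_indicator)
  also have "\<dots> = (\<integral>\<^sup>+q. ennreal (F q) \<partial>density \<sigma> (indicator N))"
    using F\<sigma> by (subst nn_integral_density) auto
  also have "\<dots> \<le> (\<integral>\<^sup>+q. ennreal (F q) \<partial>distr M0 (restrict_space borel S) \<phi>2)"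
    by (rule nn_integral_mono_measure[OF _ le]) (use sp in simp)
  also have "\<dots> = (\<integral>\<^sup>+x. ennreal (F (\<phi>2 x)) \<partial>M0)"
    using \<phi>2m Fr by (subst nn_integral_distr) auto
  also have "\<dots> = (\<integral>\<^sup>+x. ennreal C * indicator (Box \<rho>) x * ennreal (F (\<phi>2 x)) \<partial>lborel)"
    unfolding M0_def using measurable_compose[OF \<phi>2b Fm] by (subst nn_integral_density) auto
  also have "\<dots> = (\<integral>\<^sup>+x. ennreal C * ennreal (h x) \<partial>lborel)"
  \<comment> \<open>The origin is the only parameter in the box at which \<open>F\<close> along the
    chart may differ from \<open>h\<close>; it is a null set.\<close>
  proof (rule nn_integral_cong_AE, use AE_lborel_singleton[of 0] in eventually_elim)
    fix x :: "real ^ 2" assume x: "x \<noteq> 0"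
    show "ennreal C * indicator (Box \<rho>) x * ennreal (F (\<phi>2 x)) = ennreal C * ennreal (h x)"
    proof (cases "x \<in> Box \<rho>")
      case True
      then have "\<phi> x \<in> W0" using W0(2) by (auto simp: N_def)
      moreover have "\<phi> x \<noteq> p" using x phi0 psi_phi by metis
      ultimately have "F (\<phi>2 x) = h x" using True by (simp add: F_def \<phi>2_def)
      then show ?thesis using True by simp
    next
      case False then show ?thesis by (simp add: h_def)
    qed
  qed
  also have "\<dots> = ennreal C * (\<integral>\<^sup>+x. ennreal (h x) \<partial>lborel)" by (rule nn_integral_cmult) measurable
  also have "\<dots> < \<infinity>" using fin by (simp add: ennreal_mult_less_top)
  finally have finF: "(\<integral>\<^sup>+q. ennreal (F q * indicator N q) \<partial>\<sigma>) < \<infinity>" .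
  have "integrable \<sigma> (\<lambda>q. F q * indicator N q)"
    by (rule integrableI_nonneg) (use F\<sigma> finF F_nonneg in auto)
  moreover have "integrable \<sigma> (\<lambda>q. indicator N q * \<bar>H q\<bar>) \<longleftrightarrow> integrable \<sigma> (\<lambda>q. F q * indicator N q)"
    by (rule Bochner_Integration.integrable_cong[OF refl]) (simp only: HF sp)
  ultimately have "set_integrable \<sigma> N (\<lambda>q. \<bar>H q\<bar>)"
    unfolding set_integrable_def real_scaleR_def by blast
  then show ?thesis using N_open pN by blast
qed

end

section \<open>Existence of graph charts and the conclusion\<close>

lemma three_indices:
  fixes i :: 3 obtains j k where "UNIV = {i, j, k}" "i \<noteq> j" "i \<noteq> k" "j \<noteq> k"
proof -
  have ne: "(1::3) \<noteq> 2" "(1::3) \<noteq> 3" "(2::3) \<noteq> 3" by simp_all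
  have U: "UNIV = {1::3, 2, 3}" "UNIV = {2::3, 1, 3}" "UNIV = {3::3, 1, 2}"
    unfolding UNIV_3 by blast+
  consider "i = 1" | "i = 2" | "i = 3" using exhaust_3 by blast
  then show thesis
  proof cases
    case 1 show ?thesis by (rule that[of 2 3]) (simp_all only: 1 U(1)[symmetric] ne not_False_eq_True)
  next
    case 2 show ?thesis by (rule that[of 1 3]) (simp_all only: 2 U(2)[symmetric] ne ne[symmetric] not_False_eq_True)
  next
    case 3 show ?thesis by (rule that[of 1 2]) (simp_all only: 3 U(3)[symmetric] ne ne[symmetric] not_False_eq_True)
  qed
qed

text \<open>A nonzero differential at \<open>p\<close> makes some axis \<open>i\<close> transversal
  to \<open>S\<close>, and the analytic implicit function theorem solves for that
  coordinate.\<close>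

lemma analytic_surface_graph_chart:
  assumes S: "analytic_surface S" and p: "p \<in> S"
  obtains i j k r \<delta> g gx gy where "graph_chart S p i j k r \<delta> g gx gy"
proof -
  obtain U u where u: "local_defining_function S p U u" "real_analytic_on u U"
    using S p unfolding analytic_surface_def by blast
  then have U: "open U" "p \<in> U" "C_on 2 u U" and SU: "S \<inter> U = {q \<in> U. u q = 0}"
    and du: "frechet_derivative u (at p) \<noteq> (\<lambda>v. 0)"
    using p unfolding local_defining_function_def by auto
  have diff: "u differentiable (at p)" using C_on_2_derivative_differentiable(1)[OF U(3,2)] .
  have up: "u p = 0" using SU p U(2) by blast
  obtain i where i: "frechet_derivative u (at p) (axis i 1) \<noteq> 0"
  proof (rule ccontr)
    assume "\<not> thesis"
    then have 0: "frechet_derivative u (at p) (axis i 1) = 0" for i using that by blast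
    have lin: "linear (frechet_derivative u (at p))" using diff by (rule linear_frechet_derivative)
    have "frechet_derivative u (at p) v = 0" for v
    proof -
      have "frechet_derivative u (at p) v = frechet_derivative u (at p) (\<Sum>b\<in>Basis. (v \<bullet> b) *\<^sub>R b)"
        by (simp only: euclidean_representation)
      also have "\<dots> = (\<Sum>b\<in>Basis. (v \<bullet> b) * frechet_derivative u (at p) b)"
        by (simp add: linear_sum[OF lin] linear_cmul[OF lin])
      also have "\<dots> = 0" using 0 by (intro sum.neutral) (auto simp: Basis_vec_def)
      finally show ?thesis .
    qed
    then show False using du by auto
  qed
  obtain j k where ijk: "UNIV = {i, j, k}" "i \<noteq> j" "i \<noteq> k" "j \<noteq> k" using three_indices by blast
  obtain e where e: "e > 0" "ball p e \<subseteq> U" using U(1,2) open_contains_ball by blast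
  \<comment> \<open>Keeps the box inside the ball of radius \<open>e\<close>, where \<open>S\<close>
    is the zero set of \<open>u\<close>.\<close>
  have e3: "e / 3 > 0" using e by simp
  obtain \<rho> \<delta> g where g: "\<rho> > 0" "\<rho> \<le> e / 3" "\<delta> > 0" "\<delta> \<le> e / 3" "biana \<rho> g"
    "\<And>x y. \<bar>x\<bar> < \<rho> \<Longrightarrow> \<bar>y\<bar> < \<rho> \<Longrightarrow> \<bar>g x y\<bar> < \<delta>"
    "\<And>x y z. \<bar>x\<bar> < \<rho> \<Longrightarrow> \<bar>y\<bar> < \<rho> \<Longrightarrow> \<bar>z\<bar> < \<delta> \<Longrightarrow>
       u (p + x *\<^sub>R axis j 1 + y *\<^sub>R axis k 1 + z *\<^sub>R axis i 1) = 0 \<longleftrightarrow> z = g x y"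
    by (rule analytic_implicit_function[OF ijk u(2) U(2) up diff i e3]) blast
  \<comment> \<open>The partial derivatives of \<open>g\<close> have bounded extensions only to
    smaller bidiscs, so the radius is halved.\<close>
  have \<rho>2: "\<rho> / 2 < \<rho>" using g by simp
  obtain gx gy where gxy: "biana (\<rho> / 2) gx" "biana (\<rho> / 2) gy"
    "\<And>x y. \<bar>x\<bar> < \<rho> / 2 \<Longrightarrow> \<bar>y\<bar> < \<rho> / 2 \<Longrightarrow>
      ((\<lambda>(x,y). g x y) has_derivative (\<lambda>(s,t). gx x y * s + gy x y * t)) (at (x, y))"
    using biana_has_derivative[OF g(5) \<rho>2] by metis
  have "graph_chart S p i j k (\<rho> / 2) \<delta> g gx gy"
  proof (rule graph_chart.intro[OF ijk])
    show "biana (\<rho> / 2) g" using g(1,5) biana_mono by force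
    fix q assume q: "\<bar>q $ j - p $ j\<bar> < \<rho> / 2" "\<bar>q $ k - p $ k\<bar> < \<rho> / 2" "\<bar>q $ i - p $ i\<bar> < \<delta>"
    have q_eq: "q = p + (q $ j - p $ j) *\<^sub>R axis j 1 + (q $ k - p $ k) *\<^sub>R axis k 1 + (q $ i - p $ i) *\<^sub>R axis i 1"
      (is "q = ?q")
    proof (rule vec_eq_iff[THEN iffD2], rule allI)
      fix t :: 3
      have "t \<in> {i, j, k}" using ijk(1) by blast
      then show "q $ t = ?q $ t" using ijk(2-4) by (auto simp: axis_def)
    qed
    have "q - p = (q $ j - p $ j) *\<^sub>R axis j 1 + (q $ k - p $ k) *\<^sub>R axis k 1 + (q $ i - p $ i) *\<^sub>R axis i 1"
      using arg_cong[OF q_eq, of "\<lambda>v. v - p"] by (simp add: add.assoc)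
    then have "norm (q - p) \<le> norm ((q $ j - p $ j) *\<^sub>R axis j (1::real)) + norm ((q $ k - p $ k) *\<^sub>R axis k (1::real))
        + norm ((q $ i - p $ i) *\<^sub>R axis i (1::real))"
      by (simp only:) (intro norm_triangle_le add_right_mono norm_triangle_ineq)
    then have "norm (q - p) \<le> \<bar>q $ j - p $ j\<bar> + \<bar>q $ k - p $ k\<bar> + \<bar>q $ i - p $ i\<bar>" by simp
    then have "norm (q - p) < e" using q g(1,2,4) by linarith
    then have "q \<in> ball p e" by (simp add: dist_norm norm_minus_commute)
    then have "q \<in> U" using e by blast
    then have "q \<in> S \<longleftrightarrow> u q = 0" using SU by blast
    also have "\<dots> \<longleftrightarrow> q $ i - p $ i = g (q $ j - p $ j) (q $ k - p $ k)"
      by (subst q_eq, rule g(7)) (use q g(1) in auto)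
    finally show "q \<in> S \<longleftrightarrow> q $ i - p $ i = g (q $ j - p $ j) (q $ k - p $ k)" .
  qed (use g gxy in auto)
  then show thesis by (rule that)
qed

theorem theorem1p3:
  fixes S :: "(real ^ 3) set"
    and G :: "real ^ 3 \<Rightarrow> real ^ 3 \<Rightarrow> real ^ 3 \<Rightarrow> real"
    and \<sigma> :: "(real ^ 3) measure"
    and H :: "real ^ 3 \<Rightarrow> real"
  assumes "analytic_surface S"
    and "\<forall>p \<in> characteristic_set S. p isolated_in characteristic_set S"
    and "riemannian_metric G" and "extends_heisenberg_metric G"
    and "is_riemannian_induced_measure G S \<sigma>"
    and "is_horizontal_mean_curvature S H"
  shows "locally_integrable_on S \<sigma> H"
  unfolding locally_integrable_on_def
proof
  fix p assume p: "p \<in> S"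
  obtain i j k r \<delta> g gx gy where "graph_chart S p i j k r \<delta> g gx gy"
    using analytic_surface_graph_chart[OF assms(1) p] .
  then interpret graph_chart S p i j k r \<delta> g gx gy .
  have phi0: "\<phi> 0 = p"
    using graph[of p] p r g_bound[of 0 0] by (simp add: \<phi>_def)
  have 0: "0 \<in> Box r" using r by (simp add: Box_def)
  \<comment> \<open>At a characteristic point this is isolation, carried to the parameters by
    injectivity of \<open>\<phi>\<close>; elsewhere it is continuity of whichever of
    \<open>G1\<close>, \<open>G2\<close> is nonzero at the origin.\<close>
  have "\<forall>\<^sub>F x in nhds 0. x \<noteq> 0 \<longrightarrow> x \<in> Box r \<longrightarrow> G1 x \<noteq> 0 \<or> G2 x \<noteq> 0"
  proof (cases "p \<in> characteristic_set S")
    case True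
    then obtain T where T: "open T" "T \<inter> characteristic_set S = {p}"
      using assms(2) isolated_inE by metis
    have "isCont \<phi> 0" using phi_has_derivative[OF 0] has_derivative_continuous by blast
    then have "\<forall>\<^sub>F x in nhds 0. \<phi> x \<in> T"
      using T phi0 by (intro isCont_eventually_nhds) auto
    then show ?thesis
    proof eventually_elim
      case (elim x)
      show ?case
      proof (intro impI)
        assume x: "x \<noteq> 0" "x \<in> Box r"
        then have "\<phi> x \<noteq> p" using phi0 psi_phi by metis
        then have "\<phi> x \<notin> characteristic_set S" using elim T by blast
        then show "G1 x \<noteq> 0 \<or> G2 x \<noteq> 0" using characteristic_phi[OF x(2)] by blast
      qed
    qed
  next
    case False
    then have nz: "G1 0 \<noteq> 0 \<or> G2 0 \<noteq> 0" using characteristic_phi[OF 0] phi0 by simp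
    have cont: "isCont f 0" if "biana r (\<lambda>x y. f (vector [x, y]))" for f :: "real ^ 2 \<Rightarrow> real"
    proof -
      have "continuous_on (Box (r / 2)) (\<lambda>x. (\<lambda>(x, y). f (vector [x, y])) (x $ 1, x $ 2))"
        by (rule continuous_on_compose2[OF biana_continuous_on[OF that, of "r / 2"]])
           (use r in \<open>auto simp: Box_def intro!: continuous_intros\<close>)
      then have "continuous_on (Box (r / 2)) f" by simp
      then show ?thesis
        using r open_Box[of "r / 2"] by (simp add: continuous_on_eq_continuous_at Box_def)
    qed
    show ?thesis
    proof (cases "G1 0 \<noteq> 0")
      case True
      have "\<forall>\<^sub>F x in nhds 0. G1 x \<in> - {0}"
        by (rule isCont_eventually_nhds[OF cont[OF biana_G(1)]]) (use True in auto)
      then show ?thesis by eventually_elim auto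
    next
      case False
      have "\<forall>\<^sub>F x in nhds 0. G2 x \<in> - {0}"
        by (rule isCont_eventually_nhds[OF cont[OF biana_G(2)]]) (use False nz in auto)
      then show ?thesis by eventually_elim auto
    qed
  qed
  then obtain e where e: "e > 0" "\<And>x. dist x 0 < e \<Longrightarrow> x \<noteq> 0 \<longrightarrow> x \<in> Box r \<longrightarrow> G1 x \<noteq> 0 \<or> G2 x \<noteq> 0"
    unfolding eventually_nhds_metric by blast
  \<comment> \<open>Half of \<open>e\<close>, because the norm of \<open>x\<close> is estimated by
    the sum of its two coordinates.\<close>
  define \<rho>1 where "\<rho>1 = min r (e / 2)"
  have \<rho>1: "0 < \<rho>1" "\<rho>1 \<le> r" "\<rho>1 \<le> e / 2" using r e by (auto simp: \<rho>1_def)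
  show "\<exists>N. openin (top_of_set S) N \<and> p \<in> N \<and> set_integrable \<sigma> N (\<lambda>q. \<bar>H q\<bar>)"
  proof (rule curvature_integrable[OF assms(3,5,6) p \<rho>1(1,2)])
    fix x assume x: "x \<in> Box \<rho>1" "x \<noteq> 0"
    have "norm x \<le> (\<Sum>i\<in>UNIV. \<bar>x $ i\<bar>)" by (rule norm_le_l1_cart)
    also have "\<dots> < e" using x \<rho>1 by (auto simp: sum_2 Box_def)
    finally show "G1 x \<noteq> 0 \<or> G2 x \<noteq> 0"
      using e(2)[of x] x Box_mono[OF \<rho>1(2)] by auto
  qed
qed

end
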